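(* Let $T$ be the split-merge Markov operator on $\Sigma_1$ and let $E$ be the identity operator, both regarded as operators on the space of Borel probability measures on $\Sigma_1$. For almost all (with respect to the Lebesgue measure) points $x\in\Sigma_1$ with finitely many non-zero coordinates, the sequence of probability measures $$\left(\frac{E+T}{2}\right)^m\delta_x$$ converges weakly as $m\to\infty$ to the Poisson--Dirichlet measure $PD(1)$, where $\delta_x$ is the $\delta$-measure at $x$. That is, for every $n\ge 1$ the convergence holds for almost every $x$ in $\{x\in\Sigma_1: x_i=0 \text{ for all } i>n\}$ with respect to $(n-1)$-dimensional Lebesgue measure on this finite-dimensional simplex.
   Context: $\Sigma_1=\{x=(x_1,x_2,\ldots): x_1\ge x_2\ge\ldots\ge 0,\ \sum_{i=1}^\infty x_i=1\}$ is the infinite-dimensional simplex of non-increasing non-negative sequences with sum one, with the topology of coordinatewise convergence (and its Borel $\sigma$-algebra). For $n=1$ the set $\{x\in\Sigma_1: x_i=0 \text{ for } i>1\}$ is the single point $(1,0,0,\ldots)$, and $0$-dimensional Lebesgue measure is counting measure. Poisson--Dirichlet measure $PD(1)$: let $U_1,U_2,\ldots$ be i.i.d. random variables uniformly distributed on $[0,1]$, and $V_n=U_n\prod_{i=1}^{n-1}(1-U_i)$; then $\sum_{i=1}^\infty V_i=1$ almost surely. $PD(1)$ is the distribution on $\Sigma_1$ of the order statistics $V_{(1)}\ge V_{(2)}\ge\ldots$ of the sequence $V_1,V_2,\ldots$. Split-merge operator $T$: let $V$ denote the operator that arranges the elements of a sequence in non-increasing order. For $x\in\Sigma_1$, $Tx$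 is the random element of $\Sigma_1$ defined by: - for each pair $i<j$, with probability $2x_ix_j$, $Tx=V(x_i+x_j,x_1,\ldots,x_{i-1},x_{i+1},\ldots,x_{j-1},x_{j+1},\ldots)$; - for each $i=1,2,\ldots$, with probability $x_i\,dt$, $t\in[0,x_i]$, $Tx=V(t,x_i-t,x_1,\ldots,x_{i-1},x_{i+1},\ldots)$ (that is, with total probability $x_i^2$ the element $x_i$ is split into $t$ and $x_i-t$ with $t$ uniform on $[0,x_i]$). $T$ acts on a Borel probability measure $\nu$ on $\Sigma_1$ by $T\nu=\int_{\Sigma_1}\mathrm{Law}(Tx)\,d\nu(x)$, and $E\nu=\nu$. *)

theory Defs
  imports "HOL-Probability.Probability"
begin

text \<open>Sequences are functions on \<^typ>\<open>nat\<close>, so the coordinates are numbered from 0. The library's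
  topology on \<^typ>\<open>nat \<Rightarrow> real\<close> is the product topology, that is, coordinatewise convergence.\<close>

definition Sigma1 :: "(nat \<Rightarrow> real) set" where
  "Sigma1 = {x. decseq x \<and> (\<forall>i. 0 \<le> x i) \<and> x sums 1}"

abbreviation Sigma1_borel :: "(nat \<Rightarrow> real) measure" where
  "Sigma1_borel \<equiv> restrict_space borel Sigma1"

text \<open>The operator \<open>V\<close>: coordinate \<open>k\<close> of the rearrangement is the largest \<open>s\<close> such that
  \<open>k + 1\<close> terms are \<open>\<ge> s\<close>. When infinitely many terms are positive, zero terms disappear.
  See \<open>decr_rearr_characterization\<close>.\<close>

definition decr_rearr :: "(nat \<Rightarrow> real) \<Rightarrow> nat \<Rightarrow> real" where
  "decr_rearr y k = (SUP A\<in>{A. card A = Suc k}. Min (y ` A))"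

definition delete_at :: "nat \<Rightarrow> (nat \<Rightarrow> real) \<Rightarrow> nat \<Rightarrow> real" where
  "delete_at i x k = (if k < i then x k else x (Suc k))"

definition merge_parts :: "(nat \<Rightarrow> real) \<Rightarrow> nat \<Rightarrow> nat \<Rightarrow> nat \<Rightarrow> real" where
  "merge_parts x i j = decr_rearr (case_nat (x i + x j) (delete_at i (delete_at j x)))"

definition split_part :: "(nat \<Rightarrow> real) \<Rightarrow> nat \<Rightarrow> real \<Rightarrow> nat \<Rightarrow> real" where
  "split_part x i t = decr_rearr (case_nat t (case_nat (x i - t) (delete_at i x)))"

definition split_merge_law :: "(nat \<Rightarrow> real) \<Rightarrow> (nat \<Rightarrow> real) measure" where
  "split_merge_law x = measure_of Sigma1 (sets Sigma1_borel) (\<lambda>A.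
     (\<Sum>j. \<Sum>i<j. ennreal (2 * x i * x j) * indicator A (merge_parts x i j)) +
     (\<Sum>i. \<integral>\<^sup>+t\<in>{0..x i}. ennreal (x i) * indicator A (split_part x i t) \<partial>lborel))"

definition split_merge :: "(nat \<Rightarrow> real) measure \<Rightarrow> (nat \<Rightarrow> real) measure" where
  "split_merge \<nu> = \<nu> \<bind> split_merge_law"

definition half_sum :: "'a measure \<Rightarrow> 'a measure \<Rightarrow> 'a measure" where
  "half_sum M N = measure_of (space M) (sets M) (\<lambda>A. (emeasure M A + emeasure N A) / 2)"

text \<open>The operator \<open>(E + T) / 2\<close>.\<close>

definition lazy_split_merge :: "(nat \<Rightarrow> real) measure \<Rightarrow> (nat \<Rightarrow> real) measure" where
  "lazy_split_merge \<nu> = half_sum \<nu> (split_merge \<nu>)"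

definition stick_breaking :: "(nat \<Rightarrow> real) \<Rightarrow> nat \<Rightarrow> real" where
  "stick_breaking u n = u n * (\<Prod>i<n. 1 - u i)"

text \<open>The sticks sum to 1 only almost surely, so the law is taken on all sequences first and then
  restricted to the simplex.\<close>

definition PD1 :: "(nat \<Rightarrow> real) measure" where
  "PD1 = restrict_space
     (distr (\<Pi>\<^sub>M i\<in>UNIV. uniform_measure lborel {0..1}) borel (\<lambda>u. decr_rearr (stick_breaking u)))
     Sigma1"

definition weakly_converges ::
    "(nat \<Rightarrow> (nat \<Rightarrow> real) measure) \<Rightarrow> (nat \<Rightarrow> real) measure \<Rightarrow> bool" where
  "weakly_converges \<mu> \<nu> \<longleftrightarrow>
     (\<forall>f :: (nat \<Rightarrow> real) \<Rightarrow> real. continuous_on Sigma1 f \<longrightarrow> bounded (f ` Sigma1) \<longrightarrow>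
        (\<lambda>m. \<integral>x. f x \<partial>\<mu> m) \<longlonglongrightarrow> (\<integral>x. f x \<partial>\<nu>))"

text \<open>Lebesgue measure on the points of \<^const>\<open>Sigma1\<close> supported on the first \<open>n\<close> coordinates, in the
  affine chart given by the first \<open>n - 1\<close> coordinates. Euclidean surface measure is \<open>sqrt n\<close> times
  this measure, so the null sets are the same. For \<open>n = 1\<close> the product measure lives on the
  one-point function space \<open>\<Pi>\<^sub>E i\<in>{}. UNIV\<close> and has mass 1.\<close>

definition simplex_point :: "nat \<Rightarrow> (nat \<Rightarrow> real) \<Rightarrow> nat \<Rightarrow> real" where
  "simplex_point n y i =
     (if i < n - 1 then y i else if i = n - 1 then 1 - (\<Sum>k<n - 1. y k) else 0)"

definition face_lebesgue :: "nat \<Rightarrow> (nat \<Rightarrow> real) measure" where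
  "face_lebesgue n =
     restrict_space (distr (\<Pi>\<^sub>M i\<in>{..<n - 1}. lborel) borel (simplex_point n)) Sigma1"

text \<open>Well-definedness of the notions above: the explicit set functions are measures, the split-merge
  law is a Markov kernel on \<^const>\<open>Sigma1\<close>, and the maps used as push-forwards are measurable.\<close>


lemma decr_rearr_less_iff:
  assumes "\<And>i. 0 \<le> y i" "y \<longlonglongrightarrow> 0" "0 < t"
  shows "finite {i. t \<le> y i}" "t \<le> decr_rearr y k \<longleftrightarrow> k < card {i. t \<le> y i}"
proof -
  have "\<forall>\<^sub>F i in sequentially. y i < t" using assms(2,3) by (rule order_tendstoD)
  then show fin: "finite {i. t \<le> y i}"
    unfolding eventually_cofinite[symmetric] cofinite_eq_sequentially[symmetric] 
    by (simp add: eventually_cofinite not_less)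
  obtain B where B: "\<And>i. y i \<le> B"
    using convergent_imp_Bseq[OF convergentI[OF assms(2)]] by (auto simp: Bseq_def) (metis abs_le_D1)
  have bdd: "bdd_above ((\<lambda>A. Min (y ` A)) ` {A. card A = Suc k})"
  proof (rule bdd_aboveI2)
    fix A :: "nat set" assume "A \<in> {A. card A = Suc k}"
    then have "finite A" "A \<noteq> {}" by (auto intro: card_ge_0_finite)
    then show "Min (y ` A) \<le> B" by (auto simp: Min_le_iff B)
  qed
  show "t \<le> decr_rearr y k \<longleftrightarrow> k < card {i. t \<le> y i}"
  proof
    assume "k < card {i. t \<le> y i}"
    then obtain A where A: "A \<subseteq> {i. t \<le> y i}" "card A = Suc k"
      by (meson Suc_leI obtain_subset_with_card_n)
    then have "finite A" "A \<noteq> {}" by (auto intro: card_ge_0_finite)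
    then have "t \<le> Min (y ` A)" using A by auto
    also have "\<dots> \<le> decr_rearr y k" unfolding decr_rearr_def by (rule cSUP_upper[OF _ bdd]) (simp add: A)
    finally show "t \<le> decr_rearr y k" .
  next
    assume le: "t \<le> decr_rearr y k"
    show "k < card {i. t \<le> y i}"
    proof (rule ccontr)
      assume n: "\<not> k < card {i. t \<le> y i}"
      have "finite {i. t/2 \<le> y i}"
      proof -
        have "\<forall>\<^sub>F i in sequentially. y i < t/2" using assms(2,3) by (intro order_tendstoD) auto
        then show ?thesis
          by (simp add: cofinite_eq_sequentially[symmetric] eventually_cofinite not_less)
      qed
      define s where "s = Max (insert (t/2) (y ` {i. t/2 \<le> y i \<and> y i < t}))"
      have f: "finite {i. t/2 \<le> y i \<and> y i < t}" using \<open>finite {i. t/2 \<le> y i}\<close> by (rule rev_finite_subset) auto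
      have s: "s < t" unfolding s_def using f assms(3) by (subst Max_less_iff) auto
      have s2: "y i \<le> s" if "y i < t" for i
      proof (cases "t/2 \<le> y i")
        case True then show ?thesis unfolding s_def using f that by (intro Max_ge) auto
      next
        case False
        have "t/2 \<le> s" unfolding s_def using f by (intro Max_ge) auto
        then show ?thesis using False by simp
      qed
      have "decr_rearr y k \<le> s" unfolding decr_rearr_def
      proof (rule cSUP_least)
        show "{A::nat set. card A = Suc k} \<noteq> {}" by (metis (mono_tags) card_atMost empty_Collect_eq)
        fix A :: "nat set" assume A: "A \<in> {A. card A = Suc k}"
        then have fA: "finite A" "A \<noteq> {}" by (auto intro: card_ge_0_finite)
        have "\<not> A \<subseteq> {i. t \<le> y i}" using card_mono[OF fin, of A] A n by auto
        then obtain i where "i \<in> A" "\<not> t \<le> y i" by blast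
        then show "Min (y ` A) \<le> s" using fA s2[of i] by (force simp: Min_le_iff not_le)
      qed
      with s le show False by simp
    qed
  qed
qed

lemma decr_rearr_nonneg:
  assumes "\<And>i. 0 \<le> y i" "y \<longlonglongrightarrow> 0" shows "0 \<le> decr_rearr y k"
proof -
  obtain B where B: "\<And>i. y i \<le> B"
    using convergent_imp_Bseq[OF convergentI[OF assms(2)]] by (auto simp: Bseq_def) (metis abs_le_D1)
  have bdd: "bdd_above ((\<lambda>A. Min (y ` A)) ` {A. card A = Suc k})"
  proof (rule bdd_aboveI2)
    fix A :: "nat set" assume "A \<in> {A. card A = Suc k}"
    then have "finite A" "A \<noteq> {}" by (auto intro: card_ge_0_finite)
    then show "Min (y ` A) \<le> B" by (auto simp: Min_le_iff B)
  qed
  have "0 \<le> Min (y ` {..k})" using assms by (subst Min_ge_iff) auto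
  also have "\<dots> \<le> decr_rearr y k" unfolding decr_rearr_def by (rule cSUP_upper[OF _ bdd]) simp
  finally show ?thesis .
qed

lemma decr_rearr_characterization:
  assumes "\<And>i. 0 \<le> y i" "y \<longlonglongrightarrow> 0"
  shows "decseq (decr_rearr y)" "0 \<le> decr_rearr y k"
    and "0 < t \<Longrightarrow> finite {i. y i = t}" 
    and "0 < t \<Longrightarrow> finite {i. decr_rearr y i = t}" 
    and "0 < t \<Longrightarrow> card {i. decr_rearr y i = t} = card {i. y i = t}"
proof -
  note L = decr_rearr_less_iff[OF assms]
  note nn = decr_rearr_nonneg[OF assms]
  show "0 \<le> decr_rearr y k" by (rule nn)
  show "decseq (decr_rearr y)"
  proof (rule decseq_SucI)
    fix n show "decr_rearr y (Suc n) \<le> decr_rearr y n"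
    proof (cases "decr_rearr y (Suc n) > 0")
      case True
      have "Suc n < card {i. decr_rearr y (Suc n) \<le> y i}"
        using L(2)[OF True, of "Suc n"] by blast
      then show ?thesis using L(2)[OF True, of n] by linarith
    qed (use nn[of n] in auto)
  qed
  assume t: "0 < t"
  show f1: "finite {i. y i = t}" by (rule finite_subset[OF _ L(1)[OF t]]) auto
  have f2: "finite {i. t \<le> decr_rearr y i}" using L(2)[OF t] by simp
  then show "finite {i. decr_rearr y i = t}" by (rule rev_finite_subset) auto
  have f3: "finite {i. t < y i}" by (rule finite_subset[OF _ L(1)[OF t]]) auto
  have f4: "finite {i. t < decr_rearr y i}" by (rule finite_subset[OF _ f2]) auto
  have "\<exists>s>t. {i. s \<le> y i} = {i. t < y i} \<and> {i. s \<le> decr_rearr y i} = {i. t < decr_rearr y i}"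
  proof -
    let ?S = "insert (t+1) (y ` {i. t < y i} \<union> decr_rearr y ` {i. t < decr_rearr y i})"
    have "Min ?S > t" using f3 f4 by (subst Min_gr_iff) auto
    moreover have "s \<in> ?S \<Longrightarrow> Min ?S \<le> s" for s using f3 f4 by (intro Min_le) auto
    ultimately obtain m where m: "m > t" "\<And>s. s \<in> ?S \<Longrightarrow> m \<le> s" by blast
    have "m \<le> y i" if "t < y i" for i using m(2) that by simp
    moreover have "m \<le> decr_rearr y i" if "t < decr_rearr y i" for i using m(2) that by simp
    ultimately have "{i. m \<le> y i} = {i. t < y i}" "{i. m \<le> decr_rearr y i} = {i. t < decr_rearr y i}"
      using less_le_trans[OF m(1)] by (blast, blast)
    then show ?thesis using m(1) by blast
  qed
  then obtain s where s: "s > t" "{i. s \<le> y i} = {i. t < y i}" "{i. s \<le> decr_rearr y i} = {i. t < decr_rearr y i}" by blast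
  have gt: "card {i. t < decr_rearr y i} = card {i. t < y i}"
  proof -
    have "{i. s \<le> decr_rearr y i} = {..<card {i. s \<le> y i}}" using L(2)[of s] s(1) t by auto
    then have "card {i. s \<le> decr_rearr y i} = card {i. s \<le> y i}" by (metis card_lessThan)
    then show ?thesis by (simp only: s(2,3))
  qed
  have ge: "card {i. t \<le> decr_rearr y i} = card {i. t \<le> y i}" using L(2)[OF t] by simp
  have "card {i. z i = t} = card {i. t \<le> z i} - card {i. t < z i}" if "finite {i. t < z i}" for z :: "nat \<Rightarrow> real"
  proof -
    have "{i. z i = t} = {i. t \<le> z i} - {i. t < z i}" by auto
    moreover have "{i. t < z i} \<subseteq> {i. t \<le> z i}" by auto
    ultimately show ?thesis by (simp only: card_Diff_subset[OF that])
  qed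
  then show "card {i. decr_rearr y i = t} = card {i. y i = t}" using f3 f4 gt ge by simp
qed

lemma nn_sum_layer:
  fixes z :: "nat \<Rightarrow> real"
  assumes "\<And>i. 0 \<le> z i" "\<And>t. t > 0 \<Longrightarrow> finite {i. t \<le> z i}"
  shows "(\<Sum>i. ennreal (z i)) = (\<integral>\<^sup>+t. ennreal (card {i. t \<le> z i}) * indicator {0<..} t \<partial>lborel)"
proof -
  have "ennreal (z i) = (\<integral>\<^sup>+t. indicator {0<..z i} t \<partial>lborel)" for i
    using assms(1)[of i] by simp
  then have "(\<Sum>i. ennreal (z i)) = (\<integral>\<^sup>+t. (\<Sum>i. indicator {0<..z i} t) \<partial>lborel)"
    by (simp add: nn_integral_suminf)
  also have "\<dots> = (\<integral>\<^sup>+t. ennreal (card {i. t \<le> z i}) * indicator {0<..} t \<partial>lborel)"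
  proof (rule nn_integral_cong)
    fix t
    show "(\<Sum>i. indicator {0<..z i} t) = ennreal (card {i. t \<le> z i}) * indicator {0<..} t"
    proof (cases "t > 0")
      case True
      have "(\<Sum>i. indicator {0<..z i} t :: ennreal) = (\<Sum>i\<in>{i. t \<le> z i}. indicator {0<..z i} t)"
        using assms(2)[OF True] by (intro suminf_finite) (auto simp: indicator_def)
      also have "\<dots> = (\<Sum>i\<in>{i. t \<le> z i}. 1)" using True by (intro sum.cong) auto
      finally show ?thesis using True by (simp add: ennreal_of_nat_eq_real_of_nat)
    qed (simp add: indicator_def)
  qed
  finally show ?thesis .
qed

lemma decr_rearr_sums:
  assumes "\<And>i. 0 \<le> y i" "y sums s"
  shows "decr_rearr y sums s"
proof -
  have y0: "y \<longlonglongrightarrow> 0" using assms(2) by (intro summable_LIMSEQ_zero) (auto simp: sums_iff)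
  note L = decr_rearr_less_iff[OF assms(1) y0]
  note nn = decr_rearr_nonneg[OF assms(1) y0]
  have "(\<Sum>i. ennreal (decr_rearr y i)) = (\<Sum>i. ennreal (y i))"
    by (subst (1 2) nn_sum_layer) (use assms L nn in \<open>auto intro!: nn_integral_cong simp: indicator_def\<close>)
  also have "\<dots> = ennreal s" using assms by (simp add: suminf_ennreal_eq sums_iff)
  finally have e: "(\<Sum>i. ennreal (decr_rearr y i)) = ennreal s" .
  then have sm: "summable (decr_rearr y)" by (intro summable_suminf_not_top nn) auto
  have "s \<ge> 0" using assms by (metis sums_le sums_zero)
  moreover have "suminf (decr_rearr y) \<ge> 0" by (intro suminf_nonneg sm nn)
  ultimately have "suminf (decr_rearr y) = s" using e suminf_ennreal2[OF nn sm] by simp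
  then show ?thesis using sm by (simp add: sums_iff)
qed

lemma decr_rearr_Sigma1:
  assumes "\<And>i. 0 \<le> y i" "y sums 1" shows "decr_rearr y \<in> Sigma1"
proof -
  have y0: "y \<longlonglongrightarrow> 0" using assms(2) by (intro summable_LIMSEQ_zero) (auto simp: sums_iff)
  show ?thesis unfolding Sigma1_def using decr_rearr_sums[OF assms] decr_rearr_characterization(1,2)[OF assms(1) y0] by auto
qed

lemma delete_at_sums:
  assumes "x sums s" shows "delete_at i x sums (s - x i)"
proof -
  have "(\<lambda>k. x (k + Suc i)) sums (s - (\<Sum>k<Suc i. x k))"
    by (rule sums_split_initial_segment[OF assms])
  then have "(\<lambda>k. delete_at i x (k + i)) sums (s - (\<Sum>k<Suc i. x k))" by (simp add: delete_at_def)
  then have "delete_at i x sums (s - (\<Sum>k<Suc i. x k) + (\<Sum>k<i. delete_at i x k))"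
    by (simp add: sums_iff_shift)
  also have "(\<Sum>k<i. delete_at i x k) = (\<Sum>k<i. x k)" by (simp add: delete_at_def)
  finally show ?thesis by simp
qed

lemma case_nat_sums: "x sums s \<Longrightarrow> case_nat a x sums (a + s)" for a :: real
  using sums_Suc_iff[of "case_nat a x" s] by (simp add: add.commute)

lemma merge_parts_Sigma1:
  assumes "x \<in> Sigma1" "i < j" shows "merge_parts x i j \<in> Sigma1"
  unfolding merge_parts_def
proof (rule decr_rearr_Sigma1)
  show "0 \<le> case_nat (x i + x j) (delete_at i (delete_at j x)) k" for k
    using assms by (auto simp: Sigma1_def delete_at_def split: nat.split)
  have "delete_at i (delete_at j x) sums (1 - x j - delete_at j x i)" using assms by (intro delete_at_sums) (auto simp: Sigma1_def)
  from case_nat_sums[OF this, of "x i + x j"] show "case_nat (x i + x j) (delete_at i (delete_at j x)) sums 1"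
    using assms(2) by (simp add: delete_at_def[of j x i])
qed

lemma split_part_Sigma1:
  assumes "x \<in> Sigma1" "0 \<le> t" "t \<le> x i" shows "split_part x i t \<in> Sigma1"
  unfolding split_part_def
proof (rule decr_rearr_Sigma1)
  show "0 \<le> case_nat t (case_nat (x i - t) (delete_at i x)) k" for k
    using assms by (auto simp: Sigma1_def delete_at_def split: nat.split)
  have "delete_at i x sums (1 - x i)" using assms by (intro delete_at_sums) (auto simp: Sigma1_def)
  from case_nat_sums[OF case_nat_sums[OF this, of "x i - t"], of t] 
  show "case_nat t (case_nat (x i - t) (delete_at i x)) sums 1" by simp
qed

lemma meas_coord: "(\<lambda>x. x i) \<in> borel_measurable (borel :: (nat \<Rightarrow> real) measure)"
  by (intro borel_measurable_continuous_onI continuous_on_product_coordinates)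

lemma meas_seq: "(\<And>i. (\<lambda>x. f x i) \<in> borel_measurable M) \<Longrightarrow> f \<in> M \<rightarrow>\<^sub>M (borel :: (nat \<Rightarrow> real) measure)"
  by (rule measurable_coordinatewise_then_product)

lemma borel_measurable_SUP_real:
  fixes F :: "_ \<Rightarrow> _ \<Rightarrow> real"
  assumes "countable I" "\<And>i. i \<in> I \<Longrightarrow> F i \<in> borel_measurable M"
  shows "(\<lambda>x. SUP i\<in>I. F i x) \<in> borel_measurable M"
proof -
  have "(SUP i\<in>I. F i x) = - (INF i\<in>I. - F i x)" for x by (simp add: Inf_real_def image_image)
  then show ?thesis using assms by (simp add: borel_measurable_cINF_real)
qed

lemma meas_decr_rearr [measurable]: "decr_rearr \<in> borel \<rightarrow>\<^sub>M borel"
proof (rule meas_seq)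
  fix k
  have c: "countable {A::nat set. card A = Suc k}"
    by (rule countable_subset[OF _ countable_Collect_finite]) (auto intro: card_ge_0_finite)
  show "(\<lambda>y. decr_rearr y k) \<in> borel_measurable borel" unfolding decr_rearr_def
    by (intro borel_measurable_SUP_real[OF c] borel_measurable_Min meas_coord) (auto intro: card_ge_0_finite)
qed

lemma sets_Sigma1 [measurable]: "Sigma1 \<in> sets borel"
proof -
  have *: "{x\<in>space M. (\<forall>n. c (Suc n) x \<le> c n x) \<and> (\<forall>i. 0 \<le> c i x) \<and> (\<lambda>n. \<Sum>k<n. c k x) \<longlonglongrightarrow> 1} \<in> sets M"
    if [measurable]: "\<And>i. c i \<in> borel_measurable M" for c :: "nat \<Rightarrow> (nat \<Rightarrow> real) \<Rightarrow> real" and M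
  proof -
    have "Measurable.pred M (\<lambda>x. (\<lambda>n. \<Sum>k<n. c k x) \<longlonglongrightarrow> 1)"
      by (rule measurable_limit) simp
    moreover have "Measurable.pred M (\<lambda>x. c (Suc n) x \<le> c n x)" for n
      unfolding pred_def by (rule borel_measurable_le[OF that that])
    moreover have "Measurable.pred M (\<lambda>x. 0 \<le> c n x)" for n
      unfolding pred_def by (rule borel_measurable_le[OF borel_measurable_const that])
    ultimately show ?thesis by measurable
  qed
  have "Sigma1 = {x\<in>space borel. (\<forall>n. x (Suc n) \<le> x n) \<and> (\<forall>i. 0 \<le> x i) \<and> (\<lambda>n. \<Sum>k<n. x k) \<longlonglongrightarrow> 1}"
    by (auto simp: Sigma1_def decseq_Suc_iff sums_def)
  then show ?thesis using *[of "\<lambda>i x. x i", OF meas_coord] by simp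
qed

lemma meas_delete_at:
  "(\<And>k. (\<lambda>x. f x k) \<in> borel_measurable M) \<Longrightarrow> (\<lambda>x. delete_at i (f x) k) \<in> borel_measurable M"
  by (cases "k < i") (auto simp: delete_at_def)

lemma meas_merge [measurable]: "(\<lambda>x. merge_parts x i j) \<in> borel \<rightarrow>\<^sub>M borel"
  unfolding merge_parts_def
proof (rule measurable_compose[OF meas_seq meas_decr_rearr])
  show "(\<lambda>x. case_nat (x i + x j) (delete_at i (delete_at j x)) k) \<in> borel_measurable borel" for k
    by (cases k) (auto intro!: meas_coord meas_delete_at borel_measurable_add)
qed

lemma meas_split [measurable]: "(\<lambda>(x, t). split_part x i t) \<in> borel \<Otimes>\<^sub>M borel \<rightarrow>\<^sub>M borel"
  unfolding split_part_def case_prod_beta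
proof (rule measurable_compose[OF meas_seq meas_decr_rearr])
  have c: "(\<lambda>p::(nat \<Rightarrow> real) \<times> real. fst p i) \<in> borel_measurable (borel \<Otimes>\<^sub>M borel)" for i
    by (rule measurable_compose[OF measurable_fst meas_coord])
  show "(\<lambda>p. case_nat (snd p) (case_nat (fst p i - snd p) (delete_at i (fst p))) k) \<in> borel_measurable (borel \<Otimes>\<^sub>M borel)" for k
    by (cases k; cases "k - 1") (auto intro!: c meas_delete_at borel_measurable_diff)
qed

lemma sets_Sigma1_borel: "A \<in> sets Sigma1_borel \<longleftrightarrow> A \<in> sets borel \<and> A \<subseteq> Sigma1"
  using sets_restrict_space_iff[where \<Omega>=Sigma1 and M=borel and A=A] sets_Sigma1 by auto

lemma space_split_merge_law [simp]: "space (split_merge_law x) = Sigma1"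
  unfolding split_merge_law_def by (rule space_measure_of) (auto simp: sets_Sigma1_borel)

lemma sets_split_merge_law [simp, measurable_cong]: "sets (split_merge_law x) = sets Sigma1_borel"
proof -
  have "sigma_algebra Sigma1 (sets Sigma1_borel)"
  proof -
    have "sigma_algebra (space Sigma1_borel) (sets Sigma1_borel)" by (rule sets.sigma_algebra_axioms)
    then show ?thesis by (simp add: space_restrict_space)
  qed
  then show ?thesis unfolding split_merge_law_def by (rule sigma_algebra.sets_measure_of_eq)
qed

lemma ennreal_suminf_swap: "(\<Sum>n. \<Sum>i. f n i) = (\<Sum>i. \<Sum>n. f n i :: ennreal)" for f :: "nat \<Rightarrow> nat \<Rightarrow> ennreal"
proof -
  have "(\<Sum>n. \<Sum>i. f n i) = (\<Sum>n. \<integral>\<^sup>+i. f n i \<partial>count_space UNIV)"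
    by (simp only: nn_integral_count_space_nat)
  also have "\<dots> = (\<integral>\<^sup>+i. (\<Sum>n. f n i) \<partial>count_space UNIV)" by (subst nn_integral_suminf) auto
  finally show ?thesis by (simp only: nn_integral_count_space_nat)
qed

lemma emeasure_split_merge_law:
  assumes "A \<in> sets Sigma1_borel"
  shows "emeasure (split_merge_law x) A =
     (\<Sum>j. \<Sum>i<j. ennreal (2 * x i * x j) * indicator A (merge_parts x i j)) +
     (\<Sum>i. \<integral>\<^sup>+t\<in>{0..x i}. ennreal (x i) * indicator A (split_part x i t) \<partial>lborel)"
proof (rule emeasure_measure_of[OF split_merge_law_def])
  show "A \<in> sets (split_merge_law x)" using assms by simp
  let ?\<mu> = "\<lambda>A. (\<Sum>j. \<Sum>i<j. ennreal (2 * x i * x j) * indicator A (merge_parts x i j)) +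
     (\<Sum>i. \<integral>\<^sup>+t\<in>{0..x i}. ennreal (x i) * indicator A (split_part x i t) \<partial>lborel)"
  show "sets Sigma1_borel \<subseteq> Pow Sigma1" by (auto simp: sets_Sigma1_borel)
  show "positive (sets (split_merge_law x)) ?\<mu>" by (simp add: positive_def)
  show "countably_additive (sets (split_merge_law x)) ?\<mu>" unfolding sets_split_merge_law
  proof (rule countably_additiveI)
    fix F :: "nat \<Rightarrow> _" assume F: "range F \<subseteq> sets Sigma1_borel" "disjoint_family F"
    have [measurable]: "F n \<in> sets borel" for n using F(1) sets_Sigma1_borel by auto
    have [measurable]: "split_part x i \<in> borel \<rightarrow>\<^sub>M borel" for i
    proof -
      have "(\<lambda>t. case (x, t) of (x, t) \<Rightarrow> split_part x i t) \<in> borel \<rightarrow>\<^sub>M borel"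
        by (rule measurable_compose[OF measurable_Pair1' meas_split]) simp
      then show ?thesis by simp
    qed
    have i: "indicator (\<Union>n. F n) z = (\<Sum>n. indicator (F n) z :: ennreal)" for z
      using suminf_indicator[OF F(2)] by simp
    have 1: "(\<Sum>n. \<Sum>j. \<Sum>i<j. ennreal (2 * x i * x j) * indicator (F n) (merge_parts x i j)) =
      (\<Sum>j. \<Sum>i<j. ennreal (2 * x i * x j) * indicator (\<Union>n. F n) (merge_parts x i j))"
    proof -
      have "(\<Sum>n. \<Sum>j. \<Sum>i<j. ennreal (2 * x i * x j) * indicator (F n) (merge_parts x i j)) = 
        (\<Sum>j. \<Sum>n. \<Sum>i<j. ennreal (2 * x i * x j) * indicator (F n) (merge_parts x i j))"
        by (rule ennreal_suminf_swap)
      also have "\<dots> = (\<Sum>j. \<Sum>i<j. ennreal (2 * x i * x j) * indicator (\<Union>n. F n) (merge_parts x i j))"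
        by (subst suminf_sum) (auto simp: i)
      finally show ?thesis .
    qed
    have 2: "(\<Sum>n. \<Sum>i. \<integral>\<^sup>+t\<in>{0..x i}. ennreal (x i) * indicator (F n) (split_part x i t) \<partial>lborel) =
      (\<Sum>i. \<integral>\<^sup>+t\<in>{0..x i}. ennreal (x i) * indicator (\<Union>n. F n) (split_part x i t) \<partial>lborel)"
    proof -
      have "(\<Sum>n. \<Sum>i. \<integral>\<^sup>+t\<in>{0..x i}. ennreal (x i) * indicator (F n) (split_part x i t) \<partial>lborel) =
         (\<Sum>i. \<Sum>n. \<integral>\<^sup>+t\<in>{0..x i}. ennreal (x i) * indicator (F n) (split_part x i t) \<partial>lborel)"
        by (rule ennreal_suminf_swap)
      also have "\<dots> = (\<Sum>i. \<integral>\<^sup>+t. (\<Sum>n. ennreal (x i) * indicator (F n) (split_part x i t) * indicator {0..x i} t) \<partial>lborel)"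
        by (subst nn_integral_suminf) auto
      finally show ?thesis by (simp add: i)
    qed
    show "(\<Sum>n. ?\<mu> (F n)) = ?\<mu> (\<Union>n. F n)"
      by (simp only: suminf_add[OF summableI summableI, symmetric] 1 2)
  qed
qed
lemma prob_space_split_merge_law:
  assumes x: "x \<in> Sigma1"
  shows "prob_space (split_merge_law x)"
proof
  have nn: "0 \<le> x i" for i using x by (simp add: Sigma1_def)
  have sm: "summable x" "suminf x = 1" using x by (auto simp: Sigma1_def sums_iff)
  have x1: "(\<Sum>i. ennreal (x i)) = 1" using suminf_ennreal2[OF nn sm(1)] sm(2) by simp
  define g where "g i j = ennreal (x i) * ennreal (x j)" for i j
  have S: "Sigma1 \<in> sets Sigma1_borel" by (simp add: sets_Sigma1_borel sets_Sigma1)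
  have "(\<integral>\<^sup>+t\<in>{0..x i}. ennreal (x i) * indicator Sigma1 (split_part x i t) \<partial>lborel) = g i i" for i
  proof -
    have "(\<integral>\<^sup>+t\<in>{0..x i}. ennreal (x i) * indicator Sigma1 (split_part x i t) \<partial>lborel)
      = (\<integral>\<^sup>+t. ennreal (x i) * indicator {0..x i} t \<partial>lborel)"
      by (intro nn_integral_cong) (auto simp: indicator_def split_part_Sigma1[OF x])
    also have "\<dots> = g i i" by (simp add: nn_integral_cmult_indicator nn g_def)
    finally show ?thesis .
  qed
  moreover have "(\<Sum>i<j. ennreal (2 * x i * x j) * indicator Sigma1 (merge_parts x i j)) = (\<Sum>i<j. g i j) + (\<Sum>i<j. g j i)" for j
  proof -
    have "(\<Sum>i<j. ennreal (2 * x i * x j) * indicator Sigma1 (merge_parts x i j)) = (\<Sum>i<j. g i j + g j i)"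
    proof (rule sum.cong[OF refl])
      fix i assume "i \<in> {..<j}"
      then have "merge_parts x i j \<in> Sigma1" using merge_parts_Sigma1[OF x] by simp
      moreover have "ennreal (2 * x i * x j) = g i j + g j i"
        unfolding g_def using nn by (simp add: ennreal_mult[symmetric] ennreal_plus[symmetric] del: ennreal_plus)
      ultimately show "ennreal (2 * x i * x j) * indicator Sigma1 (merge_parts x i j) = g i j + g j i" by simp
    qed
    then show ?thesis by (simp add: sum.distrib)
  qed
  ultimately have "emeasure (split_merge_law x) Sigma1 =
     (\<Sum>j. (\<Sum>i<j. g i j) + (\<Sum>i<j. g j i)) + (\<Sum>i. g i i)"
    by (subst emeasure_split_merge_law[OF S]) simp
  also have "\<dots> = (\<Sum>j. \<Sum>i. g j i)"
  proof -
    have fin: "(\<Sum>i. f i * indicator {..<j} i) = (\<Sum>i<j. f i)" for f :: "nat \<Rightarrow> ennreal" and j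
      by (subst suminf_finite[of "{..<j}"]) (auto simp: indicator_def)
    have "(\<Sum>j. \<Sum>i<j. g i j) = (\<Sum>j. \<Sum>i. g j i * indicator {j<..} i)"
    proof -
      have "(\<Sum>j. \<Sum>i<j. g i j) = (\<Sum>j. \<Sum>i. g i j * indicator {..<j} i)" by (simp add: fin)
      also have "\<dots> = (\<Sum>i. \<Sum>j. g i j * indicator {..<j} i)" by (rule ennreal_suminf_swap)
      finally show ?thesis by (simp add: indicator_def)
    qed
    moreover have "g j j = (\<Sum>i. g j i * indicator {j} i)" for j
      by (subst suminf_finite[of "{j}"]) (auto simp: indicator_def)
    ultimately have "(\<Sum>j. (\<Sum>i<j. g i j) + (\<Sum>i<j. g j i)) + (\<Sum>i. g i i) =
      (\<Sum>j. \<Sum>i. g j i * indicator {j<..} i) + (\<Sum>j. \<Sum>i. g j i * indicator {..<j} i) + (\<Sum>j. \<Sum>i. g j i * indicator {j} i)"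
      by (simp add: suminf_add[symmetric] fin)
    also have "\<dots> = (\<Sum>j. \<Sum>i. g j i * indicator {j<..} i + g j i * indicator {..<j} i + g j i * indicator {j} i)"
      by (simp add: suminf_add)
    also have "\<dots> = (\<Sum>j. \<Sum>i. g j i)"
      by (intro suminf_cong) (auto simp: indicator_def)
    finally show ?thesis .
  qed
  also have "\<dots> = 1" by (simp add: g_def ennreal_suminf_cmult x1)
  finally show "emeasure (split_merge_law x) (space (split_merge_law x)) = 1" by simp
qed

lemma measurable_split_merge_law [measurable]:
  "split_merge_law \<in> Sigma1_borel \<rightarrow>\<^sub>M prob_algebra Sigma1_borel"
proof (rule measurable_prob_algebraI[OF _ measurable_subprob_algebra])
  fix A assume A: "A \<in> sets Sigma1_borel"
  then have [measurable]: "A \<in> sets borel" by (simp add: sets_Sigma1_borel)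
  have c[measurable]: "(\<lambda>x. x i) \<in> borel_measurable Sigma1_borel" for i
    by (intro measurable_restrict_space1 meas_coord)
  have c2[measurable]: "(\<lambda>p. fst p i) \<in> borel_measurable (Sigma1_borel \<Otimes>\<^sub>M (lborel :: real measure))" for i
    by (rule measurable_compose[OF measurable_fst c])
  have m: "(\<lambda>x. merge_parts x i j) \<in> Sigma1_borel \<rightarrow>\<^sub>M borel" for i j
    by (intro measurable_restrict_space1 meas_merge)
  have m2[measurable]: "(\<lambda>x. indicator A (merge_parts x i j) :: ennreal) \<in> borel_measurable Sigma1_borel" for i j
    by (rule measurable_compose[OF m]) simp
  have s: "(\<lambda>p. split_part (fst p) i (snd p)) \<in> (Sigma1_borel \<Otimes>\<^sub>M lborel) \<rightarrow>\<^sub>M borel" for i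
  proof -
    have "(\<lambda>p. (fst p, snd p)) \<in> (Sigma1_borel \<Otimes>\<^sub>M lborel) \<rightarrow>\<^sub>M (borel \<Otimes>\<^sub>M (borel :: real measure))"
      by (intro measurable_Pair measurable_compose[OF measurable_fst] measurable_restrict_space1 measurable_ident_sets) 
         (auto intro!: measurable_compose[OF measurable_snd])
    from measurable_compose[OF this meas_split[of i]] show ?thesis by simp
  qed
  have s2[measurable]: "(\<lambda>p. indicator A (split_part (fst p) i (snd p)) :: ennreal) \<in> borel_measurable (Sigma1_borel \<Otimes>\<^sub>M lborel)" for i
    by (rule measurable_compose[OF s]) simp
  have i: "(\<lambda>p. indicator {0..fst p i} (snd p) :: ennreal) \<in> borel_measurable (Sigma1_borel \<Otimes>\<^sub>M (lborel :: real measure))" for i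
  proof -
    have sn: "snd \<in> borel_measurable (Sigma1_borel \<Otimes>\<^sub>M (lborel :: real measure))"
      using measurable_snd[of Sigma1_borel "lborel :: real measure"] by simp
    have "(\<lambda>p :: (nat \<Rightarrow> real) \<times> real. indicator {0..fst p i} (snd p) :: ennreal) = (\<lambda>p. if 0 \<le> snd p \<and> snd p \<le> fst p i then 1 else 0)"
      by (auto simp: indicator_def fun_eq_iff)
    also have "\<dots> \<in> borel_measurable (Sigma1_borel \<Otimes>\<^sub>M (lborel :: real measure))"
      by (intro measurable_If measurable_const sets.sets_Collect_conj borel_measurable_le
        borel_measurable_const sn c2)
    finally show ?thesis .
  qed
  have "(\<lambda>x. \<integral>\<^sup>+t\<in>{0..x i}. ennreal (x i) * indicator A (split_part x i t) \<partial>lborel) \<in> borel_measurable Sigma1_borel" for i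
    by (rule lborel.borel_measurable_nn_integral, unfold case_prod_beta)
       (intro borel_measurable_times_ennreal i s2 measurable_compose[OF c2 measurable_ennreal])
  then show "(\<lambda>x. emeasure (split_merge_law x) A) \<in> borel_measurable Sigma1_borel"
    unfolding emeasure_split_merge_law[OF A] 
    by (intro borel_measurable_add borel_measurable_suminf_order borel_measurable_sum borel_measurable_times_ennreal m2
      measurable_compose[OF _ measurable_ennreal] borel_measurable_times c borel_measurable_const) auto
qed (auto simp: space_restrict_space prob_space_split_merge_law intro!: prob_space_imp_subprob_space)

lemma sets_half_sum [simp]: "sets (half_sum M N) = sets M"
  and space_half_sum [simp]: "space (half_sum M N) = space M"
  by (simp_all add: half_sum_def)

lemma emeasure_half_sum:
  assumes "sets N = sets M" "A \<in> sets M"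
  shows "emeasure (half_sum M N) A = (emeasure M A + emeasure N A) / 2"
proof (rule emeasure_measure_of[OF half_sum_def])
  show "sets M \<subseteq> Pow (space M)" by (rule sets.space_closed)
  show "A \<in> sets (half_sum M N)" using assms by simp
  show "positive (sets (half_sum M N)) (\<lambda>A. (emeasure M A + emeasure N A) / 2)"
    by (simp add: positive_def)
  show "countably_additive (sets (half_sum M N)) (\<lambda>A. (emeasure M A + emeasure N A) / 2)"
    using assms(1) by (intro countably_additiveI)
      (simp add: divide_ennreal_def ennreal_suminf_multc suminf_add[symmetric] suminf_emeasure)
qed

lemma prob_space_PD1_base: "prob_space (\<Pi>\<^sub>M i\<in>(UNIV::nat set). uniform_measure lborel {0..1::real})"
  by (intro prob_space_PiM prob_space_uniform_measure) auto

lemma measurable_PD1: "(\<lambda>u. decr_rearr (stick_breaking u)) \<in> (\<Pi>\<^sub>M i\<in>UNIV. uniform_measure lborel {0..1}) \<rightarrow>\<^sub>M borel"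
proof (rule measurable_compose[OF meas_seq meas_decr_rearr])
  show "(\<lambda>u. stick_breaking u k) \<in> borel_measurable (\<Pi>\<^sub>M i\<in>UNIV. uniform_measure lborel {0..1})" for k
    unfolding stick_breaking_def by measurable
qed

lemma measurable_simplex_point: "simplex_point n \<in> (\<Pi>\<^sub>M i\<in>{..<n - 1}. lborel) \<rightarrow>\<^sub>M borel"
proof (rule meas_seq)
  show "(\<lambda>u. simplex_point n u k) \<in> borel_measurable (\<Pi>\<^sub>M i\<in>{..<n-1}. lborel)" for k
    unfolding simplex_point_def 
    by (cases "k < n-1"; cases "k = n - 1") (auto intro!: borel_measurable_diff borel_measurable_sum measurable_component_singleton[THEN measurable_compose])
qed

lemma emeasure_split_merge:
  assumes "\<nu> \<in> space (prob_algebra Sigma1_borel)" "A \<in> sets Sigma1_borel"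
  shows "emeasure (split_merge \<nu>) A = (\<integral>\<^sup>+x. emeasure (split_merge_law x) A \<partial>\<nu>)"
  unfolding split_merge_def
  by (rule emeasure_bind_prob_algebra[OF assms(1) measurable_split_merge_law assms(2)])

lemma lazy_split_merge_prob_algebra:
  assumes "\<nu> \<in> space (prob_algebra Sigma1_borel)"
  shows "lazy_split_merge \<nu> \<in> space (prob_algebra Sigma1_borel)"
proof -
  have \<nu>: "sets \<nu> = sets Sigma1_borel" "prob_space \<nu>" using assms by (auto simp: space_prob_algebra)
  have s: "sets (split_merge \<nu>) = sets Sigma1_borel" "prob_space (split_merge \<nu>)"
    unfolding split_merge_def
    using sets_bind'[OF assms measurable_split_merge_law] prob_space_bind'[OF assms measurable_split_merge_law]
    by blast+
  have sp: "space (split_merge \<nu>) = space \<nu>" using \<nu>(1) s(1) by (metis sets_eq_imp_space_eq)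
  have top: "space \<nu> \<in> sets Sigma1_borel" using \<nu>(1) by (metis sets.top)
  have "prob_space (lazy_split_merge \<nu>)"
  proof
    have "emeasure (lazy_split_merge \<nu>) (space \<nu>) = (1 + 1) / 2"
      unfolding lazy_split_merge_def
      using \<nu> s prob_space.emeasure_space_1[OF \<nu>(2)] prob_space.emeasure_space_1[OF s(2)]
      by (subst emeasure_half_sum) (simp_all add: sp top)
    then show "emeasure (lazy_split_merge \<nu>) (space (lazy_split_merge \<nu>)) = 1"
      by (simp add: lazy_split_merge_def)
  qed
  then show ?thesis using \<nu>(1) by (simp add: space_prob_algebra lazy_split_merge_def)
qed

end

theory Submission imports Defs "HOL-Real_Asymp.Real_Asymp" begin

text \<open>For \<open>\<theta> = 1\<close> the split-merge chain is reversible with respect to the \<open>\<sigma>\<close>-finite measure with density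
  \<open>\<Prod>\<^sub>i 1 / x\<^sub>i\<close> on the finite-dimensional faces of the simplex. Started at \<open>(1, 0, 0, \<dots>)\<close>, the lazy chain
  after \<open>N - 1\<close> steps has density \<open>Q\<^sub>N(x) / N\<close> with respect to it, \<open>Q\<^sub>N(x)\<close> being the probability that \<open>N\<close>
  independent points drawn according to \<open>x\<close> hit every part: these are the cycle masses of a uniform
  permutation of \<open>N\<close> points carrying uniform spacings. By inclusion-exclusion \<open>Q\<^sub>N\<close> is explicit, and the
  step from \<open>N\<close> to \<open>N + 1\<close> is a polynomial identity.

  In size-biased order these laws are stick breaking with uniform sticks, stopped late; hence they
  converge to \<open>PD(1)\<close>. They give \<open>(1, 0, 0, \<dots>)\<close> mass at least \<open>1 / N\<close>, whose sum diverges, so this point is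
  recurrent; and they dominate Lebesgue measure on each face, so from almost every point of a face
  the chain reaches \<open>(1, 0, 0, \<dots>)\<close> almost surely and then converges as well.\<close>


section \<open>Lebesgue measure on the simplex\<close>

text \<open>Convergence in total variation is impossible: from a point with finitely many parts the
  chain keeps finitely many parts, whereas almost every point for \<open>PD1\<close> has infinitely
  many. The explicit laws are therefore compared with stick breaking through Lipschitz test
  functions only. Laziness enters through the polynomial identity: \<open>T\<close> sends the weight
  \<open>Q_N\<close> to \<open>2 * N / (N + 1) * Q_{N+1} - Q_N\<close>, and the contribution of
  \<open>E\<close> is exactly the \<open>Q_N\<close> that removes the negative term. The estimates
  of integrals under the chain are lower bounds for nonnegative functions. Such bounds pass through
  monotone limits, and they survive when the paths that have not yet visited (1, 0, 0, ...) are
  discarded. No path space is constructed: visits are expressed by iterating the operator dual to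
  one step. Two lower bounds, for \<open>f + B\<close> and for \<open>B - f\<close>, give the
  convergence for a bounded \<open>f\<close>.\<close>

lemma measurable_coord [measurable (raw)]:
  "(\<lambda>x. x i) \<in> borel_measurable (borel :: (nat \<Rightarrow> real) measure)"
  "(\<lambda>x. fst x i) \<in> borel_measurable ((borel :: (nat \<Rightarrow> real) measure) \<Otimes>\<^sub>M M)"
  "(\<lambda>x. snd x i) \<in> borel_measurable (M \<Otimes>\<^sub>M (borel :: (nat \<Rightarrow> real) measure))"
  by (rule meas_coord measurable_compose[OF measurable_fst meas_coord]
    measurable_compose[OF measurable_snd meas_coord])+

lemma measurable_case_nat_seq [measurable (raw)]:
  assumes [measurable]: "f \<in> borel_measurable M" "g \<in> M \<rightarrow>\<^sub>M (borel :: (nat \<Rightarrow> real) measure)"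
  shows "(\<lambda>x. case_nat (f x) (g x)) \<in> M \<rightarrow>\<^sub>M (borel :: (nat \<Rightarrow> real) measure)"
proof (rule meas_seq)
  show "(\<lambda>x. case_nat (f x) (g x) i) \<in> borel_measurable M" for i
    using measurable_compose[OF assms(2) meas_coord] assms(1) by (cases i) simp_all
qed

lemma measurable_delete_at [measurable (raw)]:
  assumes [measurable]: "f \<in> M \<rightarrow>\<^sub>M borel" shows "(\<lambda>x. delete_at i (f x)) \<in> M \<rightarrow>\<^sub>M borel"
  using measurable_compose[OF assms meas_coord] by (intro meas_seq meas_delete_at)

lemma measurable_tail [measurable (raw)]:
  assumes [measurable]: "f \<in> M \<rightarrow>\<^sub>M (borel :: (nat \<Rightarrow> real) measure)"
  shows "(\<lambda>x. f x \<circ> Suc) \<in> M \<rightarrow>\<^sub>M (borel :: (nat \<Rightarrow> real) measure)"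
  using measurable_compose[OF assms meas_coord] by (intro meas_seq) (simp add: comp_def)

lemma case_nat_o_Suc [simp]: "case_nat t y \<circ> Suc = y" by auto

lemma nn_integral_open_closed:
  fixes f :: "real \<Rightarrow> ennreal"
  shows "(\<integral>\<^sup>+t. f t * indicator {0<..<s} t \<partial>lborel) = (\<integral>\<^sup>+t. f t * indicator {0..s} t \<partial>lborel)"
proof (rule nn_integral_cong_AE)
  have "AE t in lborel. t \<noteq> (0::real) \<and> t \<noteq> s" by (intro AE_conjI AE_lborel_singleton)
  then show "AE t in lborel. f t * indicator {0<..<s} t = f t * indicator {0..s} t"
    by eventually_elim (auto simp: indicator_def)
qed

abbreviation zeros :: "nat \<Rightarrow> real" where "zeros \<equiv> \<lambda>_. 0"

text \<open>Lebesgue integral over the points with \<open>k + 1\<close> positive parts and sum \<open>s\<close>, in the chart given by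
  the first \<open>k\<close> parts.\<close>

fun simplex_nn :: "nat \<Rightarrow> real \<Rightarrow> ((nat \<Rightarrow> real) \<Rightarrow> ennreal) \<Rightarrow> ennreal" where
  "simplex_nn 0 s g = g (case_nat s zeros)"
| "simplex_nn (Suc k) s g =
     (\<integral>\<^sup>+t. simplex_nn k (s - t) (\<lambda>y. g (case_nat t y)) * indicator {0<..<s} t \<partial>lborel)"

text \<open>Every unfolding of \<open>simplex_nn\<close> frees one more real parameter. Packing the
  parameters into a sequence keeps their type fixed: the new coordinate \<open>t\<close> is pushed
  onto the front of the parameter and \<open>h\<close> pops it again, so the induction hypothesis
  applies to \<open>h\<close>.\<close>

lemma measurable_simplex_nn_seq:
  fixes g :: "(nat \<Rightarrow> real) \<Rightarrow> (nat \<Rightarrow> real) \<Rightarrow> ennreal"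
  assumes "(\<lambda>x. g (fst x) (snd x)) \<in> borel_measurable (borel \<Otimes>\<^sub>M borel)"
  shows "(\<lambda>x. simplex_nn k (snd x) (g (fst x))) \<in> borel_measurable (borel \<Otimes>\<^sub>M borel)"
  using assms
proof (induction k arbitrary: g)
  case 0
  have "(\<lambda>x. (fst x, case_nat (snd x) zeros)) \<in>
      (borel \<Otimes>\<^sub>M borel) \<rightarrow>\<^sub>M ((borel :: (nat \<Rightarrow> real) measure) \<Otimes>\<^sub>M (borel :: (nat \<Rightarrow> real) measure))" by measurable
  from measurable_compose[OF this 0] show ?case by simp
next
  case (Suc k)
  define h where "h q y = g (q \<circ> Suc) (case_nat (q 0) y)" for q y :: "nat \<Rightarrow> real"
  have "(\<lambda>x. (fst x \<circ> Suc, case_nat (fst x 0) (snd x))) \<in>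
      (borel \<Otimes>\<^sub>M borel) \<rightarrow>\<^sub>M ((borel :: (nat \<Rightarrow> real) measure) \<Otimes>\<^sub>M (borel :: (nat \<Rightarrow> real) measure))" by measurable
  from measurable_compose[OF this Suc.prems]
  have "(\<lambda>x. h (fst x) (snd x)) \<in> borel_measurable (borel \<Otimes>\<^sub>M borel)" unfolding h_def fst_conv snd_conv .
  have hc: "h (case_nat t p) = (\<lambda>y. g p (case_nat t y))" for t p by (simp add: h_def fun_eq_iff)
  from Suc.IH[OF \<open>(\<lambda>x. h (fst x) (snd x)) \<in> _\<close>]
  have IH: "(\<lambda>x. simplex_nn k (snd x) (h (fst x))) \<in> borel_measurable (borel \<Otimes>\<^sub>M borel)" .
  have "(\<lambda>z. (case_nat (snd z) (fst (fst z)), snd (fst z) - snd z)) \<in>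
     ((borel \<Otimes>\<^sub>M borel) \<Otimes>\<^sub>M lborel) \<rightarrow>\<^sub>M ((borel :: (nat \<Rightarrow> real) measure) \<Otimes>\<^sub>M (borel :: real measure))"
    by measurable
  from measurable_compose[OF this IH]
  have 1: "(\<lambda>z. simplex_nn k (snd (fst z) - snd z) (\<lambda>y. g (fst (fst z)) (case_nat (snd z) y)))
      \<in> borel_measurable ((borel \<Otimes>\<^sub>M borel) \<Otimes>\<^sub>M lborel)"
    by (simp add: hc)
  have 2: "(\<lambda>z. indicator {0<..<snd (fst z)} (snd z) :: ennreal) \<in> borel_measurable (((borel :: (nat \<Rightarrow> real) measure) \<Otimes>\<^sub>M (borel :: real measure)) \<Otimes>\<^sub>M lborel)"
  proof -
    have "(\<lambda>z::((nat\<Rightarrow>real)\<times>real)\<times>real. indicator {0<..<snd (fst z)} (snd z) :: ennreal) = (\<lambda>z. if 0 < snd z \<and> snd z < snd (fst z) then 1 else 0)"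
      by (auto simp: fun_eq_iff indicator_def)
    then show ?thesis by simp
  qed
  have "(\<lambda>x. \<integral>\<^sup>+t. simplex_nn k (snd (fst (x,t)) - snd (x,t)) (\<lambda>y. g (fst (fst (x,t))) (case_nat (snd (x,t)) y)) * indicator {0<..<snd (fst (x,t))} (snd (x,t)) \<partial>lborel) \<in> borel_measurable (borel \<Otimes>\<^sub>M borel)"
    by (rule sigma_finite_measure.borel_measurable_nn_integral[OF sigma_finite_lborel])
       (use borel_measurable_times_ennreal[OF 1 2] in \<open>simp add: case_prod_beta\<close>)
  then show ?case by simp
qed

lemma measurable_simplex_nn:
  fixes g :: "real \<Rightarrow> real \<Rightarrow> (nat \<Rightarrow> real) \<Rightarrow> ennreal"
  assumes g: "(\<lambda>x. g (fst (fst x)) (snd (fst x)) (snd x)) \<in> borel_measurable ((borel \<Otimes>\<^sub>M borel) \<Otimes>\<^sub>M borel)"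
    and [measurable]: "a \<in> borel_measurable M" "b \<in> borel_measurable M" "s \<in> borel_measurable M"
  shows "(\<lambda>x. simplex_nn k (s x) (g (a x) (b x))) \<in> borel_measurable M"
proof -
  have "(\<lambda>x. ((fst x 0, fst x 1), snd x)) \<in>
      ((borel :: (nat \<Rightarrow> real) measure) \<Otimes>\<^sub>M (borel :: (nat \<Rightarrow> real) measure)) \<rightarrow>\<^sub>M ((borel \<Otimes>\<^sub>M borel) \<Otimes>\<^sub>M borel)"
    by measurable
  from measurable_compose[OF this g]
  have "(\<lambda>x. g (fst x 0) (fst x 1) (snd x)) \<in> borel_measurable ((borel :: (nat \<Rightarrow> real) measure) \<Otimes>\<^sub>M borel)" by simp
  from measurable_simplex_nn_seq[OF this]
  have 1: "(\<lambda>x. simplex_nn k (snd x) (g (fst x 0) (fst x 1))) \<in> borel_measurable ((borel :: (nat \<Rightarrow> real) measure) \<Otimes>\<^sub>M borel)" .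
  have "(\<lambda>x. (case_nat (a x) (case_nat (b x) zeros), s x)) \<in> M \<rightarrow>\<^sub>M ((borel :: (nat \<Rightarrow> real) measure) \<Otimes>\<^sub>M borel)"
    by measurable
  from measurable_compose[OF this 1] show ?thesis by simp
qed


lemma measurable_simplex_nn_1:
  fixes g :: "real \<Rightarrow> (nat \<Rightarrow> real) \<Rightarrow> ennreal"
  assumes [measurable]: "(\<lambda>x. g (fst x) (snd x)) \<in> borel_measurable (borel \<Otimes>\<^sub>M borel)"
   "a \<in> borel_measurable M" "s \<in> borel_measurable M"
  shows "(\<lambda>x. simplex_nn k (s x) (g (a x))) \<in> borel_measurable M"
proof (rule measurable_simplex_nn[where g="\<lambda>t _. g t" and b="\<lambda>_. 0"])
  have "(\<lambda>x::(real\<times>real)\<times>(nat\<Rightarrow>real). (fst (fst x), snd x)) \<in> (borel \<Otimes>\<^sub>M borel) \<Otimes>\<^sub>M borel \<rightarrow>\<^sub>M borel \<Otimes>\<^sub>M borel" by measurable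
  from measurable_compose[OF this assms(1)]
  show "(\<lambda>x. g (fst (fst x)) (snd x)) \<in> borel_measurable ((borel \<Otimes>\<^sub>M (borel :: real measure)) \<Otimes>\<^sub>M borel)" by simp
qed measurable

text \<open>The integrals run over open intervals, so only points with \<open>k + 1\<close> strictly
  positive parts of sum \<open>s\<close> count. This is how positivity becomes available in the
  later pointwise computations with \<open>1 / y i\<close>.\<close>

lemma simplex_nn_mono:
  assumes "0 < s"
    and "\<And>y. (\<And>i. i \<le> k \<Longrightarrow> 0 < y i) \<Longrightarrow> (\<And>i. k < i \<Longrightarrow> y i = 0) \<Longrightarrow> (\<Sum>i\<le>k. y i) = s \<Longrightarrow> g y \<le> h y"
  shows "simplex_nn k s g \<le> simplex_nn k s h"
  using assms
proof (induction k arbitrary: s g h)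
  case 0
  show ?case using 0(1) by (auto intro!: 0(2) split: nat.split)
next
  case (Suc k)
  have "simplex_nn k (s - t) (\<lambda>y. g (case_nat t y)) \<le> simplex_nn k (s - t) (\<lambda>y. h (case_nat t y))"
    if "t \<in> {0<..<s}" for t
  proof (rule Suc.IH)
    show "0 < s - t" using that by simp
    fix y assume y: "\<And>i. i \<le> k \<Longrightarrow> 0 < y i" "\<And>i. k < i \<Longrightarrow> y i = 0" "(\<Sum>i\<le>k. y i) = s - t"
    show "g (case_nat t y) \<le> h (case_nat t y)"
      using y that by (intro Suc.prems(2)) (auto split: nat.split simp del: sum.atMost_Suc simp: sum.atMost_Suc_shift)
  qed
  then show ?case by (auto intro!: nn_integral_mono simp: indicator_def)
qed

lemma simplex_nn_cong:
  assumes "0 < s"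
    and "\<And>y. (\<And>i. i \<le> k \<Longrightarrow> 0 < y i) \<Longrightarrow> (\<And>i. k < i \<Longrightarrow> y i = 0) \<Longrightarrow> (\<Sum>i\<le>k. y i) = s \<Longrightarrow> g y = h y"
  shows "simplex_nn k s g = simplex_nn k s h"
  using assms by (intro antisym simplex_nn_mono) auto

lemma simplex_nn_cmult:
  assumes [measurable]: "g \<in> borel_measurable borel"
  shows "simplex_nn k s (\<lambda>y. c * g y) = c * simplex_nn k s g"
  using assms
proof (induction k arbitrary: s g)
  case (Suc k)
  note [measurable] = Suc.prems
  have "simplex_nn k (s - t) (\<lambda>y. c * g (case_nat t y)) = c * simplex_nn k (s - t) (\<lambda>y. g (case_nat t y))" for t
    by (rule Suc.IH) measurable
  moreover have "(\<lambda>t. simplex_nn k (s - t) (\<lambda>y. g (case_nat t y))) \<in> borel_measurable lborel"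
    by (rule measurable_simplex_nn_1[where a="\<lambda>t. t"]) measurable
  ultimately show ?case by (simp add: mult.assoc nn_integral_cmult)
qed simp

lemma simplex_nn_add:
  assumes [measurable]: "g \<in> borel_measurable borel" "h \<in> borel_measurable borel"
  shows "simplex_nn k s (\<lambda>y. g y + h y) = simplex_nn k s g + simplex_nn k s h"
  using assms
proof (induction k arbitrary: s g h)
  case (Suc k)
  note [measurable] = Suc.prems
  have "simplex_nn k (s - t) (\<lambda>y. g (case_nat t y) + h (case_nat t y)) = 
    simplex_nn k (s - t) (\<lambda>y. g (case_nat t y)) + simplex_nn k (s - t) (\<lambda>y. h (case_nat t y))" for t
    by (rule Suc.IH) measurable
  moreover have "(\<lambda>t. simplex_nn k (s - t) (\<lambda>y. g (case_nat t y))) \<in> borel_measurable lborel"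
    "(\<lambda>t. simplex_nn k (s - t) (\<lambda>y. h (case_nat t y))) \<in> borel_measurable lborel"
    by (rule measurable_simplex_nn_1[where a="\<lambda>t. t"]; measurable)+
  ultimately show ?case by (simp add: distrib_right nn_integral_add)
qed simp

lemma simplex_nn_zero [simp]: "simplex_nn k s (\<lambda>_. 0) = 0"
  by (induction k arbitrary: s) auto

lemma simplex_nn_sum:
  assumes "finite I" "\<And>i. i \<in> I \<Longrightarrow> g i \<in> borel_measurable borel"
  shows "simplex_nn k s (\<lambda>y. \<Sum>i\<in>I. g i y) = (\<Sum>i\<in>I. simplex_nn k s (g i))"
  using assms by (induction I) (simp_all add: simplex_nn_add)

lemma simplex_nn_nn_integral:
  fixes h :: "real \<Rightarrow> (nat \<Rightarrow> real) \<Rightarrow> ennreal"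
  assumes [measurable]: "(\<lambda>x. h (fst x) (snd x)) \<in> borel_measurable (borel \<Otimes>\<^sub>M borel)"
  shows "simplex_nn k s (\<lambda>y. \<integral>\<^sup>+t. h t y \<partial>lborel) = (\<integral>\<^sup>+t. simplex_nn k s (h t) \<partial>lborel)"
  using assms
proof (induction k arbitrary: s h)
  case (Suc k)
  note [measurable] = Suc.prems
  have c: "(\<lambda>x. h (fst x) (case_nat t (snd x))) \<in> borel_measurable (borel \<Otimes>\<^sub>M borel)" for t :: real
  proof -
    have "(\<lambda>x. (fst x, case_nat t (snd x))) \<in> (borel :: real measure) \<Otimes>\<^sub>M borel \<rightarrow>\<^sub>M borel \<Otimes>\<^sub>M borel" by measurable
    from measurable_compose[OF this Suc.prems] show ?thesis by simp
  qed
  have c2: "(\<lambda>x. h (fst (fst x)) (case_nat (snd (fst x)) (snd x))) \<in> borel_measurable ((borel \<Otimes>\<^sub>M borel) \<Otimes>\<^sub>M borel)"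
  proof -
    have "(\<lambda>x. (fst (fst x), case_nat (snd (fst x)) (snd x))) \<in> ((borel :: real measure) \<Otimes>\<^sub>M (borel :: real measure)) \<Otimes>\<^sub>M borel \<rightarrow>\<^sub>M borel \<Otimes>\<^sub>M borel" by measurable
    from measurable_compose[OF this Suc.prems] show ?thesis by simp
  qed
  have m: "(\<lambda>p. simplex_nn k (s - snd p) (\<lambda>y. h (fst p) (case_nat (snd p) y))) \<in> borel_measurable (lborel \<Otimes>\<^sub>M lborel)"
    by (rule measurable_simplex_nn[OF c2]) measurable
  have "simplex_nn (Suc k) s (\<lambda>y. \<integral>\<^sup>+t. h t y \<partial>lborel) =
    (\<integral>\<^sup>+u. (\<integral>\<^sup>+t. simplex_nn k (s - u) (\<lambda>y. h t (case_nat u y)) \<partial>lborel) * indicator {0<..<s} u \<partial>lborel)"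
    by (simp add: Suc.IH[OF c])
  also have "\<dots> = (\<integral>\<^sup>+u. (\<integral>\<^sup>+t. simplex_nn k (s - u) (\<lambda>y. h t (case_nat u y)) * indicator {0<..<s} u \<partial>lborel) \<partial>lborel)"
    using measurable_compose[OF measurable_Pair2' m, of _ ] by (intro nn_integral_cong nn_integral_multc[symmetric]) simp
  also have "\<dots> = (\<integral>\<^sup>+t. (\<integral>\<^sup>+u. simplex_nn k (s - u) (\<lambda>y. h t (case_nat u y)) * indicator {0<..<s} u \<partial>lborel) \<partial>lborel)"
  proof (rule lborel_pair.Fubini')
    show "(\<lambda>(t, u). simplex_nn k (s - u) (\<lambda>y. h t (case_nat u y)) * indicator {0<..<s} u) \<in> borel_measurable (lborel \<Otimes>\<^sub>M lborel)"
      unfolding case_prod_beta by (intro borel_measurable_times_ennreal m) measurable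
  qed
  finally show ?case by simp
qed simp

section \<open>Symmetry in the parts, and merging of two parts\<close>

definition swap01 :: "(nat \<Rightarrow> real) \<Rightarrow> nat \<Rightarrow> real" where
  "swap01 y = case_nat (y 1) (case_nat (y 0) (y \<circ> Suc \<circ> Suc))"

lemma swap01_case_nat [simp]: "swap01 (case_nat t (case_nat u y)) = case_nat u (case_nat t y)"
  by (simp add: swap01_def)

lemma measurable_swap01 [measurable]: "swap01 \<in> borel \<rightarrow>\<^sub>M borel"
  unfolding swap01_def by measurable

lemma indicator_triangle:
  "(indicator {0<..<s - t} u :: ennreal) * indicator {0<..<s} t = (if 0 < t \<and> 0 < u \<and> t + u < s then 1 else 0)"
  for s t u :: real by (auto simp: indicator_def)

lemma simplex_nn_two:
  assumes [measurable]: "g \<in> borel_measurable borel"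
  shows "simplex_nn (Suc (Suc k)) s g =
   (\<integral>\<^sup>+t. \<integral>\<^sup>+u. simplex_nn k (s - t - u) (\<lambda>y. g (case_nat t (case_nat u y))) *
      (if 0 < t \<and> 0 < u \<and> t + u < s then 1 else 0) \<partial>lborel \<partial>lborel)"
    and "(\<lambda>(t, u). simplex_nn k (s - t - u) (\<lambda>y. g (case_nat t (case_nat u y))) *
      (if 0 < t \<and> 0 < u \<and> t + u < s then 1 else 0)) \<in> borel_measurable (lborel \<Otimes>\<^sub>M lborel)"
proof -
  have m: "(\<lambda>p. simplex_nn k (s - fst p - snd p) (\<lambda>y. g (case_nat (fst p) (case_nat (snd p) y)))) \<in> borel_measurable (lborel \<Otimes>\<^sub>M lborel)"
    by (rule measurable_simplex_nn) measurable
  have mt: "(\<lambda>u. simplex_nn k (s - t - u) (\<lambda>y. g (case_nat t (case_nat u y)))) \<in> borel_measurable lborel" for t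
    by (rule measurable_simplex_nn) measurable
  show "(\<lambda>(t, u). simplex_nn k (s - t - u) (\<lambda>y. g (case_nat t (case_nat u y))) *
      (if 0 < t \<and> 0 < u \<and> t + u < s then 1 else 0)) \<in> borel_measurable (lborel \<Otimes>\<^sub>M lborel)"
    unfolding case_prod_beta by (intro borel_measurable_times_ennreal m) measurable
  show "simplex_nn (Suc (Suc k)) s g =
   (\<integral>\<^sup>+t. \<integral>\<^sup>+u. simplex_nn k (s - t - u) (\<lambda>y. g (case_nat t (case_nat u y))) *
      (if 0 < t \<and> 0 < u \<and> t + u < s then 1 else 0) \<partial>lborel \<partial>lborel)"
    unfolding simplex_nn.simps using mt
    by (subst nn_integral_multc[symmetric]) (auto simp: mult.assoc indicator_triangle)
qed

text \<open>With two or more free coordinates this is Fubini, since the region \<open>t > 0\<close>,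
  \<open>u > 0\<close>, \<open>t + u < s\<close> is symmetric. With \<open>k = 0\<close> the second
  part is not a free coordinate but \<open>s - t\<close>, and the exchange is the reflection of the
  interval.\<close>

lemma simplex_nn_swap01:
  assumes [measurable]: "g \<in> borel_measurable borel"
  shows "simplex_nn (Suc k) s (\<lambda>y. g (swap01 y)) = simplex_nn (Suc k) s g"
proof (cases k)
  case 0
  have "simplex_nn (Suc 0) s g = (\<integral>\<^sup>+t. g (case_nat t (case_nat (s - t) zeros)) * indicator {0<..<s} t \<partial>lborel)"
    by simp
  also have "\<dots> = (\<integral>\<^sup>+t. g (case_nat (s - t) (case_nat t zeros)) * indicator {0<..<s} (s - t) \<partial>lborel)"
    by (subst nn_integral_real_affine[where c="-1" and t=s]) auto
  also have "\<dots> = simplex_nn (Suc 0) s (\<lambda>y. g (swap01 y))"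
    by (auto intro!: nn_integral_cong simp: indicator_def)
  finally show ?thesis using 0 by simp
next
  case (Suc j)
  have [measurable]: "(\<lambda>y. g (swap01 y)) \<in> borel_measurable borel" by measurable
  show ?thesis unfolding Suc simplex_nn_two(1)[OF assms] lborel_pair.Fubini'[OF simplex_nn_two(2)[OF assms], symmetric]
    by (subst simplex_nn_two(1), measurable) (auto intro!: nn_integral_cong simp: algebra_simps)
qed

text \<open>The substitution of \<open>z 0 = t + u\<close> for the second part \<open>u\<close> has
  determinant 1: a point with \<open>k + 2\<close> parts becomes a point with \<open>k + 1\<close>
  parts together with a cut \<open>t\<close> of the first. For \<open>k = 0\<close> both sides
  unfold to the same integral.\<close>

lemma simplex_nn_merge:
  assumes [measurable]: "g \<in> borel_measurable borel"
  shows "simplex_nn (Suc k) s g =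
    simplex_nn k s (\<lambda>z. \<integral>\<^sup>+t. g (case_nat t (case_nat (z 0 - t) (z \<circ> Suc))) * indicator {0<..<z 0} t \<partial>lborel)"
proof (cases k)
  case (Suc j)
  let ?h = "\<lambda>z t y. g (case_nat t (case_nat (z - t) y)) * indicator {0<..<z} t"
  have i: "(indicator {0<..<z} t :: ennreal) = (if 0 < t \<and> t < z then 1 else 0)" for z t :: real by (auto simp: indicator_def)
  have m1: "(\<lambda>p. simplex_nn j (s - snd p) (?h (snd p) (fst p)) * indicator {0<..<s} (snd p)) \<in> borel_measurable (lborel \<Otimes>\<^sub>M lborel)"
    by (intro borel_measurable_times_ennreal measurable_simplex_nn[where a=snd and b=fst and g="?h"]) (auto simp: i)
  have m2: "(\<lambda>x. ?h z (fst x) (snd x)) \<in> borel_measurable (borel \<Otimes>\<^sub>M borel)" for z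
    unfolding i by measurable
  have "simplex_nn k s (\<lambda>z. \<integral>\<^sup>+t. g (case_nat t (case_nat (z 0 - t) (z \<circ> Suc))) * indicator {0<..<z 0} t \<partial>lborel)
    = (\<integral>\<^sup>+z. simplex_nn j (s - z) (\<lambda>y. \<integral>\<^sup>+t. ?h z t y \<partial>lborel) * indicator {0<..<s} z \<partial>lborel)"
    by (simp add: Suc)
  also have "\<dots> = (\<integral>\<^sup>+z. (\<integral>\<^sup>+t. simplex_nn j (s - z) (?h z t) * indicator {0<..<s} z \<partial>lborel) \<partial>lborel)"
  proof -
    have "(\<lambda>t. simplex_nn j (s - z) (?h z t)) \<in> borel_measurable lborel" for z
      by (rule measurable_simplex_nn_1[OF m2]) auto
    then show ?thesis by (simp add: simplex_nn_nn_integral[OF m2] nn_integral_multc)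
  qed
  also have "\<dots> = (\<integral>\<^sup>+t. (\<integral>\<^sup>+z. simplex_nn j (s - z) (?h z t) * indicator {0<..<s} z \<partial>lborel) \<partial>lborel)"
    using m1 by (intro lborel_pair.Fubini') (simp add: case_prod_beta)
  also have "\<dots> = (\<integral>\<^sup>+t. (\<integral>\<^sup>+u. simplex_nn j (s - (t + u)) (?h (t + u) t) * indicator {0<..<s} (t + u) \<partial>lborel) \<partial>lborel)"
  proof (rule nn_integral_cong)
    fix t :: real
    have "(\<lambda>z. (t, z)) \<in> lborel \<rightarrow>\<^sub>M lborel \<Otimes>\<^sub>M lborel" by measurable
    from measurable_compose[OF this m1]
    have "(\<lambda>z. simplex_nn j (s - z) (?h z t) * indicator {0<..<s} z) \<in> borel_measurable borel" by simp
    from nn_integral_real_affine[OF this, of 1 t]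
    show "(\<integral>\<^sup>+z. simplex_nn j (s - z) (?h z t) * indicator {0<..<s} z \<partial>lborel) =
      (\<integral>\<^sup>+u. simplex_nn j (s - (t + u)) (?h (t + u) t) * indicator {0<..<s} (t + u) \<partial>lborel)" by simp
  qed
  also have "\<dots> = simplex_nn (Suc (Suc j)) s g"
    unfolding simplex_nn_two(1)[OF assms]
    by (intro nn_integral_cong) (auto simp: i algebra_simps)
  finally show ?thesis by (simp only: Suc)
qed simp

text \<open>Brings one part to the front and keeps the order of the others. By this relabelling a
  sum over the choice of a part becomes a multiple of the term in which the first part, the
  outermost integration variable, is chosen.\<close>

definition to_front :: "nat \<Rightarrow> (nat \<Rightarrow> real) \<Rightarrow> nat \<Rightarrow> real" where
  "to_front i y = case_nat (y i) (delete_at i y)"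

lemma measurable_to_front [measurable]: "to_front i \<in> borel \<rightarrow>\<^sub>M borel"
  unfolding to_front_def by measurable

lemma delete_at_case_nat [simp]:
  "delete_at 0 (case_nat t y) = y" "delete_at (Suc i) (case_nat t y) = case_nat t (delete_at i y)"
  by (auto simp: delete_at_def fun_eq_iff split: nat.split)

lemma to_front_Suc: "to_front (Suc i) (case_nat t y) = swap01 (case_nat t (to_front i y))"
  by (simp add: to_front_def)

lemma to_front_0 [simp]: "to_front 0 y = y"
  by (auto simp: to_front_def delete_at_def fun_eq_iff split: nat.split)

text \<open>Induction on \<open>i\<close>: part \<open>i + 1\<close> is moved to the front of the
  tail, inside the integral over the first part, and is then exchanged with the head by
  \<open>swap01\<close>.\<close>

lemma simplex_nn_to_front:
  assumes "g \<in> borel_measurable borel" "i \<le> k"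
  shows "simplex_nn k s (\<lambda>y. g (to_front i y)) = simplex_nn k s g"
  using assms
proof (induction i arbitrary: k s g)
  case (Suc i)
  then obtain j where k: "k = Suc j" "i \<le> j" by (cases k) auto
  note [measurable] = Suc.prems(1)
  have "simplex_nn k s (\<lambda>y. g (to_front (Suc i) y)) = simplex_nn k s (\<lambda>y. g (swap01 y))"
    using Suc.IH[of "\<lambda>y. g (swap01 (case_nat t y))" j for t] k(2) 
    by (simp add: k(1) to_front_Suc)
  then show ?case using simplex_nn_swap01[OF Suc.prems(1)] k by simp
qed simp

section \<open>Detailed balance of splits and merges\<close>

definition perm_inv :: "nat \<Rightarrow> ((nat \<Rightarrow> real) \<Rightarrow> 'a) \<Rightarrow> bool" where
  "perm_inv k f \<longleftrightarrow> (\<forall>\<pi> y. \<pi> permutes {..k} \<longrightarrow> f (y \<circ> \<pi>) = f y)"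

lemma inj_imp_permutes:
  assumes "finite S" "inj p" "p ` S \<subseteq> S" "\<And>x. x \<notin> S \<Longrightarrow> p x = x" shows "p permutes S"
proof (rule bij_imp_permutes)
  have "inj_on p S" using assms(2) by (rule inj_on_subset) simp
  then show "bij_betw p S S" using endo_inj_surj[OF assms(1,3)] by (simp add: bij_betw_def)
qed (rule assms(4))

lemma to_front_permutes:
  assumes "i \<le> k" obtains \<pi> where "\<pi> permutes {..k}" "\<And>y. to_front i y = y \<circ> \<pi>"
proof
  let ?\<pi> = "case_nat i (\<lambda>m. if m < i then m else Suc m)"
  show "to_front i y = y \<circ> ?\<pi>" for y
    by (auto simp: to_front_def delete_at_def fun_eq_iff split: nat.split)
  have "inj ?\<pi>" by (auto simp: inj_def split: nat.splits if_splits)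
  moreover have "?\<pi> ` {..k} \<subseteq> {..k}" using assms by (auto split: nat.splits)
  moreover have "?\<pi> x = x" if "x \<notin> {..k}" for x using that assms by (cases x) auto
  ultimately show "?\<pi> permutes {..k}" by (rule inj_imp_permutes[OF finite_atMost])
qed

lemma lift_permutes:
  assumes "\<pi> permutes {..k}" shows "case_nat 0 (\<lambda>m. Suc (\<pi> m)) permutes {..Suc k}"
proof -
  let ?\<pi> = "case_nat 0 (\<lambda>m. Suc (\<pi> m))"
  have "inj ?\<pi>" using inj_eq[OF permutes_inj[OF assms]] by (auto simp: inj_def split: nat.splits)
  moreover have "?\<pi> ` {..Suc k} \<subseteq> {..Suc k}"
    using permutes_in_image[OF assms] by (auto split: nat.splits)
  moreover have "?\<pi> x = x" if "x \<notin> {..Suc k}" for x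
    using that permutes_not_in[OF assms] by (cases x) auto
  ultimately show ?thesis by (rule inj_imp_permutes[OF finite_atMost])
qed

lemma perm_inv_to_front: "perm_inv k f \<Longrightarrow> i \<le> k \<Longrightarrow> f (to_front i y) = f y"
  using to_front_permutes[of i k] unfolding perm_inv_def by metis

lemma case_nat_o_lift: "case_nat t y \<circ> case_nat 0 (\<lambda>m. Suc (\<pi> m)) = case_nat t (y \<circ> \<pi>)"
  by (auto simp: fun_eq_iff split: nat.split)

lemma perm_inv_case_nat: "perm_inv (Suc k) f \<Longrightarrow> perm_inv k (\<lambda>y. f (case_nat t y))"
  unfolding perm_inv_def using lift_permutes[of _ k] by (simp flip: case_nat_o_lift)

abbreviation inv_prod :: "nat \<Rightarrow> (nat \<Rightarrow> real) \<Rightarrow> ennreal" where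
  "inv_prod k y \<equiv> (\<Prod>i\<le>k. ennreal (1 / y i))"

lemma perm_inv_inv_prod: "perm_inv k (inv_prod k)"
  unfolding perm_inv_def
proof (intro allI impI)
  fix \<pi> y assume "\<pi> permutes {..k}"
  from prod.permute[OF this, of "\<lambda>i. ennreal (1 / y i)"]
  show "inv_prod k (y \<circ> \<pi>) = inv_prod k y" by (simp add: comp_def)
qed

text \<open>The part of the reversible measure that lives on points with \<open>k + 1\<close> parts; the factorial accounts
  for the order of the parts.\<close>

definition cycle_nn :: "nat \<Rightarrow> real \<Rightarrow> ((nat \<Rightarrow> real) \<Rightarrow> ennreal) \<Rightarrow> ennreal" where
  "cycle_nn k s g = ennreal (1 / fact (Suc k)) * simplex_nn k s (\<lambda>y. g y * inv_prod k y)"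

lemma simplex_nn_sum_to_front:
  assumes [measurable]: "g \<in> borel_measurable borel"
  shows "simplex_nn k s (\<lambda>y. \<Sum>i\<le>k. g (to_front i y)) = of_nat (Suc k) * simplex_nn k s g"
proof -
  have "simplex_nn k s (\<lambda>y. \<Sum>i\<le>k. g (to_front i y)) = (\<Sum>i\<le>k. simplex_nn k s (\<lambda>y. g (to_front i y)))"
    by (rule simplex_nn_sum) auto
  also have "\<dots> = (\<Sum>i\<le>k. simplex_nn k s g)"
    by (intro sum.cong refl simplex_nn_to_front) auto
  finally show ?thesis by simp
qed

lemma to_front_simps [simp]: "to_front i y 0 = y i" "to_front i y (Suc j) = delete_at i y j" "to_front i y \<circ> Suc = delete_at i y"
  by (simp_all add: to_front_def)

lemma delete_at_0_to_front [simp]: "delete_at 0 (to_front i y) = delete_at i y"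
  by (simp add: to_front_def)

lemma case_nat_head_tail [simp]: "case_nat (y 0) (y \<circ> Suc) = y"
  by (auto simp: fun_eq_iff split: nat.split)

lemma inv_prod_Suc: "inv_prod (Suc k) y = ennreal (1 / y 0) * inv_prod k (y \<circ> Suc)"
  by (simp add: prod.atMost_Suc_shift del: prod.atMost_Suc)

lemma ennreal_mult_inverse: "0 < t \<Longrightarrow> ennreal t * ennreal (1 / t) = 1"
  by (simp add: ennreal_mult[symmetric])

lemma ennreal_inverse_mult_cancel: "0 < t \<Longrightarrow> ennreal (1 / t) * (ennreal t * x) = x"
  using ennreal_mult_inverse[of t] by (simp only: mult.assoc[symmetric] mult.commute[of "ennreal (1 / t)"] mult_1_left)

lemma inverse_fact_mult: "ennreal (1 / fact (Suc (Suc k))) * of_nat (Suc (Suc k)) = ennreal (1 / fact (Suc k))"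
proof -
  have "ennreal (1 / fact (Suc (Suc k))) * of_nat (Suc (Suc k)) = ennreal (1 / fact (Suc (Suc k)) * real (Suc (Suc k)))"
    by (subst ennreal_mult) (auto simp: ennreal_of_nat_eq_real_of_nat)
  also have "1 / fact (Suc (Suc k)) * real (Suc (Suc k)) = 1 / fact (Suc k)"
    unfolding fact_Suc[of "Suc k"] by (simp del: fact_Suc)
  finally show ?thesis .
qed

text \<open>Size-biased choice of a part: multiply by
  \<open>(\<Sum>i\<le>Suc k. y i) / s = 1\<close> and use symmetry to let the chosen part come
  first, \<open>k + 2\<close> times. Its factor \<open>y 0\<close> cancels the
  \<open>1 / y 0\<close> of the density and \<open>k + 2\<close> cancels against the factorial, so
  the chosen part carries the flat density \<open>dt / s\<close>. This is the origin of the uniform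
  sticks.\<close>

lemma cycle_nn_Suc:
  assumes [measurable]: "g \<in> borel_measurable borel" and g: "perm_inv (Suc k) g" and s: "0 < s"
  shows "cycle_nn (Suc k) s g =
    ennreal (1 / s) * (\<integral>\<^sup>+t. cycle_nn k (s - t) (\<lambda>y. g (case_nat t y)) * indicator {0<..<s} t \<partial>lborel)"
proof -
  define \<phi> where "\<phi> y = ennreal (y 0) * (g y * inv_prod (Suc k) y)" for y
  have [measurable]: "\<phi> \<in> borel_measurable borel" unfolding \<phi>_def by measurable
  have "simplex_nn (Suc k) s (\<lambda>y. g y * inv_prod (Suc k) y) =
      simplex_nn (Suc k) s (\<lambda>y. ennreal (1 / s) * (\<Sum>i\<le>Suc k. \<phi> (to_front i y)))"
  proof (rule simplex_nn_cong[OF s])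
    fix y :: "nat \<Rightarrow> real" assume y: "\<And>i. i \<le> Suc k \<Longrightarrow> 0 < y i" "(\<Sum>i\<le>Suc k. y i) = s"
    have "(\<Sum>i\<le>Suc k. \<phi> (to_front i y)) = (\<Sum>i\<le>Suc k. ennreal (y i) * (g y * inv_prod (Suc k) y))"
      unfolding \<phi>_def using perm_inv_to_front[OF g] perm_inv_to_front[OF perm_inv_inv_prod[of "Suc k"]]
      by (intro sum.cong) auto
    also have "\<dots> = (\<Sum>i\<le>Suc k. ennreal (y i)) * (g y * inv_prod (Suc k) y)"
      by (simp only: sum_distrib_right)
    also have "(\<Sum>i\<le>Suc k. ennreal (y i)) = ennreal s"
      unfolding y(2)[symmetric] by (rule sum_ennreal) (simp add: y(1) less_imp_le)
    finally show "g y * inv_prod (Suc k) y = ennreal (1 / s) * (\<Sum>i\<le>Suc k. \<phi> (to_front i y))"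
      by (simp only: ennreal_inverse_mult_cancel[OF s])
  qed
  also have "\<dots> = ennreal (1 / s) * (of_nat (Suc (Suc k)) * simplex_nn (Suc k) s \<phi>)"
    by (subst simplex_nn_cmult, measurable) (simp only: simplex_nn_sum_to_front[OF \<open>\<phi> \<in> _\<close>])
  also have "simplex_nn (Suc k) s \<phi> = (\<integral>\<^sup>+t. simplex_nn k (s - t) (\<lambda>y. g (case_nat t y) * inv_prod k y) * indicator {0<..<s} t \<partial>lborel)"
    unfolding simplex_nn.simps
  proof (rule nn_integral_cong)
    fix t
    have "\<phi> (case_nat t y) = g (case_nat t y) * inv_prod k y" if "0 < t" for y
    proof -
      have "\<phi> (case_nat t y) = (ennreal t * ennreal (1 / t)) * (g (case_nat t y) * inv_prod k y)"
        unfolding \<phi>_def inv_prod_Suc by (simp add: ac_simps)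
      then show ?thesis by (simp only: ennreal_mult_inverse[OF that] mult_1_left)
    qed
    then show "simplex_nn k (s - t) (\<lambda>y. \<phi> (case_nat t y)) * indicator {0<..<s} t =
       simplex_nn k (s - t) (\<lambda>y. g (case_nat t y) * inv_prod k y) * indicator {0<..<s} t"
      by (auto simp: indicator_def)
  qed
  finally have *: "simplex_nn (Suc k) s (\<lambda>y. g y * inv_prod (Suc k) y) = ennreal (1 / s) * (of_nat (Suc (Suc k)) *
    (\<integral>\<^sup>+t. simplex_nn k (s - t) (\<lambda>y. g (case_nat t y) * inv_prod k y) * indicator {0<..<s} t \<partial>lborel))" .
  have m: "(\<lambda>t. simplex_nn k (s - t) (\<lambda>y. g (case_nat t y) * inv_prod k y)) \<in> borel_measurable lborel"
    by (rule measurable_simplex_nn_1[where a="\<lambda>t. t"]) measurable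
  have "cycle_nn (Suc k) s g = ennreal (1 / s) * ((ennreal (1 / fact (Suc (Suc k))) * of_nat (Suc (Suc k))) *
     (\<integral>\<^sup>+t. simplex_nn k (s - t) (\<lambda>y. g (case_nat t y) * inv_prod k y) * indicator {0<..<s} t \<partial>lborel))"
    unfolding cycle_nn_def * by (simp only: ac_simps)
  then show ?thesis unfolding inverse_fact_mult cycle_nn_def using m
    by (simp add: nn_integral_cmult mult.assoc)
qed

text \<open>The merges of the kernel at an unsorted point with \<open>k + 2\<close> parts. The sum
  is over ordered pairs, which absorbs the factor 2 of \<open>split_merge_law\<close>;
  \<open>j\<close> numbers the parts left after part \<open>i\<close> is deleted.\<close>

definition merge_sum :: "nat \<Rightarrow> ((nat \<Rightarrow> real) \<Rightarrow> ennreal) \<Rightarrow> (nat \<Rightarrow> real) \<Rightarrow> ennreal" where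
  "merge_sum k g y = (\<Sum>i\<le>Suc k. \<Sum>j\<le>k. ennreal (y i) * ennreal (delete_at i y j) *
     g (case_nat (y i + delete_at i y j) (delete_at j (delete_at i y))))"

definition split_sum :: "nat \<Rightarrow> ((nat \<Rightarrow> real) \<Rightarrow> ennreal) \<Rightarrow> (nat \<Rightarrow> real) \<Rightarrow> ennreal" where
  "split_sum k f y = (\<Sum>i\<le>k. ennreal (y i) *
     (\<integral>\<^sup>+t. f (case_nat t (case_nat (y i - t) (delete_at i y))) * indicator {0<..<y i} t \<partial>lborel))"

lemma measurable_split_int:
  fixes f :: "(nat \<Rightarrow> real) \<Rightarrow> ennreal"
  assumes [measurable]: "f \<in> borel_measurable borel"
  shows "(\<lambda>z. \<integral>\<^sup>+t. f (case_nat t (case_nat (z 0 - t) (z \<circ> Suc))) * indicator {0<..<z 0} t \<partial>lborel) \<in> borel_measurable borel"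
proof -
  have i: "(indicator {0<..<z} t :: ennreal) = (if 0 < t \<and> t < z then 1 else 0)" for z t :: real by (auto simp: indicator_def)
  show ?thesis unfolding i
    by (rule sigma_finite_measure.borel_measurable_nn_integral[OF sigma_finite_lborel]) (unfold case_prod_beta, measurable)
qed

text \<open>Both sides are multiples of one integral. The merge rate \<open>y i * y j\<close>
  cancels the two factors \<open>1 / y i\<close> and \<open>1 / y j\<close> of the density, and the
  split rate \<open>z 0\<close> cancels the \<open>1 / z 0\<close> of the part that is cut, so by
  \<open>simplex_nn_merge\<close> the same flat integral over the cut remains. The
  \<open>(k + 2) * (k + 1)\<close> ordered pairs against \<open>k + 1\<close> parts are balanced by
  the factorials in \<open>cycle_nn\<close>.\<close>

theorem merge_split_balance:
  assumes [measurable]: "f \<in> borel_measurable borel" "g \<in> borel_measurable borel"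
    and f: "perm_inv (Suc k) f" and g: "perm_inv k g" and s: "0 < s"
  shows "cycle_nn (Suc k) s (\<lambda>y. f y * merge_sum k g y) = cycle_nn k s (\<lambda>y. g y * split_sum k f y)"
proof -
  let ?J = "\<lambda>z. \<integral>\<^sup>+t. f (case_nat t (case_nat (z 0 - t) (z \<circ> Suc))) * indicator {0<..<z 0} t \<partial>lborel"
  note [measurable] = measurable_split_int[OF assms(1)]
  define \<psi> :: "nat \<Rightarrow> (nat \<Rightarrow> real) \<Rightarrow> ennreal" where "\<psi> j y = ennreal (y 0) * ennreal (y (Suc j)) * g (case_nat (y 0 + y (Suc j)) (delete_at j (y \<circ> Suc)))
    * (f y * inv_prod (Suc k) y)" for j y
  have [measurable]: "\<psi> j \<in> borel_measurable borel" for j unfolding \<psi>_def by measurable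
  define \<xi> where "\<xi> z = ennreal (z 0) * ?J z * (g z * inv_prod k z)" for z
  have [measurable]: "\<xi> \<in> borel_measurable borel" unfolding \<xi>_def by measurable
  have "f y * merge_sum k g y * inv_prod (Suc k) y = (\<Sum>i\<le>Suc k. \<Sum>j\<le>k. \<psi> j (to_front i y))" for y
  proof -
    have "(\<Sum>i\<le>Suc k. \<Sum>j\<le>k. \<psi> j (to_front i y)) = (\<Sum>i\<le>Suc k. \<Sum>j\<le>k. ennreal (y i) * ennreal (delete_at i y j) *
     g (case_nat (y i + delete_at i y j) (delete_at j (delete_at i y))) * (f y * inv_prod (Suc k) y))"
      unfolding \<psi>_def using perm_inv_to_front[OF f] perm_inv_to_front[OF perm_inv_inv_prod[of "Suc k"]]
      by (intro sum.cong) auto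
    then show ?thesis unfolding merge_sum_def by (simp only: sum_distrib_left sum_distrib_right ac_simps)
  qed
  then have "simplex_nn (Suc k) s (\<lambda>y. f y * merge_sum k g y * inv_prod (Suc k) y) =
     simplex_nn (Suc k) s (\<lambda>y. \<Sum>i\<le>Suc k. (\<lambda>z. \<Sum>j\<le>k. \<psi> j z) (to_front i y))" by simp
  also have "\<dots> = of_nat (Suc (Suc k)) * (\<Sum>j\<le>k. simplex_nn (Suc k) s (\<psi> j))"
    by (subst simplex_nn_sum_to_front, measurable, subst simplex_nn_sum[OF finite_atMost]) simp_all
  also have "(\<Sum>j\<le>k. simplex_nn (Suc k) s (\<psi> j)) = (\<Sum>j\<le>k. simplex_nn (Suc k) s (\<psi> 0))"
  proof (rule sum.cong[OF refl])
    fix j assume "j \<in> {..k}"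
    then have j: "j \<le> k" by simp
    have "\<psi> j (case_nat t r) = \<psi> 0 (case_nat t (to_front j r))" for t r
      using perm_inv_to_front[OF perm_inv_case_nat[OF f] j] perm_inv_to_front[OF perm_inv_inv_prod[of k] j]
      by (simp add: \<psi>_def inv_prod_Suc del: prod.atMost_Suc)
    then show "simplex_nn (Suc k) s (\<psi> j) = simplex_nn (Suc k) s (\<psi> 0)"
      unfolding simplex_nn.simps using simplex_nn_to_front[OF _ j, of "\<lambda>r. \<psi> 0 (case_nat t r)" for t] by simp
  qed
  also have "simplex_nn (Suc k) s (\<psi> 0) = simplex_nn k s \<xi>"
  proof (subst simplex_nn_merge, measurable, rule simplex_nn_cong[OF s])
    fix z :: "nat \<Rightarrow> real" assume z: "\<And>i. i \<le> k \<Longrightarrow> 0 < z i"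
    \<comment> \<open>The product of \<open>1 / z i\<close> over all parts except the first.
      \<open>inv_prod\<close> always has at least one factor, hence the separate empty product for
      \<open>k = 0\<close>.\<close>
    define Q where "Q = (case k of 0 \<Rightarrow> 1 | Suc j \<Rightarrow> inv_prod j (z \<circ> Suc))"
    have Q: "inv_prod k (case_nat u (z \<circ> Suc)) = ennreal (1 / u) * Q" for u
      unfolding Q_def by (cases k) (auto simp: inv_prod_Suc simp del: prod.atMost_Suc)
    have Qz: "ennreal (z 0) * inv_prod k z = Q"
      using Q[of "z 0"] ennreal_mult_inverse[OF z[of 0]] by (simp add: mult.assoc[symmetric])
    have "\<psi> 0 (case_nat t (case_nat (z 0 - t) (z \<circ> Suc))) * indicator {0<..<z 0} t =
      (g z * Q) * (f (case_nat t (case_nat (z 0 - t) (z \<circ> Suc))) * indicator {0<..<z 0} t)" for t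
    proof (cases "0 < t \<and> t < z 0")
      case True
      have "\<psi> 0 (case_nat t (case_nat (z 0 - t) (z \<circ> Suc))) =
        (ennreal t * ennreal (1 / t)) * (ennreal (z 0 - t) * ennreal (1 / (z 0 - t))) * (g z * Q) *
         f (case_nat t (case_nat (z 0 - t) (z \<circ> Suc)))"
        unfolding \<psi>_def inv_prod_Suc by (simp add: Q ac_simps)
      then show ?thesis using True by (simp add: ennreal_mult_inverse)
    qed (auto simp: indicator_def)
    moreover have "(\<lambda>t. f (case_nat t (case_nat (z 0 - t) (z \<circ> Suc))) * indicator {0<..<z 0} t) \<in> borel_measurable lborel" by measurable
    ultimately have "(\<integral>\<^sup>+t. \<psi> 0 (case_nat t (case_nat (z 0 - t) (z \<circ> Suc))) * indicator {0<..<z 0} t \<partial>lborel) = (g z * Q) * ?J z"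
      by (simp only: nn_integral_cmult)
    then show "(\<integral>\<^sup>+t. \<psi> 0 (case_nat t (case_nat (z 0 - t) (z \<circ> Suc))) * indicator {0<..<z 0} t \<partial>lborel) = \<xi> z"
      unfolding \<xi>_def Qz[symmetric] by (simp only: ac_simps)
  qed
  finally have L: "simplex_nn (Suc k) s (\<lambda>y. f y * merge_sum k g y * inv_prod (Suc k) y)
      = of_nat (Suc (Suc k)) * (of_nat (Suc k) * simplex_nn k s \<xi>)" by simp
  have "g y * split_sum k f y * inv_prod k y = (\<Sum>i\<le>k. \<xi> (to_front i y))" for y
  proof -
    have "(\<Sum>i\<le>k. \<xi> (to_front i y)) = (\<Sum>i\<le>k. ennreal (y i) *
     (\<integral>\<^sup>+t. f (case_nat t (case_nat (y i - t) (delete_at i y))) * indicator {0<..<y i} t \<partial>lborel) * (g y * inv_prod k y))"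
      unfolding \<xi>_def using perm_inv_to_front[OF g] perm_inv_to_front[OF perm_inv_inv_prod[of k]]
      by (intro sum.cong) auto
    then show ?thesis unfolding split_sum_def by (simp only: sum_distrib_left sum_distrib_right ac_simps)
  qed
  then have R: "simplex_nn k s (\<lambda>y. g y * split_sum k f y * inv_prod k y) = of_nat (Suc k) * simplex_nn k s \<xi>"
    by (simp only: simplex_nn_sum_to_front[OF \<open>\<xi> \<in> _\<close>])
  show ?thesis unfolding cycle_nn_def L R by (simp only: inverse_fact_mult mult.assoc[symmetric])
qed

section \<open>Surjection weights\<close>

text \<open>The iterated forward difference of \<open>\<phi>\<close> at 0 with the steps
  \<open>y i\<close>, \<open>i \<in> I\<close>, written out by inclusion-exclusion.\<close>

definition alt_sum :: "(real \<Rightarrow> real) \<Rightarrow> nat set \<Rightarrow> (nat \<Rightarrow> real) \<Rightarrow> real" where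
  "alt_sum \<phi> I y = (\<Sum>C\<in>Pow I. (-1) ^ card (I - C) * \<phi> (sum y C))"

text \<open>Read from left to right, it lifts a sum over the subsets that avoid \<open>i\<close> to
  all subsets of \<open>I\<close>: those with \<open>i\<close> carry \<open>F\<close>, those without
  carry \<open>G\<close>, whose sign flips because the complement gains \<open>i\<close>.\<close>

lemma sum_Pow_remove:
  fixes F G :: "nat set \<Rightarrow> real"
  assumes "finite I" "i \<in> I"
  shows "(\<Sum>C\<in>Pow (I - {i}). (-1) ^ card (I - {i} - C) * (F (insert i C) + G C)) =
    (\<Sum>C\<in>Pow I. (-1) ^ card (I - C) * (if i \<in> C then F C else - G C))"
proof -
  let ?K = "I - {i}"
  have I: "I = insert i ?K" using assms by auto
  have "(\<Sum>C\<in>Pow I. (-1) ^ card (I - C) * (if i \<in> C then F C else - G C)) =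
    (\<Sum>C\<in>Pow ?K. (-1) ^ card (I - C) * (if i \<in> C then F C else - G C)) +
    (\<Sum>C\<in>insert i ` Pow ?K. (-1) ^ card (I - C) * (if i \<in> C then F C else - G C))"
  proof -
    have "Pow I = Pow ?K \<union> insert i ` Pow ?K" using I by (metis Pow_insert)
    moreover have "Pow ?K \<inter> insert i ` Pow ?K = {}" by auto
    ultimately show ?thesis using assms(1) by (simp add: sum.union_disjoint)
  qed
  also have "(\<Sum>C\<in>Pow ?K. (-1) ^ card (I - C) * (if i \<in> C then F C else - G C)) = (\<Sum>C\<in>Pow ?K. (-1) ^ card (?K - C) * G C)"
  proof (rule sum.cong[OF refl])
    fix C assume C: "C \<in> Pow ?K"
    then have "I - C = insert i (?K - C)" using assms by auto
    then have "card (I - C) = Suc (card (?K - C))" using assms(1) by simp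
    then show "(-1) ^ card (I - C) * (if i \<in> C then F C else - G C) = (-1) ^ card (?K - C) * G C" using C by auto
  qed
  also have "(\<Sum>C\<in>insert i ` Pow ?K. (-1) ^ card (I - C) * (if i \<in> C then F C else - G C)) =
     (\<Sum>C\<in>Pow ?K. (-1) ^ card (?K - C) * F (insert i C))"
  proof (subst sum.reindex)
    show "inj_on (insert i) (Pow ?K)" by (auto simp: inj_on_def)
    have "card (I - insert i C) = card (?K - C)" for C by (rule arg_cong[where f=card]) auto
    then show "sum ((\<lambda>C. (-1) ^ card (I - C) * (if i \<in> C then F C else - G C)) \<circ> insert i) (Pow ?K) =
       (\<Sum>C\<in>Pow ?K. (-1) ^ card (?K - C) * F (insert i C))"
      by (simp only: comp_def insertI1 if_True)
  qed
  finally show ?thesis by (simp only: distrib_left sum.distrib add.commute)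
qed

lemma alt_sum_insert:
  assumes "finite I" "i \<notin> I"
  shows "alt_sum \<phi> (insert i I) y = alt_sum (\<lambda>x. \<phi> (x + y i) - \<phi> x) I y"
proof -
  have "alt_sum (\<lambda>x. \<phi> (x + y i) - \<phi> x) I y =
     (\<Sum>C\<in>Pow (insert i I - {i}). (-1) ^ card (insert i I - {i} - C) * (\<phi> (sum y (insert i C)) + - \<phi> (sum y C)))"
    unfolding alt_sum_def
  proof (rule sum.cong)
    show "Pow I = Pow (insert i I - {i})" using assms by simp
    fix C assume "C \<in> Pow (insert i I - {i})"
    then have "finite C" "i \<notin> C" using assms by (auto intro: finite_subset)
    moreover have "insert i I - {i} = I" using assms by auto
    ultimately show "(-1) ^ card (I - C) * (\<phi> (sum y C + y i) - \<phi> (sum y C)) =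
      (-1) ^ card (insert i I - {i} - C) * (\<phi> (sum y (insert i C)) + - \<phi> (sum y C))" by (simp add: add.commute)
  qed
  also have "\<dots> = alt_sum \<phi> (insert i I) y"
    unfolding alt_sum_def by (subst sum_Pow_remove) (use assms in \<open>auto intro!: sum.cong\<close>)
  finally show ?thesis by simp
qed

lemma alt_sum_reindex:
  assumes "inj_on h I"
  shows "alt_sum \<phi> (h ` I) y = alt_sum \<phi> I (y \<circ> h)"
  unfolding alt_sum_def
proof (rule sum.reindex_cong[where l="(`) h"])
  show "inj_on ((`) h) (Pow I)" using assms by (rule inj_on_image_Pow)
  show "Pow (h ` I) = (`) h ` Pow I" by (simp add: image_Pow_surj)
  fix C assume "C \<in> Pow I"
  then have C: "C \<subseteq> I" by simp
  have "h ` I - h ` C = h ` (I - C)" using assms C by (simp add: inj_on_image_set_diff)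
  then have "card (h ` I - h ` C) = card (I - C)"
    using assms by (simp add: card_image inj_on_subset[of h I "I - C"])
  moreover have "sum y (h ` C) = sum (y \<circ> h) C"
    using assms C by (intro sum.reindex) (rule inj_on_subset)
  ultimately show "(-1) ^ card (h ` I - h ` C) * \<phi> (sum y (h ` C)) = (-1) ^ card (I - C) * \<phi> (sum (y \<circ> h) C)" by simp
qed

lemma alt_sum_cmult: "alt_sum (\<lambda>x. c * \<phi> x) I y = c * alt_sum \<phi> I y"
  by (simp add: alt_sum_def sum_distrib_left ac_simps)

lemma alt_sum_add: "alt_sum (\<lambda>x. \<phi> x + \<psi> x) I y = alt_sum \<phi> I y + alt_sum \<psi> I y"
  by (simp add: alt_sum_def sum.distrib algebra_simps)

lemma alt_sum_diff: "alt_sum (\<lambda>x. \<phi> x - \<psi> x) I y = alt_sum \<phi> I y - alt_sum \<psi> I y"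
  by (simp add: alt_sum_def sum_subtractf algebra_simps)

lemma alt_sum_sum: "finite K \<Longrightarrow> alt_sum (\<lambda>x. \<Sum>k\<in>K. \<phi> k x) I y = (\<Sum>k\<in>K. alt_sum (\<phi> k) I y)"
  by (induction K rule: finite_induct) (simp_all add: alt_sum_add, simp add: alt_sum_def)

text \<open>\<open>K\<close> counts the draws that fall into part \<open>i\<close>. The difference
  removes \<open>K = 0\<close>, the case in which this part is missed, so only nonnegative
  coefficients remain when \<open>y i\<close> is nonnegative.\<close>

lemma alt_sum_power_insert:
  assumes "finite I" "i \<notin> I"
  shows "alt_sum (\<lambda>x. x ^ N) (insert i I) y =
    (\<Sum>K\<in>{1..N}. real (N choose K) * y i ^ K * alt_sum (\<lambda>x. x ^ (N - K)) I y)"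
proof -
  have "(x + y i) ^ N - x ^ N = (\<Sum>K\<in>{1..N}. (real (N choose K) * y i ^ K) * x ^ (N - K))" for x
  proof -
    have "(y i + x) ^ N = (\<Sum>K\<le>N. (real (N choose K) * y i ^ K) * x ^ (N - K))" by (rule binomial_ring)
    also have "\<dots> = x ^ N + (\<Sum>K\<in>{1..N}. (real (N choose K) * y i ^ K) * x ^ (N - K))"
      by (simp add: atMost_atLeast0 sum.atLeast_Suc_atMost)
    finally show ?thesis by (simp add: add.commute)
  qed
  then show ?thesis using assms
    by (simp add: alt_sum_insert alt_sum_sum alt_sum_cmult)
qed

lemma alt_sum_power_nonneg:
  assumes "finite I" "\<And>i. i \<in> I \<Longrightarrow> 0 \<le> y i"
  shows "0 \<le> alt_sum (\<lambda>x. x ^ N) I y"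
  using assms
proof (induction I arbitrary: N rule: finite_induct)
  case empty show ?case by (simp add: alt_sum_def)
next
  case (insert i I)
  then show ?case by (auto simp: alt_sum_power_insert intro!: sum_nonneg mult_nonneg_nonneg)
qed

text \<open>Expand everything over the subsets \<open>C\<close> of the full \<open>I\<close> and
  compare coefficients. A merged pair lies inside \<open>C\<close> or outside it as a whole, so
  pairs separated by \<open>C\<close> drop out; the splits supply the diagonal \<open>i = j\<close>.
  The double sums then complete to the squares of \<open>sum y C\<close> and of its complement
  \<open>s - sum y C\<close>, while \<open>\<Phi>\<close> collects \<open>- 2 * y i\<close> from
  every part. In the application \<open>\<Phi>\<close> is an antiderivative of
  \<open>\<phi>\<close>.\<close>

theorem alt_sum_split_merge:
  fixes y :: "nat \<Rightarrow> real"
  assumes I: "finite I" and s: "s = sum y I"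
  shows "(\<Sum>i\<in>I. \<Sum>j\<in>I - {i}. y i * y j * alt_sum (\<lambda>x. \<phi> (x + (y i + y j)) - \<phi> x) (I - {i} - {j}) y) +
    (\<Sum>i\<in>I. y i * alt_sum (\<lambda>x. y i * (\<phi> (x + y i) + \<phi> x) - 2 * (\<Phi> (x + y i) - \<Phi> x)) (I - {i}) y) =
    alt_sum (\<lambda>x. (x\<^sup>2 - (s - x)\<^sup>2) * \<phi> x - 2 * s * \<Phi> x) I y"
proof -
  let ?a = "\<lambda>i j. alt_sum (\<lambda>x. \<phi> (x + (y i + y j)) - \<phi> x) (I - {i} - {j}) y"
  let ?b = "\<lambda>i. alt_sum (\<lambda>x. y i * (\<phi> (x + y i) + \<phi> x) - 2 * (\<Phi> (x + y i) - \<Phi> x)) (I - {i}) y"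
  define sg :: "nat set \<Rightarrow> real" where "sg C = (-1) ^ card (I - C)" for C
  \<comment> \<open>For a pair outside \<open>C\<close> the two extra indices leave the parity of
    the complement unchanged, and the minus sign of the difference gives -1. For
    \<open>i = j\<close> the complement gains one index, and the same value -1 comes from that flip
    against the plus sign of the split term.\<close>
  define w :: "nat set \<Rightarrow> nat \<Rightarrow> nat \<Rightarrow> real" where
    "w C i j = (if i \<in> C then (if j \<in> C then 1 else 0) else (if j \<in> C then 0 else -1))" for C i j
  have m: "(?a i j) = (\<Sum>C\<in>Pow I. sg C * (w C i j * \<phi> (sum y C)))"
    if ij: "i \<in> I" "j \<in> I - {i}" for i j
  proof -
    have fin: "finite C" if "C \<in> Pow (I - {i})" for C using that I by (auto intro: finite_subset)
    have "(?a i j) =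
      (\<Sum>C\<in>Pow (I - {i} - {j}). (-1) ^ card (I - {i} - {j} - C) * (\<phi> (sum y (insert j C) + y i) + - \<phi> (sum y C)))"
      unfolding alt_sum_def
    proof (rule sum.cong[OF refl])
      fix C assume "C \<in> Pow (I - {i} - {j})"
      then have "finite C" "j \<notin> C" using I by (auto intro: finite_subset)
      then show "(-1) ^ card (I - {i} - {j} - C) * (\<phi> (sum y C + (y i + y j)) - \<phi> (sum y C)) =
         (-1) ^ card (I - {i} - {j} - C) * (\<phi> (sum y (insert j C) + y i) + - \<phi> (sum y C))" by (simp add: ac_simps)
    qed
    also have "\<dots> = (\<Sum>C\<in>Pow (I - {i}). (-1) ^ card (I - {i} - C) * (if j \<in> C then \<phi> (sum y C + y i) else - (- \<phi> (sum y C))))"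
      by (rule sum_Pow_remove[where F="\<lambda>C. \<phi> (sum y C + y i)" and G="\<lambda>C. - \<phi> (sum y C)"]) (use I ij in auto)
    also have "\<dots> = (\<Sum>C\<in>Pow (I - {i}). (-1) ^ card (I - {i} - C) *
        ((if j \<in> insert i C then \<phi> (sum y (insert i C)) else 0) + (if j \<in> C then 0 else \<phi> (sum y C))))"
    proof (rule sum.cong[OF refl])
      fix C assume C: "C \<in> Pow (I - {i})"
      then have "i \<notin> C" by auto
      then show "(-1) ^ card (I - {i} - C) * (if j \<in> C then \<phi> (sum y C + y i) else - (- \<phi> (sum y C))) =
        (-1) ^ card (I - {i} - C) * ((if j \<in> insert i C then \<phi> (sum y (insert i C)) else 0) + (if j \<in> C then 0 else \<phi> (sum y C)))"
        using fin[OF C] ij by (simp add: add.commute)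
    qed
    also have "\<dots> = (\<Sum>C\<in>Pow I. (-1) ^ card (I - C) * (if i \<in> C then (if j \<in> C then \<phi> (sum y C) else 0) else - (if j \<in> C then 0 else \<phi> (sum y C))))"
      by (rule sum_Pow_remove[where F="\<lambda>C. if j \<in> C then \<phi> (sum y C) else 0"]) (use I ij in auto)
    also have "\<dots> = (\<Sum>C\<in>Pow I. sg C * (w C i j * \<phi> (sum y C)))"
      unfolding sg_def w_def by (intro sum.cong) auto
    finally show ?thesis .
  qed
  have sp: "(?b i) =
      (\<Sum>C\<in>Pow I. sg C * (w C i i * y i * \<phi> (sum y C) - 2 * \<Phi> (sum y C)))" if i: "i \<in> I" for i
  proof -
    have "(?b i) =
      (\<Sum>C\<in>Pow (I - {i}). (-1) ^ card (I - {i} - C) * ((y i * \<phi> (sum y (insert i C)) - 2 * \<Phi> (sum y (insert i C)))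
         + (y i * \<phi> (sum y C) + 2 * \<Phi> (sum y C))))"
      unfolding alt_sum_def
    proof (rule sum.cong[OF refl])
      fix C assume C: "C \<in> Pow (I - {i})"
      then have "finite C" "i \<notin> C" using I by (auto intro: finite_subset)
      then show "(-1) ^ card (I - {i} - C) * (y i * (\<phi> (sum y C + y i) + \<phi> (sum y C)) - 2 * (\<Phi> (sum y C + y i) - \<Phi> (sum y C))) =
        (-1) ^ card (I - {i} - C) * ((y i * \<phi> (sum y (insert i C)) - 2 * \<Phi> (sum y (insert i C)))
         + (y i * \<phi> (sum y C) + 2 * \<Phi> (sum y C)))"
        by (simp add: algebra_simps)
    qed
    also have "\<dots> = (\<Sum>C\<in>Pow I. (-1) ^ card (I - C) * (if i \<in> C then y i * \<phi> (sum y C) - 2 * \<Phi> (sum y C) else - (y i * \<phi> (sum y C) + 2 * \<Phi> (sum y C))))"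
      by (rule sum_Pow_remove[where F="\<lambda>C. y i * \<phi> (sum y C) - 2 * \<Phi> (sum y C)"]) (use I i in auto)
    also have "\<dots> = (\<Sum>C\<in>Pow I. sg C * (w C i i * y i * \<phi> (sum y C) - 2 * \<Phi> (sum y C)))"
      unfolding sg_def w_def by (intro sum.cong) auto
    finally show ?thesis .
  qed
  have "(\<Sum>i\<in>I. \<Sum>j\<in>I - {i}. y i * y j * (?a i j)) =
     (\<Sum>i\<in>I. \<Sum>j\<in>I - {i}. \<Sum>C\<in>Pow I. y i * y j * (sg C * (w C i j * \<phi> (sum y C))))"
    by (intro sum.cong refl) (simp only: m sum_distrib_left)
  also have "\<dots> = (\<Sum>C\<in>Pow I. \<Sum>i\<in>I. \<Sum>j\<in>I - {i}. y i * y j * (sg C * (w C i j * \<phi> (sum y C))))"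
    by (subst sum.swap, rule sum.cong[OF refl], subst sum.swap) (rule refl)
  finally have M: "(\<Sum>i\<in>I. \<Sum>j\<in>I - {i}. y i * y j * (?a i j)) =
    (\<Sum>C\<in>Pow I. \<Sum>i\<in>I. \<Sum>j\<in>I - {i}. y i * y j * (sg C * (w C i j * \<phi> (sum y C))))" .
  have "(\<Sum>i\<in>I. y i * (?b i)) =
     (\<Sum>i\<in>I. \<Sum>C\<in>Pow I. y i * (sg C * (w C i i * y i * \<phi> (sum y C) - 2 * \<Phi> (sum y C))))"
    by (intro sum.cong refl) (simp only: sp sum_distrib_left)
  also have "\<dots> = (\<Sum>C\<in>Pow I. \<Sum>i\<in>I. y i * (sg C * (w C i i * y i * \<phi> (sum y C) - 2 * \<Phi> (sum y C))))"
    by (rule sum.swap)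
  finally have S: "(\<Sum>i\<in>I. y i * (?b i)) =
     (\<Sum>C\<in>Pow I. \<Sum>i\<in>I. y i * (sg C * (w C i i * y i * \<phi> (sum y C) - 2 * \<Phi> (sum y C))))" .
  have C: "(\<Sum>i\<in>I. \<Sum>j\<in>I - {i}. y i * y j * (sg C * (w C i j * \<phi> (sum y C)))) +
     (\<Sum>i\<in>I. y i * (sg C * (w C i i * y i * \<phi> (sum y C) - 2 * \<Phi> (sum y C)))) =
     sg C * (((sum y C)\<^sup>2 - (s - sum y C)\<^sup>2) * \<phi> (sum y C) - 2 * s * \<Phi> (sum y C))" if C: "C \<in> Pow I" for C
  proof -
    have IC: "I = C \<union> (I - C)" using C by auto
    have fC: "finite C" using C I by (auto intro: finite_subset)
    have sC: "(\<Sum>i\<in>I - C. y i) = s - sum y C" unfolding s using C I by (simp add: sum_diff)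
    have splitI: "(\<Sum>i\<in>I. f i) = (\<Sum>i\<in>C. f i) + (\<Sum>i\<in>I - C. f i)" for f :: "nat \<Rightarrow> real"
      using C I by (metis PowD add.commute sum.subset_diff)
    have "(\<Sum>i\<in>I. \<Sum>j\<in>I. y i * y j * w C i j) =
      (\<Sum>i\<in>C. \<Sum>j\<in>C. y i * y j) - (\<Sum>i\<in>I - C. \<Sum>j\<in>I - C. y i * y j)"
      unfolding splitI w_def by (simp add: sum_negf)
    also have "\<dots> = (sum y C)\<^sup>2 - (s - sum y C)\<^sup>2"
      by (simp add: sum_product[symmetric] sC power2_eq_square)
    finally have 1: "(\<Sum>i\<in>I. \<Sum>j\<in>I. y i * y j * w C i j) = (sum y C)\<^sup>2 - (s - sum y C)\<^sup>2" .
    have "(\<Sum>i\<in>I. \<Sum>j\<in>I - {i}. y i * y j * (sg C * (w C i j * \<phi> (sum y C)))) +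
     (\<Sum>i\<in>I. y i * (sg C * (w C i i * y i * \<phi> (sum y C) - 2 * \<Phi> (sum y C)))) =
     (\<Sum>i\<in>I. (\<Sum>j\<in>I - {i}. y i * y j * (sg C * (w C i j * \<phi> (sum y C)))) + y i * y i * (sg C * (w C i i * \<phi> (sum y C)))
        - y i * (2 * sg C * \<Phi> (sum y C)))"
      by (subst sum.distrib[symmetric], rule sum.cong) (auto simp: algebra_simps)
    also have "\<dots> = (\<Sum>i\<in>I. (\<Sum>j\<in>I. y i * y j * (sg C * (w C i j * \<phi> (sum y C)))) - y i * (2 * sg C * \<Phi> (sum y C)))"
      using I by (intro sum.cong refl arg_cong2[where f="(-)"]) (simp add: sum.remove)
    also have "\<dots> = sg C * \<phi> (sum y C) * (\<Sum>i\<in>I. \<Sum>j\<in>I. y i * y j * w C i j) - s * (2 * sg C * \<Phi> (sum y C))"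
      unfolding s by (simp add: sum_subtractf sum_distrib_left sum_distrib_right ac_simps)
    finally show ?thesis unfolding 1 by (simp add: algebra_simps)
  qed
  show ?thesis unfolding M S sum.distrib[where A="Pow I", symmetric] unfolding alt_sum_def sg_def[symmetric]
    by (rule sum.cong[OF refl C])
qed


text \<open>The probability \<open>Q\<^sub>N(y)\<close> when the \<open>k + 1\<close> parts of \<open>y\<close> sum to 1.\<close>

definition surj_wt :: "nat \<Rightarrow> nat \<Rightarrow> (nat \<Rightarrow> real) \<Rightarrow> real" where
  "surj_wt N k y = alt_sum (\<lambda>x. x ^ N) {..k} y"

lemma alt_sum_case_nat: "alt_sum \<phi> (insert 0 (Suc ` I)) (case_nat t y) = alt_sum (\<lambda>x. \<phi> (x + t) - \<phi> x) I y"
  if "finite I"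
  using that by (subst alt_sum_insert) (auto simp: alt_sum_reindex)

lemma atMost_Suc_insert_0: "{..Suc k} = insert 0 (Suc ` {..k})"
  by (metis atMost_Suc_eq_insert_0)

lemma alt_sum_delete_at:
  assumes "i \<le> Suc k" shows "alt_sum \<phi> {..k} (delete_at i y) = alt_sum \<phi> ({..Suc k} - {i}) y"
    "bij_betw (\<lambda>j. if j < i then j else Suc j) {..k} ({..Suc k} - {i})"
proof -
  let ?h = "\<lambda>j. if j < i then j else Suc j"
  have h: "delete_at i y = y \<circ> ?h" by (auto simp: delete_at_def)
  have inj: "inj_on ?h {..k}" by (auto simp: inj_on_def split: if_splits)
  have "?h ` {..k} = {..Suc k} - {i}"
  proof (intro equalityI subsetI)
    fix x assume x: "x \<in> {..Suc k} - {i}"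
    show "x \<in> ?h ` {..k}"
    proof (cases "x < i")
      case True then show ?thesis using assms by (intro image_eqI[of _ _ x]) auto
    next
      case False then show ?thesis using x by (intro image_eqI[of _ _ "x - 1"]) auto
    qed
  qed (use assms in auto)
  then show "alt_sum \<phi> {..k} (delete_at i y) = alt_sum \<phi> ({..Suc k} - {i}) y"
    "bij_betw ?h {..k} ({..Suc k} - {i})"
    using alt_sum_reindex[OF inj, of \<phi> y] inj by (auto simp: h bij_betw_def)
qed

lemma alt_sum_delete_at_remove:
  assumes "i \<le> k" shows "alt_sum \<phi> {..<k} (delete_at i y) = alt_sum \<phi> ({..k} - {i}) y"
proof (cases k)
  case 0 then show ?thesis using assms by (simp add: alt_sum_def)
next
  case (Suc m) then show ?thesis using alt_sum_delete_at(1)[of i m] assms by (simp add: lessThan_Suc_atMost)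
qed

lemma surj_wt_nonneg: "(\<And>i. i \<le> k \<Longrightarrow> 0 \<le> y i) \<Longrightarrow> 0 \<le> surj_wt N k y"
  unfolding surj_wt_def by (rule alt_sum_power_nonneg) auto

lemma surj_wt_Suc:
  "surj_wt N (Suc k) (case_nat t y) = (\<Sum>K\<in>{1..N}. real (N choose K) * t ^ K * surj_wt (N - K) k y)"
  unfolding surj_wt_def atMost_Suc_insert_0
  by (subst alt_sum_power_insert) (auto simp: alt_sum_reindex)

lemma surj_wt_0: "surj_wt N 0 y = y 0 ^ N - 0 ^ N"
proof -
  have "Pow {..0::nat} = {{}, {0}}" by auto
  then show ?thesis by (simp add: surj_wt_def alt_sum_def)
qed

lemma surj_wt_0_eq: "surj_wt 0 k z = 0"
proof -
  have "surj_wt 0 (Suc k) (case_nat t z) = 0" for k t and z by (simp add: surj_wt_Suc)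
  then have "surj_wt 0 (Suc k) z = 0" for k z by (metis case_nat_head_tail)
  then show ?thesis by (cases k) (simp_all add: surj_wt_0)
qed

lemma perm_inv_surj_wt: "perm_inv k (surj_wt N k)"
  unfolding perm_inv_def surj_wt_def
proof (intro allI impI)
  fix \<pi> :: "nat \<Rightarrow> nat" and y assume p: "\<pi> permutes {..k}"
  have "alt_sum (\<lambda>x. x ^ N) (\<pi> ` {..k}) y = alt_sum (\<lambda>x. x ^ N) {..k} (y \<circ> \<pi>)"
    by (rule alt_sum_reindex) (use p in \<open>simp add: permutes_inj_on\<close>)
  then show "alt_sum (\<lambda>x. x ^ N) {..k} (y \<circ> \<pi>) = alt_sum (\<lambda>x. x ^ N) {..k} y"
    by (simp add: permutes_image[OF p])
qed

lemma measurable_surj_wt [measurable]: "surj_wt N k \<in> borel_measurable borel"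
  unfolding surj_wt_def alt_sum_def by measurable

text \<open>Brings the merges of the weights into the form of the first sum of
  \<open>alt_sum_split_merge\<close> with \<open>\<phi> x = x ^ N\<close>. Each alternating sum is
  the surjection weight of the merged point and thus nonnegative; the second claim records this so
  that the real identity can be carried over to \<open>ennreal\<close>.\<close>

lemma surj_wt_merge:
  fixes y :: "nat \<Rightarrow> real"
  assumes y: "\<And>i. i \<le> Suc k \<Longrightarrow> 0 \<le> y i"
  shows "merge_sum k (\<lambda>z. ennreal (surj_wt N k z)) y =
    ennreal (\<Sum>i\<in>{..Suc k}. \<Sum>j\<in>{..Suc k} - {i}. y i * y j * alt_sum (\<lambda>x. (x + (y i + y j)) ^ N - x ^ N) ({..Suc k} - {i} - {j}) y)"
    and "0 \<le> (\<Sum>i\<in>{..Suc k}. \<Sum>j\<in>{..Suc k} - {i}. y i * y j * alt_sum (\<lambda>x. (x + (y i + y j)) ^ N - x ^ N) ({..Suc k} - {i} - {j}) y)"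
proof -
  let ?T = "\<lambda>i j. alt_sum (\<lambda>x. (x + (y i + y j)) ^ N - x ^ N) ({..Suc k} - {i} - {j}) y"
  let ?h = "\<lambda>i j. if j < i then j else Suc j"
  have e: "surj_wt N k (case_nat t (delete_at j (delete_at i y))) = alt_sum (\<lambda>x. (x + t) ^ N - x ^ N) ({..Suc k} - {i} - {?h i j}) y"
    if "i \<le> Suc k" "j \<le> k" for i j t
  proof -
    have d: "delete_at i y = y \<circ> ?h i" by (auto simp: delete_at_def)
    have inj: "inj_on (?h i) ({..k} - {j})" by (auto simp: inj_on_def split: if_splits)
    have im: "?h i ` ({..k} - {j}) = {..Suc k} - {i} - {?h i j}"
      using alt_sum_delete_at(2)[OF that(1)] that(2)
      by (subst inj_on_image_set_diff[of "?h i" "{..k}"]) (auto simp: bij_betw_def)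
    have "{..k} = insert 0 (Suc ` {..<k})" by (cases k) (auto simp: lessThan_Suc_atMost atMost_Suc_insert_0)
    then have "surj_wt N k (case_nat t (delete_at j (delete_at i y))) = alt_sum (\<lambda>x. (x + t) ^ N - x ^ N) {..<k} (delete_at j (delete_at i y))"
      by (simp add: surj_wt_def alt_sum_case_nat)
    also have "\<dots> = alt_sum (\<lambda>x. (x + t) ^ N - x ^ N) ({..k} - {j}) (delete_at i y)"
      by (rule alt_sum_delete_at_remove) (rule that)
    also have "\<dots> = alt_sum (\<lambda>x. (x + t) ^ N - x ^ N) ({..Suc k} - {i} - {?h i j}) y"
      unfolding d im[symmetric] by (rule alt_sum_reindex[OF inj, symmetric])
    finally show ?thesis .
  qed
  have nn: "0 \<le> ?T i (?h i j)" if "i \<le> Suc k" "j \<le> k" for i j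
    unfolding e[OF that, symmetric] using that
    by (intro surj_wt_nonneg) (auto simp: delete_at_def split: nat.split intro!: add_nonneg_nonneg y)
  have r: "(\<Sum>j\<in>{..Suc k} - {i}. y i * y j * (?T i j)) =
    (\<Sum>j\<le>k. y i * y (?h i j) * ?T i (?h i j))"
    if "i \<le> Suc k" for i
    by (rule sum.reindex_bij_betw[OF alt_sum_delete_at(2)[OF that], symmetric])
  have nn2: "0 \<le> y i * y (?h i j) * ?T i (?h i j)"
    if "i \<le> Suc k" "j \<le> k" for i j
    using that by (intro mult_nonneg_nonneg nn y) auto
  show "0 \<le> (\<Sum>i\<in>{..Suc k}. \<Sum>j\<in>{..Suc k} - {i}. y i * y j * (?T i j))"
  proof (rule sum_nonneg)
    fix i assume "i \<in> {..Suc k}"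
    then have i: "i \<le> Suc k" by simp
    show "0 \<le> (\<Sum>j\<in>{..Suc k} - {i}. y i * y j * (?T i j))"
      unfolding r[OF i] by (intro sum_nonneg nn2 i) simp
  qed
  have dh: "delete_at i y j = y (?h i j)" for i j by (simp add: delete_at_def)
  have "merge_sum k (\<lambda>z. ennreal (surj_wt N k z)) y = (\<Sum>i\<le>Suc k. \<Sum>j\<le>k. ennreal (y i * y (?h i j) * ?T i (?h i j)))"
    unfolding merge_sum_def
  proof (intro sum.cong refl)
    fix i j assume "i \<in> {..Suc k}" "j \<in> {..k}"
    then have ij: "i \<le> Suc k" "j \<le> k" by auto
    have "0 \<le> y i" "0 \<le> y (?h i j)" using ij by (auto intro: y)
    then show "ennreal (y i) * ennreal (delete_at i y j) * ennreal (surj_wt N k (case_nat (y i + delete_at i y j) (delete_at j (delete_at i y)))) =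
      ennreal (y i * y (?h i j) * ?T i (?h i j))"
      unfolding e[OF ij] dh using nn[OF ij] by (simp only: ennreal_mult mult_nonneg_nonneg)
  qed
  also have "\<dots> = (\<Sum>i\<le>Suc k. ennreal (\<Sum>j\<le>k. y i * y (?h i j) * ?T i (?h i j)))"
    by (intro sum.cong refl sum_ennreal nn2) auto
  also have "\<dots> = ennreal (\<Sum>i\<le>Suc k. \<Sum>j\<le>k. y i * y (?h i j) * ?T i (?h i j))"
    by (intro sum_ennreal sum_nonneg nn2) auto
  also have "(\<Sum>i\<le>Suc k. \<Sum>j\<le>k. y i * y (?h i j) * ?T i (?h i j))
    = (\<Sum>i\<in>{..Suc k}. \<Sum>j\<in>{..Suc k} - {i}. y i * y j * (?T i j))"
    by (rule sum.cong[OF refl], rule r[symmetric]) simp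
  finally show "merge_sum k (\<lambda>z. ennreal (surj_wt N k z)) y =
    ennreal (\<Sum>i\<in>{..Suc k}. \<Sum>j\<in>{..Suc k} - {i}. y i * y j * (?T i j))"
    .
qed

text \<open>When \<open>t\<close> and \<open>y i - t\<close> replace \<open>y i\<close>, the weight
  is the alternating sum of \<open>(x + y i)^N + x^N - (x + t)^N - (x + (y i - t))^N\<close> over
  the other parts. The last two powers have equal integrals over the cut, which explains the factor
  2 before the antiderivative \<open>\<Phi>\<close>.\<close>

lemma surj_wt_split:
  fixes y :: "nat \<Rightarrow> real" and N :: nat
  assumes y: "\<And>i. i \<le> k \<Longrightarrow> 0 \<le> y i"
  defines "\<Phi> \<equiv> \<lambda>x. x ^ Suc N / real (Suc N)"
  defines "D \<equiv> \<lambda>i. alt_sum (\<lambda>x. y i * ((x + y i) ^ N + x ^ N) - 2 * (\<Phi> (x + y i) - \<Phi> x)) ({..k} - {i}) y"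
  shows "split_sum k (\<lambda>z. ennreal (surj_wt N (Suc k) z)) y = ennreal (\<Sum>i\<in>{..k}. y i * D i)"
    and "0 \<le> (\<Sum>i\<in>{..k}. y i * D i)"
proof -
  have D: "(\<integral>\<^sup>+t. ennreal (surj_wt N (Suc k) (case_nat t (case_nat (y i - t) (delete_at i y)))) * indicator {0<..<y i} t \<partial>lborel)
      = ennreal (D i) \<and> 0 \<le> D i" if i: "i \<le> k" for i
  proof -
    let ?K = "{..k} - {i}"
    define g where "g t = alt_sum (\<lambda>x. ((x + y i) ^ N + x ^ N) - ((x + t) ^ N + (x + (y i - t)) ^ N)) ?K y" for t
    define G where "G t = alt_sum (\<lambda>x. t * ((x + y i) ^ N + x ^ N) - (\<Phi> (x + t) - \<Phi> (x + (y i - t)))) ?K y" for t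
    have k: "{..k} = insert 0 (Suc ` {..<k})" by (cases k) (auto simp: lessThan_Suc_atMost atMost_Suc_insert_0)
    have g: "surj_wt N (Suc k) (case_nat t (case_nat (y i - t) (delete_at i y))) = g t" for t
    proof -
      have "surj_wt N (Suc k) (case_nat t (case_nat (y i - t) (delete_at i y))) =
         alt_sum (\<lambda>x. (x + (y i - t) + t) ^ N - (x + (y i - t)) ^ N - ((x + t) ^ N - x ^ N)) {..<k} (delete_at i y)"
        by (simp add: surj_wt_def atMost_Suc_insert_0 alt_sum_case_nat) (simp add: k alt_sum_case_nat)
      also have "\<dots> = g t" unfolding alt_sum_delete_at_remove[OF i] g_def by (simp add: algebra_simps)
      finally show ?thesis .
    qed
    have nn: "0 \<le> g t" if "0 \<le> t" "t \<le> y i" for t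
      unfolding g[symmetric] using that i
      by (intro surj_wt_nonneg) (auto simp: delete_at_def split: nat.split intro!: y)
    have \<Phi>: "(\<Phi> has_real_derivative x ^ N) (at x)" for x
      unfolding \<Phi>_def by (rule derivative_eq_intros refl | simp)+
    have der: "(G has_real_derivative g t) (at t)" for t
      unfolding G_def g_def alt_sum_def
    proof (rule DERIV_sum)
      fix C
      let ?x = "sum y C"
      have "((\<lambda>t. \<Phi> (?x + t)) has_real_derivative (?x + t) ^ N * 1) (at t)"
        by (rule DERIV_chain2[OF \<Phi>]) (auto intro!: derivative_eq_intros)
      moreover have "((\<lambda>t. \<Phi> (?x + (y i - t))) has_real_derivative (?x + (y i - t)) ^ N * (- 1)) (at t)"
        by (rule DERIV_chain2[OF \<Phi>]) (auto intro!: derivative_eq_intros)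
      ultimately show "((\<lambda>t. (- 1) ^ card (?K - C) * (t * ((?x + y i) ^ N + ?x ^ N) - (\<Phi> (?x + t) - \<Phi> (?x + (y i - t)))))
        has_real_derivative (- 1) ^ card (?K - C) * ((?x + y i) ^ N + ?x ^ N - ((?x + t) ^ N + (?x + (y i - t)) ^ N))) (at t)"
        by (auto intro!: derivative_eq_intros)
    qed
    have "(\<integral>\<^sup>+t. ennreal (g t) * indicator {0<..<y i} t \<partial>lborel) = (\<integral>\<^sup>+t. ennreal (g t) * indicator {0..y i} t \<partial>lborel)"
      by (rule nn_integral_open_closed)
    also have "\<dots> = ennreal (G (y i) - G 0)"
    proof (rule nn_integral_FTC_Icc)
      show "g \<in> borel_measurable borel" unfolding g_def alt_sum_def by measurable
    qed (use der nn y[OF i] in \<open>auto intro: has_field_derivative_at_within\<close>)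
    also have "G (y i) - G 0 = D i"
      unfolding G_def D_def alt_sum_diff[symmetric] by (rule arg_cong[where f="\<lambda>\<phi>. alt_sum \<phi> _ _"]) (simp add: fun_eq_iff)
    finally have e: "(\<integral>\<^sup>+t. ennreal (g t) * indicator {0<..<y i} t \<partial>lborel) = ennreal (D i)" .
    have "G 0 \<le> G (y i)"
      by (rule DERIV_nonneg_imp_nondecreasing[OF y[OF i]]) (use der nn in blast)
    then have "0 \<le> D i" using \<open>G (y i) - G 0 = D i\<close> by simp
    then show ?thesis unfolding g using e by simp
  qed
  then show "0 \<le> (\<Sum>i\<in>{..k}. y i * D i)" using y by (intro sum_nonneg) auto
  have "split_sum k (\<lambda>z. ennreal (surj_wt N (Suc k) z)) y = (\<Sum>i\<le>k. ennreal (y i * D i))"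
    unfolding split_sum_def using D y by (intro sum.cong refl) (simp add: ennreal_mult)
  also have "\<dots> = ennreal (\<Sum>i\<in>{..k}. y i * D i)" using D y by (intro sum_ennreal) auto
  finally show "split_sum k (\<lambda>z. ennreal (surj_wt N (Suc k) z)) y = ennreal (\<Sum>i\<in>{..k}. y i * D i)" .
qed

text \<open>The kernel \<open>T\<close> on functions graded by the number of parts:
  \<open>f k\<close> is read at unsorted points with \<open>k + 1\<close> parts, a merge lands in
  the grade below and a split in the grade above. A single part cannot merge, hence the 0 in grade
  0.\<close>

definition split_merge_sum :: "(nat \<Rightarrow> (nat \<Rightarrow> real) \<Rightarrow> ennreal) \<Rightarrow> nat \<Rightarrow> (nat \<Rightarrow> real) \<Rightarrow> ennreal" where
  "split_merge_sum f k y = (case k of 0 \<Rightarrow> 0 | Suc m \<Rightarrow> merge_sum m (f m) y) + split_sum k (f (Suc k)) y"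

text \<open>At total mass 1 the coefficient in \<open>alt_sum_split_merge\<close> is
  \<open>x^2 - (1 - x)^2 = 2 * x - 1\<close>, so the function there is
  \<open>(2 * x - 1) * x ^ N - 2 * x ^ Suc N / (N + 1)\<close>. Its term \<open>- x ^ N\<close> is
  cancelled by the added \<open>surj_wt N\<close>, the contribution of \<open>E\<close>, and a
  multiple of \<open>x ^ Suc N\<close> remains.\<close>

theorem surj_wt_split_merge:
  assumes y: "\<And>i. i \<le> k \<Longrightarrow> 0 \<le> y i" and s: "(\<Sum>i\<le>k. y i) = 1"
  shows "split_merge_sum (\<lambda>k y. ennreal (surj_wt N k y)) k y + ennreal (surj_wt N k y) =
    ennreal (2 * real N / real (Suc N) * surj_wt (Suc N) k y)"
proof -
  let ?\<Phi> = "\<lambda>x. x ^ Suc N / real (Suc N)"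
  let ?M = "\<Sum>i\<in>{..k}. \<Sum>j\<in>{..k} - {i}. y i * y j * alt_sum (\<lambda>x. (x + (y i + y j)) ^ N - x ^ N) ({..k} - {i} - {j}) y"
  let ?S = "\<Sum>i\<in>{..k}. y i * alt_sum (\<lambda>x. y i * ((x + y i) ^ N + x ^ N) - 2 * (?\<Phi> (x + y i) - ?\<Phi> x)) ({..k} - {i}) y"
  have "(case k of 0 \<Rightarrow> 0 | Suc m \<Rightarrow> merge_sum m (\<lambda>z. ennreal (surj_wt N m z)) y) = ennreal ?M" and M: "0 \<le> ?M"
  proof -
    have "(case k of 0 \<Rightarrow> 0 | Suc m \<Rightarrow> merge_sum m (\<lambda>z. ennreal (surj_wt N m z)) y) = ennreal ?M \<and> 0 \<le> ?M"
    proof (cases k)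
      case (Suc m) then show ?thesis using surj_wt_merge[of m y N] y by auto
    qed simp
    then show "(case k of 0 \<Rightarrow> 0 | Suc m \<Rightarrow> merge_sum m (\<lambda>z. ennreal (surj_wt N m z)) y) = ennreal ?M" and "0 \<le> ?M" by blast+
  qed
  then have "split_merge_sum (\<lambda>k y. ennreal (surj_wt N k y)) k y + ennreal (surj_wt N k y) = ennreal (?M + ?S + surj_wt N k y)"
    unfolding split_merge_sum_def using surj_wt_split[of k y N, OF y] surj_wt_nonneg[of k y N, OF y]
    by simp
  also have "?M + ?S = alt_sum (\<lambda>x. (x\<^sup>2 - (1 - x)\<^sup>2) * x ^ N - 2 * 1 * ?\<Phi> x) {..k} y"
    using s by (intro alt_sum_split_merge) auto
  also have "(\<lambda>x::real. (x\<^sup>2 - (1 - x)\<^sup>2) * x ^ N - 2 * 1 * ?\<Phi> x) = (\<lambda>x. 2 * real N / real (Suc N) * x ^ Suc N - x ^ N)"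
  proof
    fix x :: real
    have "(x\<^sup>2 - (1 - x)\<^sup>2) * x ^ N = 2 * x ^ Suc N - x ^ N" by (simp add: power2_eq_square algebra_simps)
    moreover have "2 * real N / real (Suc N) * x ^ Suc N = 2 * x ^ Suc N - 2 * 1 * ?\<Phi> x" by (simp add: field_simps)
    ultimately show "(x\<^sup>2 - (1 - x)\<^sup>2) * x ^ N - 2 * 1 * ?\<Phi> x = 2 * real N / real (Suc N) * x ^ Suc N - x ^ N" by simp
  qed
  also have "alt_sum (\<lambda>x. 2 * real N / real (Suc N) * x ^ Suc N - x ^ N) {..k} y = 2 * real N / real (Suc N) * surj_wt (Suc N) k y - surj_wt N k y"
    unfolding alt_sum_diff alt_sum_cmult surj_wt_def ..
  finally show ?thesis by simp
qed

section \<open>The split-merge law at finitely supported points\<close>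

lemma decr_rearr_bij:
  assumes "bij \<pi>" shows "decr_rearr (y \<circ> \<pi>) = decr_rearr y"
proof
  fix k
  have "(\<lambda>A. Min ((y \<circ> \<pi>) ` A)) ` {A. card A = Suc k} = (\<lambda>A. Min (y ` A)) ` {A. card A = Suc k}"
  proof (intro equalityI subsetI)
    fix x assume "x \<in> (\<lambda>A. Min ((y \<circ> \<pi>) ` A)) ` {A. card A = Suc k}"
    then obtain A where A: "card A = Suc k" "x = Min (y ` (\<pi> ` A))" by (auto simp: image_comp)
    have "inj_on \<pi> A" using assms by (meson bij_is_inj inj_on_subset subset_UNIV)
    then have "card (\<pi> ` A) = Suc k" using A(1) by (simp add: card_image)
    then show "x \<in> (\<lambda>A. Min (y ` A)) ` {A. card A = Suc k}" using A(2) by blast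
  next
    fix x assume "x \<in> (\<lambda>A. Min (y ` A)) ` {A. card A = Suc k}"
    then obtain A where A: "card A = Suc k" "x = Min (y ` A)" by auto
    have "card (inv \<pi> ` A) = Suc k"
      using A(1) assms by (subst card_image) (auto intro!: inj_on_subset[OF bij_is_inj[OF bij_imp_bij_inv]])
    moreover have "\<pi> ` inv \<pi> ` A = A" using assms by (simp add: bij_is_surj image_f_inv_f)
    then have "(y \<circ> \<pi>) ` (inv \<pi> ` A) = y ` A" by (metis image_comp)
    then have "x = Min ((y \<circ> \<pi>) ` (inv \<pi> ` A))" using A(2) by simp
    ultimately show "x \<in> (\<lambda>A. Min ((y \<circ> \<pi>) ` A)) ` {A. card A = Suc k}" by blast
  qed
  then show "decr_rearr (y \<circ> \<pi>) k = decr_rearr y k" unfolding decr_rearr_def by simp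
qed

lemma decr_rearr_eqI:
  assumes y: "\<And>i. 0 \<le> y i" "y \<longlonglongrightarrow> 0" and z: "\<And>i. 0 \<le> z i" "z \<longlonglongrightarrow> 0"
    and c: "\<And>t. 0 < t \<Longrightarrow> card {i. t \<le> y i} = card {i. t \<le> z i}"
  shows "decr_rearr y = decr_rearr z"
proof
  fix k
  have *: "t \<le> decr_rearr y k \<longleftrightarrow> t \<le> decr_rearr z k" if "0 < t" for t
    using decr_rearr_less_iff(2)[OF y that] decr_rearr_less_iff(2)[OF z that] c[OF that] by simp
  show "decr_rearr y k = decr_rearr z k"
    using *[of "decr_rearr y k"] *[of "decr_rearr z k"] decr_rearr_nonneg[OF y, of k] decr_rearr_nonneg[OF z, of k]
    by linarith
qed

lemma case_nat_tendsto: "y \<longlonglongrightarrow> l \<Longrightarrow> case_nat t y \<longlonglongrightarrow> l"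
  by (subst filterlim_sequentially_Suc[symmetric]) simp

lemma decr_rearr_zero:
  assumes "\<And>i. 0 \<le> y i" "y \<longlonglongrightarrow> 0" shows "decr_rearr (case_nat 0 y) = decr_rearr y"
proof (rule decr_rearr_eqI)
  fix t :: real assume "0 < t"
  then have "{i. t \<le> case_nat 0 y i} = Suc ` {i. t \<le> y i}" by (auto split: nat.splits simp: image_iff gr0_conv_Suc)
  then show "card {i. t \<le> case_nat 0 y i} = card {i. t \<le> y i}" by (simp add: card_image)
qed (use assms in \<open>auto split: nat.split intro: case_nat_tendsto\<close>)

lemma decr_rearr_decseq:
  assumes "decseq x" "\<And>i. 0 \<le> x i" "x \<longlonglongrightarrow> 0" shows "decr_rearr x = x"
proof
  fix k
  have *: "t \<le> decr_rearr x k \<longleftrightarrow> t \<le> x k" if "0 < t" for t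
  proof -
    have fin: "finite {i. t \<le> x i}" by (rule decr_rearr_less_iff(1)[OF assms(2,3) that])
    have "k < card {i. t \<le> x i} \<longleftrightarrow> t \<le> x k"
    proof
      assume "t \<le> x k"
      then have "{..k} \<subseteq> {i. t \<le> x i}" using decseqD[OF assms(1)] by (auto intro: order_trans)
      from card_mono[OF fin this] show "k < card {i. t \<le> x i}" by simp
    next
      assume k: "k < card {i. t \<le> x i}"
      have "\<not> {i. t \<le> x i} \<subseteq> {..<k}" using card_mono[of "{..<k}" "{i. t \<le> x i}"] k by auto
      then obtain i where "i \<in> {i. t \<le> x i}" "i \<notin> {..<k}" by blast
      then have "t \<le> x i" "k \<le> i" by auto
      then show "t \<le> x k" using decseqD[OF assms(1)] by (meson order_trans)
    qed
    then show ?thesis using decr_rearr_less_iff(2)[OF assms(2,3) that] by simp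
  qed
  show "decr_rearr x k = x k"
    using *[of "decr_rearr x k"] *[of "x k"] decr_rearr_nonneg[OF assms(2,3), of k] assms(2)[of k]
    by linarith
qed

lemma Sigma1_tendsto: "x \<in> Sigma1 \<Longrightarrow> x \<longlonglongrightarrow> 0"
  unfolding Sigma1_def by (auto intro: summable_LIMSEQ_zero sums_summable)

lemma decr_rearr_Sigma1_id: "x \<in> Sigma1 \<Longrightarrow> decr_rearr x = x"
  by (rule decr_rearr_decseq) (auto simp: Sigma1_def intro: Sigma1_tendsto)

lemma finite_support_tendsto: "(\<And>i. k < i \<Longrightarrow> y i = 0) \<Longrightarrow> y \<longlonglongrightarrow> (0::real)"
  by (rule tendsto_eventually) (auto simp: eventually_sequentially intro!: exI[of _ "Suc k"])

lemma decr_rearr_permutes: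
  assumes nn: "\<And>i. 0 \<le> y i" and z: "\<And>i. k < i \<Longrightarrow> y i = 0"
  obtains \<pi> where "\<pi> permutes {..k}" "decr_rearr y = y \<circ> \<pi>"
proof -
  define xs where "xs = map y [0..<Suc k]"
  have "mset (rev (sort xs)) = mset xs" by simp
  then obtain \<pi> where \<pi>: "\<pi> permutes {..<length xs}" "permute_list \<pi> xs = rev (sort xs)"
    by (metis mset_eq_permutation)
  have l: "length xs = Suc k" by (simp add: xs_def)
  have p: "\<pi> permutes {..k}" using \<pi>(1) by (simp add: l lessThan_Suc_atMost)
  have yp: "y (\<pi> i) = rev (sort xs) ! i" if "i \<le> k" for i
  proof -
    have "permute_list \<pi> xs ! i = xs ! \<pi> i" using \<pi>(1) l that by (intro permute_list_nth) auto
    moreover have "\<pi> i < Suc k" using permutes_in_image[OF p, of i] that by auto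
    ultimately show ?thesis unfolding \<pi>(2)[symmetric] by (simp add: xs_def del: upt_Suc)
  qed
  have "decseq (y \<circ> \<pi>)"
  proof (rule decseq_SucI)
    fix i show "(y \<circ> \<pi>) (Suc i) \<le> (y \<circ> \<pi>) i"
    proof (cases "Suc i \<le> k")
      case True
      then show ?thesis using sorted_rev_nth_mono[of "rev (sort xs)" i "Suc i"] l by (simp add: yp)
    next
      case False
      then have "y (\<pi> (Suc i)) = 0" using permutes_not_in[OF p, of "Suc i"] z by simp
      then show ?thesis using nn by simp
    qed
  qed
  moreover have "(y \<circ> \<pi>) \<longlonglongrightarrow> 0"
    by (rule finite_support_tendsto[of k]) (use z permutes_not_in[OF p] in auto)
  ultimately have "decr_rearr (y \<circ> \<pi>) = y \<circ> \<pi>" by (intro decr_rearr_decseq) (auto intro: nn)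
  then have "decr_rearr y = y \<circ> \<pi>" using decr_rearr_bij[OF permutes_bij[OF p], of y] by simp
  then show ?thesis using that p by blast
qed

lemma bij_to_front: obtains \<pi> where "bij \<pi>" "\<And>y. to_front i y = y \<circ> \<pi>"
  using to_front_permutes[of i i] permutes_bij by (metis order_refl)

lemma bij_lift: "bij \<pi> \<Longrightarrow> bij (case_nat 0 (\<lambda>m. Suc (\<pi> m)))"
proof (rule bijI)
  assume b: "bij \<pi>"
  show "inj (case_nat 0 (\<lambda>m. Suc (\<pi> m)))"
    using inj_eq[OF bij_is_inj[OF b]] by (auto simp: inj_def split: nat.splits)
  show "surj (case_nat 0 (\<lambda>m. Suc (\<pi> m)))"
  proof (rule surjI)
    show "case_nat 0 (\<lambda>m. Suc (\<pi> m)) (case_nat 0 (\<lambda>m. Suc (inv \<pi> m)) x) = x" for x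
      using b by (cases x) (auto simp: bij_is_surj surj_f_inv_f)
  qed
qed

lemma decr_rearr_to_front: "decr_rearr (to_front i y) = decr_rearr y"
  using bij_to_front[of i] decr_rearr_bij by metis

lemma decr_rearr_case_nat_bij: "bij \<pi> \<Longrightarrow> decr_rearr (case_nat t (y \<circ> \<pi>)) = decr_rearr (case_nat t y)"
  unfolding case_nat_o_lift[symmetric] by (intro decr_rearr_bij bij_lift)

lemma decr_rearr_case_nat_to_front: "decr_rearr (case_nat t (to_front i y)) = decr_rearr (case_nat t y)"
  using bij_to_front[of i] decr_rearr_case_nat_bij by metis

lemma delete_at_upd [simp]: "delete_at i (y(i := c)) = delete_at i y"
  by (auto simp: delete_at_def)

text \<open>A merge may be written in place: slot \<open>a\<close> receives \<open>c\<close> and the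
  other slot becomes 0, since a zero does not affect the sorted sequence. The in-place form
  transforms simply under permutations. The conditional undoes the index shift caused by the first
  deletion.\<close>

lemma decr_rearr_delete_two:
  assumes nn: "\<And>i. 0 \<le> y i" "0 \<le> c" and z: "y \<longlonglongrightarrow> 0"
  shows "decr_rearr (case_nat c (delete_at b (delete_at a y))) = decr_rearr (y(a := c, (if b < a then b else Suc b) := 0))"
proof -
  let ?j = "if b < a then b else Suc b"
  have d: "delete_at a (y(a := c, ?j := 0)) = (delete_at a y)(b := 0)"
    by (auto simp: delete_at_def fun_eq_iff)
  have dz: "delete_at i x \<longlonglongrightarrow> 0" if "x \<longlonglongrightarrow> 0" for x :: "nat \<Rightarrow> real" and i
  proof -
    have "(\<lambda>k. delete_at i x (k + i)) \<longlonglongrightarrow> 0"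
      using LIMSEQ_ignore_initial_segment[OF that, of "Suc i"] by (simp add: delete_at_def)
    then show ?thesis by (rule LIMSEQ_offset)
  qed
  have "decr_rearr (y(a := c, ?j := 0)) = decr_rearr (to_front a (y(a := c, ?j := 0)))" by (simp only: decr_rearr_to_front)
  also have "\<dots> = decr_rearr (case_nat c ((delete_at a y)(b := 0)))"
    unfolding to_front_def d by simp
  also have "\<dots> = decr_rearr (case_nat c (to_front b ((delete_at a y)(b := 0))))" by (simp only: decr_rearr_case_nat_to_front)
  also have "\<dots> = decr_rearr (to_front 1 (case_nat c (case_nat 0 (delete_at b (delete_at a y)))))"
    by (simp only: decr_rearr_to_front) (simp add: to_front_def)
  also have "\<dots> = decr_rearr (case_nat 0 (case_nat c (delete_at b (delete_at a y))))"
    by (simp add: to_front_def)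
  also have "\<dots> = decr_rearr (case_nat c (delete_at b (delete_at a y)))"
    by (intro decr_rearr_zero case_nat_tendsto dz z) (auto split: nat.split simp: delete_at_def nn)
  finally show ?thesis by simp
qed

lemma decr_rearr_split:
  "decr_rearr (case_nat t (case_nat u (delete_at i y))) = decr_rearr (case_nat t (y(i := u)))"
  using decr_rearr_case_nat_to_front[of t i "y(i := u)"] by (simp add: to_front_def)

text \<open>Extends \<open>emeasure_split_merge_law\<close> from indicators by induction on
  measurable functions. Writing the sums as integrals over counting measures, in \<open>R\<close>,
  reduces linearity and monotone convergence to the usual rules for integrals.\<close>

lemma nn_integral_split_merge_law:
  assumes F: "F \<in> borel_measurable Sigma1_borel" and x: "x \<in> Sigma1"
  shows "(\<integral>\<^sup>+z. F z \<partial>split_merge_law x) =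
     (\<Sum>j. \<Sum>i<j. ennreal (2 * x i * x j) * F (merge_parts x i j)) +
     (\<Sum>i. \<integral>\<^sup>+t\<in>{0..x i}. ennreal (x i) * F (split_part x i t) \<partial>lborel)"
proof -
  have c: "(\<Sum>i<j. a i) = (\<integral>\<^sup>+i. a i \<partial>count_space {..<j})" for a :: "nat \<Rightarrow> ennreal" and j
    by (subst nn_integral_count_space_finite) auto
  have F': "F \<in> borel_measurable (split_merge_law x)" using F by (simp cong: measurable_cong_sets)
  have s: "split_part x i \<in> borel \<rightarrow>\<^sub>M borel" for i
  proof -
    have "(\<lambda>t. case (x, t) of (x, t) \<Rightarrow> split_part x i t) \<in> borel \<rightarrow>\<^sub>M borel"
      by (rule measurable_compose[OF measurable_Pair1' meas_split]) simp
    then show ?thesis by simp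
  qed
  \<comment> \<open>\<open>F\<close> is measurable only on \<open>Sigma1\<close>, so for
    \<open>t\<close> outside \<open>{0..x i}\<close>, where \<open>split_part\<close> may leave the
    simplex, the map takes the default value \<open>x\<close>.\<close>
  have s1: "(\<lambda>t. if 0 \<le> t \<and> t \<le> x i then split_part x i t else x) \<in> lborel \<rightarrow>\<^sub>M Sigma1_borel" for i
    using s x by (intro measurable_restrict_space2) (auto intro: split_part_Sigma1)
  have m: "(\<lambda>t. ennreal (x i) * F (split_part x i t) * indicator {0..x i} t) \<in> borel_measurable lborel"
    if "F \<in> borel_measurable Sigma1_borel" for F i
  proof -
    have "(\<lambda>t. ennreal (x i) * F (if 0 \<le> t \<and> t \<le> x i then split_part x i t else x) * indicator {0..x i} t) \<in> borel_measurable lborel"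
      by (intro borel_measurable_times_ennreal measurable_compose[OF s1 that]) auto
    also have "(\<lambda>t. ennreal (x i) * F (if 0 \<le> t \<and> t \<le> x i then split_part x i t else x) * indicator {0..x i} t)
      = (\<lambda>t. ennreal (x i) * F (split_part x i t) * indicator {0..x i} t)" by (auto simp: indicator_def)
    finally show ?thesis .
  qed
  define R where "R F = (\<integral>\<^sup>+j. \<integral>\<^sup>+i. ennreal (2 * x i * x j) * F (merge_parts x i j) \<partial>count_space {..<j} \<partial>count_space UNIV) +
     (\<integral>\<^sup>+i. \<integral>\<^sup>+t. ennreal (x i) * F (split_part x i t) * indicator {0..x i} t \<partial>lborel \<partial>count_space UNIV)" for F :: "(nat \<Rightarrow> real) \<Rightarrow> ennreal"
  have em: "emeasure (split_merge_law x) A = R (indicator A)" if "A \<in> sets Sigma1_borel" for A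
    unfolding emeasure_split_merge_law[OF that] R_def nn_integral_count_space_nat c ..
  have "(\<integral>\<^sup>+z. F z \<partial>split_merge_law x) = R F"
    using F'
  proof (induction rule: borel_measurable_induct)
    case (cong f g)
    have e: "f z = g z" if "z \<in> Sigma1" for z using cong that by simp
    have "R f = R g" unfolding R_def
      by (intro arg_cong2[where f="(+)"] nn_integral_cong)
         (auto simp: e merge_parts_Sigma1[OF x] indicator_def split_part_Sigma1[OF x])
    moreover have "(\<integral>\<^sup>+z. f z \<partial>split_merge_law x) = (\<integral>\<^sup>+z. g z \<partial>split_merge_law x)" by (rule nn_integral_cong) (simp add: e)
    ultimately show ?case using cong by simp
  next
    case (set A) then show ?case using em[of A] by simp
  next
    case (mult u c)
    then have "u \<in> borel_measurable Sigma1_borel" by (simp cong: measurable_cong_sets)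
    have "R (\<lambda>z. c * u z) = c * R u"
    proof -
      have a: "(\<integral>\<^sup>+t. ennreal (x i) * (c * u (split_part x i t)) * indicator {0..x i} t \<partial>lborel) = 
         c * (\<integral>\<^sup>+t. ennreal (x i) * u (split_part x i t) * indicator {0..x i} t \<partial>lborel)" for i
        by (subst nn_integral_cmult[symmetric, OF m]) (fact, simp add: ac_simps)
      have b: "(\<integral>\<^sup>+i. ennreal (2 * x i * x j) * (c * u (merge_parts x i j)) \<partial>count_space {..<j}) =
        c * (\<integral>\<^sup>+i. ennreal (2 * x i * x j) * u (merge_parts x i j) \<partial>count_space {..<j})" for j
        by (subst nn_integral_cmult[symmetric]) (auto simp: ac_simps)
      show ?thesis unfolding R_def a b by (simp add: nn_integral_cmult distrib_left)
    qed
    then show ?case using mult by (simp add: nn_integral_cmult)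
  next
    case (add u v)
    then have uv: "u \<in> borel_measurable Sigma1_borel" "v \<in> borel_measurable Sigma1_borel" by (simp_all cong: measurable_cong_sets)
    have "R (\<lambda>z. v z + u z) = R v + R u"
    proof -
      have a: "(\<integral>\<^sup>+t. ennreal (x i) * (v (split_part x i t) + u (split_part x i t)) * indicator {0..x i} t \<partial>lborel) = 
         (\<integral>\<^sup>+t. ennreal (x i) * v (split_part x i t) * indicator {0..x i} t \<partial>lborel) +
         (\<integral>\<^sup>+t. ennreal (x i) * u (split_part x i t) * indicator {0..x i} t \<partial>lborel)" for i
        by (subst nn_integral_add[symmetric, OF m m]) (fact, fact, simp add: distrib_left distrib_right)
      have b: "(\<integral>\<^sup>+i. ennreal (2 * x i * x j) * (v (merge_parts x i j) + u (merge_parts x i j)) \<partial>count_space {..<j}) =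
        (\<integral>\<^sup>+i. ennreal (2 * x i * x j) * v (merge_parts x i j) \<partial>count_space {..<j}) +
        (\<integral>\<^sup>+i. ennreal (2 * x i * x j) * u (merge_parts x i j) \<partial>count_space {..<j})" for j
        by (subst nn_integral_add[symmetric]) (auto simp: distrib_left)
      show ?thesis unfolding R_def a b by (simp add: nn_integral_add ac_simps)
    qed
    then show ?case using add by (simp add: nn_integral_add)
  next
    case (seq U)
    then have U: "U n \<in> borel_measurable Sigma1_borel" for n by (simp cong: measurable_cong_sets)
    have inc: "incseq U" by fact
    have le: "U n z \<le> U m z" if "n \<le> m" for n m z using incseqD[OF inc that] by (simp add: le_fun_def)
    have "R (\<lambda>z. SUP n. U n z) = (SUP n. R (U n))"
    proof -
      have a: "(\<integral>\<^sup>+t. ennreal (x i) * (SUP n. U n (split_part x i t)) * indicator {0..x i} t \<partial>lborel) = 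
         (SUP n. \<integral>\<^sup>+t. ennreal (x i) * U n (split_part x i t) * indicator {0..x i} t \<partial>lborel)" for i
      proof (subst nn_integral_monotone_convergence_SUP[symmetric])
        show "incseq (\<lambda>n t. ennreal (x i) * U n (split_part x i t) * indicator {0..x i} t)"
          by (auto intro!: incseq_SucI le_funI mult_right_mono mult_left_mono le)
      qed (use m[OF U] in \<open>auto simp: SUP_mult_left_ennreal SUP_mult_right_ennreal\<close>)
      have b: "(\<integral>\<^sup>+i. ennreal (2 * x i * x j) * (SUP n. U n (merge_parts x i j)) \<partial>count_space {..<j}) =
        (SUP n. \<integral>\<^sup>+i. ennreal (2 * x i * x j) * U n (merge_parts x i j) \<partial>count_space {..<j})" for j
      proof (subst nn_integral_monotone_convergence_SUP[symmetric])
        show "incseq (\<lambda>n i. ennreal (2 * x i * x j) * U n (merge_parts x i j))"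
          by (auto intro!: incseq_SucI le_funI mult_left_mono le)
      qed (auto simp: SUP_mult_left_ennreal)
      have i1: "incseq (\<lambda>n j. \<integral>\<^sup>+i. ennreal (2 * x i * x j) * U n (merge_parts x i j) \<partial>count_space {..<j})"
        by (intro incseq_SucI le_funI nn_integral_mono mult_left_mono le) auto
      have i2: "incseq (\<lambda>n i. \<integral>\<^sup>+t. ennreal (x i) * U n (split_part x i t) * indicator {0..x i} t \<partial>lborel)"
        by (intro incseq_SucI le_funI nn_integral_mono mult_right_mono mult_left_mono le) auto
      show ?thesis unfolding R_def a b
        by (subst (1 2) nn_integral_monotone_convergence_SUP)
           (auto intro!: i1 i2 ennreal_SUP_add[symmetric] incseq_SucI nn_integral_mono mult_right_mono mult_left_mono le)
    qed
    moreover have "(\<integral>\<^sup>+z. (SUP n. U n z) \<partial>split_merge_law x) = (SUP n. \<integral>\<^sup>+z. U n z \<partial>split_merge_law x)"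
      by (rule nn_integral_monotone_convergence_SUP[OF inc seq(1)])
    ultimately show ?case using seq by (simp add: image_comp)
  qed
  then show ?thesis unfolding R_def nn_integral_count_space_nat c .
qed


lemma sum_less_symmetrize:
  fixes g :: "nat \<Rightarrow> nat \<Rightarrow> ennreal"
  shows "(\<Sum>j\<le>k. \<Sum>i<j. g i j + g j i) = (\<Sum>i\<le>k. \<Sum>j\<in>{..k} - {i}. g i j)"
proof (induction k)
  case (Suc k)
  have "(\<Sum>j\<in>{..Suc k} - {i}. g i j) = (\<Sum>j\<in>{..k} - {i}. g i j) + g i (Suc k)" if "i \<le> k" for i
  proof -
    have "{..Suc k} - {i} = insert (Suc k) ({..k} - {i})" using that by auto
    then show ?thesis by (simp add: add.commute)
  qed
  moreover have "{..Suc k} - {Suc k} = {..k}" by auto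
  ultimately show ?case using Suc by (simp add: sum.distrib lessThan_Suc_atMost ac_simps)
qed simp

text \<open>The kernel is applied at a sorted point, whereas the simplex integrals run over all
  orders of the parts. The sums over parts are invariant under the sorting permutation
  \<open>\<pi>\<close>, so they can be evaluated at \<open>y\<close> itself.\<close>

theorem nn_integral_split_merge_law_finite:
  assumes F: "F \<in> borel_measurable Sigma1_borel"
    and pos: "\<And>i. i \<le> k \<Longrightarrow> 0 < y i" and z: "\<And>i. k < i \<Longrightarrow> y i = 0" and s: "(\<Sum>i\<le>k. y i) = 1"
  shows "(\<integral>\<^sup>+x. F x \<partial>split_merge_law (decr_rearr y)) = split_merge_sum (\<lambda>_ y. F (decr_rearr y)) k y"
proof -
  have nn: "0 \<le> y i" for i using pos[of i] z[of i] by (cases "i \<le> k") auto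
  have y0: "y \<longlonglongrightarrow> 0" using z by (rule finite_support_tendsto)
  have "y sums (\<Sum>i\<le>k. y i)" by (rule sums_finite) (auto simp: z)
  then have S: "decr_rearr y \<in> Sigma1" using nn s by (intro decr_rearr_Sigma1) auto
  obtain \<pi> where \<pi>: "\<pi> permutes {..k}" "decr_rearr y = y \<circ> \<pi>"
    using decr_rearr_permutes[of y k] nn z by blast
  define x where "x = decr_rearr y"
  have x: "x = y \<circ> \<pi>" by (simp add: x_def \<pi>)
  have x0: "x i = 0" if "k < i" for i using that permutes_not_in[OF \<pi>(1)] z by (simp add: x)
  have xnn: "0 \<le> x i" for i by (simp add: x nn)
  have xl: "x \<longlonglongrightarrow> 0" using x0 by (rule finite_support_tendsto)
  \<comment> \<open>Part \<open>j\<close> is merged into slot \<open>i\<close>, leaving a zero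
    behind. Because \<open>g\<close> is symmetric, the factor 2 over pairs \<open>i < j\<close>
    becomes a sum over ordered pairs.\<close>
  define g where "g z i j = ennreal (z i) * ennreal (z j) * F (decr_rearr (z(i := z i + z j, j := 0)))" for z :: "nat \<Rightarrow> real" and i j
  have g_sym: "g z i j = g z j i" if "i \<noteq> j" for z i j
  proof -
    have "(z(i := z i + z j, j := 0)) \<circ> Transposition.transpose i j = z(j := z i + z j, i := 0)"
      using that by (auto simp: fun_eq_iff Transposition.transpose_def)
    then have "decr_rearr (z(i := z i + z j, j := 0)) = decr_rearr (z(j := z i + z j, i := 0))"
      by (metis decr_rearr_bij bij_transpose)
    then show ?thesis by (simp only: g_def add.commute[of "z j"] mult.commute[of "ennreal (z j)"])
  qed
  have g_perm: "g x i j = g y (\<pi> i) (\<pi> j)" for i j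
  proof -
    have "x(i := x i + x j, j := 0) = (y(\<pi> i := y (\<pi> i) + y (\<pi> j), \<pi> j := 0)) \<circ> \<pi>"
      by (auto simp: fun_eq_iff x inj_eq[OF permutes_inj[OF \<pi>(1)]])
    then show ?thesis unfolding g_def
      by (simp add: decr_rearr_bij[OF permutes_bij[OF \<pi>(1)]]) (simp add: x)
  qed
  have mg: "ennreal (2 * x i * x j) * F (merge_parts x i j) = g x i j + g x j i" if "i < j" for i j
  proof -
    have "merge_parts x i j = decr_rearr (x(j := x i + x j, i := 0))"
      unfolding merge_parts_def using decr_rearr_delete_two[OF xnn _ xl, of "x i + x j" i j] that xnn by simp
    then have "g x j i = ennreal (x i) * ennreal (x j) * F (merge_parts x i j)"
      by (simp only: g_def add.commute[of "x j"] mult.commute[of "ennreal (x j)"])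
    moreover have "ennreal (2 * x i * x j) = 2 * (ennreal (x i) * ennreal (x j))"
      using xnn by (simp add: ennreal_mult mult.assoc)
    ultimately have "ennreal (2 * x i * x j) * F (merge_parts x i j) = 2 * g x j i" by (simp only: mult.assoc)
    moreover have "g x i j = g x j i" using that by (intro g_sym) simp
    ultimately show ?thesis by (simp only: mult_2)
  qed
  have M: "(\<Sum>j. \<Sum>i<j. ennreal (2 * x i * x j) * F (merge_parts x i j)) =
    (case k of 0 \<Rightarrow> 0 | Suc m \<Rightarrow> merge_sum m (\<lambda>y. F (decr_rearr y)) y)"
  proof -
    have "(\<Sum>j. \<Sum>i<j. ennreal (2 * x i * x j) * F (merge_parts x i j)) =
       (\<Sum>j\<le>k. \<Sum>i<j. ennreal (2 * x i * x j) * F (merge_parts x i j))"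
      by (rule suminf_finite) (auto simp: x0)
    also have "\<dots> = (\<Sum>j\<le>k. \<Sum>i<j. g x i j + g x j i)" by (intro sum.cong refl mg) simp
    also have "\<dots> = (\<Sum>i\<le>k. \<Sum>j\<in>{..k} - {i}. g x i j)" by (rule sum_less_symmetrize)
    also have "\<dots> = (\<Sum>i\<le>k. \<Sum>j\<in>{..k} - {i}. g y i j)"
    proof -
      have "(\<Sum>j\<in>{..k} - {i}. g x i j) = (\<Sum>j\<in>{..k} - {\<pi> i}. g y (\<pi> i) j)" if "i \<le> k" for i
        unfolding g_perm
      proof (rule sum.reindex_bij_betw)
        have "inj_on \<pi> {..k}" "\<pi> ` {..k} = {..k}" using permutes_inj_on[OF \<pi>(1)] permutes_image[OF \<pi>(1)] by auto
        then show "bij_betw \<pi> ({..k} - {i}) ({..k} - {\<pi> i})"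
          using that by (auto simp: bij_betw_def inj_on_image_set_diff[where C="{..k}"] intro: inj_on_subset)
      qed
      then have "(\<Sum>i\<le>k. \<Sum>j\<in>{..k} - {i}. g x i j) = (\<Sum>i\<le>k. \<Sum>j\<in>{..k} - {\<pi> i}. g y (\<pi> i) j)" by simp
      also have "\<dots> = (\<Sum>i\<le>k. \<Sum>j\<in>{..k} - {i}. g y i j)"
        using sum.permute[OF \<pi>(1), of "\<lambda>i. \<Sum>j\<in>{..k} - {i}. g y i j"] by (simp add: comp_def)
      finally show ?thesis .
    qed
    also have "\<dots> = (case k of 0 \<Rightarrow> 0 | Suc m \<Rightarrow> merge_sum m (\<lambda>y. F (decr_rearr y)) y)"
    proof (cases k)
      case (Suc m)
      let ?h = "\<lambda>i j. if j < i then j else Suc j"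
      have "(\<Sum>j\<in>{..Suc m} - {i}. g y i j) = (\<Sum>j\<le>m. ennreal (y i) * ennreal (delete_at i y j) *
          F (decr_rearr (case_nat (y i + delete_at i y j) (delete_at j (delete_at i y)))))" if "i \<le> Suc m" for i
      proof -
        have "(\<Sum>j\<in>{..Suc m} - {i}. g y i j) = (\<Sum>j\<le>m. g y i (?h i j))"
          by (rule sum.reindex_bij_betw[OF alt_sum_delete_at(2)[OF that], symmetric])
        also have "\<dots> = (\<Sum>j\<le>m. ennreal (y i) * ennreal (delete_at i y j) *
          F (decr_rearr (case_nat (y i + delete_at i y j) (delete_at j (delete_at i y)))))"
        proof (rule sum.cong[OF refl])
          fix j
          have d: "delete_at i y j = y (?h i j)" by (simp add: delete_at_def)
          show "g y i (?h i j) = ennreal (y i) * ennreal (delete_at i y j) *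
             F (decr_rearr (case_nat (y i + delete_at i y j) (delete_at j (delete_at i y))))"
            unfolding decr_rearr_delete_two[OF nn add_nonneg_nonneg[OF nn nn[of "?h i j"], folded d] y0]
            unfolding g_def d ..
        qed
        finally show ?thesis .
      qed
      then show ?thesis unfolding Suc merge_sum_def by (auto intro!: sum.cong)
    qed simp
    finally show ?thesis .
  qed
  have Sp: "(\<Sum>i. \<integral>\<^sup>+t\<in>{0..x i}. ennreal (x i) * F (split_part x i t) \<partial>lborel) = split_sum k (\<lambda>y. F (decr_rearr y)) y"
  proof -
    define q where "q z i = (\<integral>\<^sup>+t\<in>{0..z i}. ennreal (z i) * F (decr_rearr (case_nat t (z(i := z i - t)))) \<partial>lborel)" for z :: "nat \<Rightarrow> real" and i
    have "(\<Sum>i. \<integral>\<^sup>+t\<in>{0..x i}. ennreal (x i) * F (split_part x i t) \<partial>lborel) = (\<Sum>i. q x i)"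
      unfolding q_def split_part_def decr_rearr_split ..
    also have "\<dots> = (\<Sum>i\<le>k. q x i)"
    proof (rule suminf_finite)
      fix i assume "i \<notin> {..k}"
      then have "x i = 0" using x0 by simp
      then show "q x i = 0" by (simp add: q_def)
    qed simp
    also have "\<dots> = (\<Sum>i\<le>k. q y (\<pi> i))"
    proof (rule sum.cong[OF refl])
      fix i
      have "x(i := c) = (y(\<pi> i := c)) \<circ> \<pi>" for c
        by (auto simp: fun_eq_iff x inj_eq[OF permutes_inj[OF \<pi>(1)]])
      then show "q x i = q y (\<pi> i)" unfolding q_def
        by (simp add: decr_rearr_case_nat_bij[OF permutes_bij[OF \<pi>(1)]]) (simp add: x)
    qed
    also have "\<dots> = (\<Sum>i\<le>k. q y i)" using sum.permute[OF \<pi>(1), of "q y"] by (simp add: comp_def)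
    also have "\<dots> = split_sum k (\<lambda>y. F (decr_rearr y)) y"
      unfolding split_sum_def
    proof (rule sum.cong[OF refl])
      fix i assume i: "i \<in> {..k}"
      define h where "h t = F (decr_rearr (case_nat t (case_nat (y i - t) (delete_at i y)))) * indicator {0<..<y i} t" for t
      have [measurable]: "h \<in> borel_measurable lborel"
      proof -
        let ?w = "\<lambda>t. if 0 < t \<and> t < y i then decr_rearr (case_nat t (case_nat (y i - t) (delete_at i y))) else decr_rearr y"
        have "?w \<in> lborel \<rightarrow>\<^sub>M Sigma1_borel"
        proof (rule measurable_restrict_space2)
          have ds: "delete_at i y sums (1 - y i)" using \<open>y sums _\<close> s by (intro delete_at_sums) simp
          have "decr_rearr (case_nat t (case_nat (y i - t) (delete_at i y))) \<in> Sigma1" if "0 < t" "t < y i" for t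
            using that case_nat_sums[OF case_nat_sums[OF ds, of "y i - t"], of t] nn
            by (intro decr_rearr_Sigma1) (auto split: nat.split simp: delete_at_def)
          then show "?w \<in> space lborel \<rightarrow> Sigma1" using S by auto
          have "(\<lambda>t. decr_rearr (case_nat t (case_nat (y i - t) (delete_at i y)))) \<in> lborel \<rightarrow>\<^sub>M borel"
            by (rule measurable_compose[OF _ meas_decr_rearr]) measurable
          then show "?w \<in> lborel \<rightarrow>\<^sub>M borel" by measurable
        qed
        then have "(\<lambda>t. F (?w t) * indicator {0<..<y i} t) \<in> borel_measurable lborel"
          by (intro borel_measurable_times_ennreal measurable_compose[OF _ F]) auto
        also have "(\<lambda>t. F (?w t) * indicator {0<..<y i} t) = h" by (auto simp: h_def indicator_def)
        finally show ?thesis .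
      qed
      have "q y i = (\<integral>\<^sup>+t. ennreal (y i) * h t \<partial>lborel)" unfolding q_def
      proof (rule nn_integral_cong_AE)
        have "AE t in lborel. t \<noteq> (0::real) \<and> t \<noteq> y i" by (intro AE_conjI AE_lborel_singleton)
        then show "AE t in lborel. ennreal (y i) * F (decr_rearr (case_nat t (y(i := y i - t)))) * indicator {0..y i} t = ennreal (y i) * h t"
          by eventually_elim (auto simp: h_def decr_rearr_split indicator_def)
      qed
      also have "\<dots> = ennreal (y i) * (\<integral>\<^sup>+t. h t \<partial>lborel)" by (rule nn_integral_cmult) measurable
      finally show "q y i = ennreal (y i) * (\<integral>\<^sup>+t. F (decr_rearr (case_nat t (case_nat (y i - t) (delete_at i y)))) * indicator {0<..<y i} t \<partial>lborel)"
        unfolding h_def .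
    qed
    finally show ?thesis .
  qed
  show ?thesis
    unfolding nn_integral_split_merge_law[OF F S] split_merge_sum_def
    unfolding x_def[symmetric] M Sp ..
qed

section \<open>Law of the chain started at (1, 0, 0, ...)\<close>

lemma cycle_nn_cong:
  assumes "0 < s"
    and "\<And>y. (\<And>i. i \<le> k \<Longrightarrow> 0 < y i) \<Longrightarrow> (\<And>i. k < i \<Longrightarrow> y i = 0) \<Longrightarrow> (\<Sum>i\<le>k. y i) = s \<Longrightarrow> g y = h y"
  shows "cycle_nn k s g = cycle_nn k s h"
  unfolding cycle_nn_def
  by (rule arg_cong[where f="(*) _"], rule simplex_nn_cong[OF assms(1)]) (simp add: assms(2))

lemma cycle_nn_mono:
  assumes "0 < s"
    and "\<And>y. (\<And>i. i \<le> k \<Longrightarrow> 0 < y i) \<Longrightarrow> (\<And>i. k < i \<Longrightarrow> y i = 0) \<Longrightarrow> (\<Sum>i\<le>k. y i) = s \<Longrightarrow> g y \<le> h y"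
  shows "cycle_nn k s g \<le> cycle_nn k s h"
  unfolding cycle_nn_def
  by (intro mult_left_mono simplex_nn_mono[OF assms(1)] mult_right_mono assms(2)) auto

lemma cycle_nn_cmult:
  assumes [measurable]: "g \<in> borel_measurable borel"
  shows "cycle_nn k s (\<lambda>y. c * g y) = c * cycle_nn k s g"
proof -
  have "simplex_nn k s (\<lambda>y. c * g y * inv_prod k y) = c * simplex_nn k s (\<lambda>y. g y * inv_prod k y)"
    unfolding mult.assoc by (rule simplex_nn_cmult) measurable
  then show ?thesis by (simp only: cycle_nn_def mult.left_commute)
qed

lemma cycle_nn_add:
  assumes [measurable]: "g \<in> borel_measurable borel" "h \<in> borel_measurable borel"
  shows "cycle_nn k s (\<lambda>y. g y + h y) = cycle_nn k s g + cycle_nn k s h"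
proof -
  have "simplex_nn k s (\<lambda>y. (g y + h y) * inv_prod k y) = simplex_nn k s (\<lambda>y. g y * inv_prod k y) + simplex_nn k s (\<lambda>y. h y * inv_prod k y)"
    unfolding distrib_right by (rule simplex_nn_add) measurable
  then show ?thesis by (simp only: cycle_nn_def distrib_left)
qed

lemma measurable_merge_sum [measurable]:
  assumes [measurable]: "g \<in> borel_measurable borel" shows "merge_sum k g \<in> borel_measurable borel"
proof -
  have d: "(\<lambda>y. delete_at i y j) \<in> borel_measurable borel" for i j
    by (rule meas_delete_at) measurable
  show ?thesis unfolding merge_sum_def
    by (intro borel_measurable_sum borel_measurable_times_ennreal measurable_compose[OF d measurable_ennreal]
      measurable_compose[OF _ assms] measurable_case_nat_seq borel_measurable_add d measurable_delete_at) measurable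
qed

lemma measurable_split_sum [measurable]:
  fixes f :: "(nat \<Rightarrow> real) \<Rightarrow> ennreal"
  assumes [measurable]: "f \<in> borel_measurable borel" shows "split_sum k f \<in> borel_measurable borel"
proof -
  have "(\<lambda>y. \<integral>\<^sup>+t. f (case_nat t (case_nat (y i - t) (delete_at i y))) * indicator {0<..<y i} t \<partial>lborel) \<in> borel_measurable borel" for i
    using measurable_compose[OF measurable_to_front[of i] measurable_split_int[OF assms]]
    by (simp only: to_front_simps)
  then show ?thesis unfolding split_sum_def by measurable
qed

text \<open>A merge of a point with \<open>k + 2\<close> parts is matched with a split of a point with \<open>k + 1\<close> parts.\<close>

theorem split_merge_reversible:
  assumes f [measurable]: "\<And>k. f k \<in> borel_measurable borel" and g [measurable]: "\<And>k. g k \<in> borel_measurable borel"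
    and pf: "\<And>k. perm_inv k (f k)" and pg: "\<And>k. perm_inv k (g k)" and s: "0 < s"
  shows "(\<Sum>k. cycle_nn k s (\<lambda>y. f k y * split_merge_sum g k y)) = (\<Sum>k. cycle_nn k s (\<lambda>y. g k y * split_merge_sum f k y))"
proof -
  have *: "(\<Sum>k. cycle_nn k s (\<lambda>y. f k y * split_merge_sum g k y)) =
     (\<Sum>k. cycle_nn k s (\<lambda>y. g k y * split_sum k (f (Suc k)) y)) + (\<Sum>k. cycle_nn k s (\<lambda>y. f k y * split_sum k (g (Suc k)) y))"
    if [measurable]: "\<And>k. f k \<in> borel_measurable borel" "\<And>k. g k \<in> borel_measurable borel"
      and pf: "\<And>k. perm_inv k (f k)" and pg: "\<And>k. perm_inv k (g k)" for f g :: "nat \<Rightarrow> (nat \<Rightarrow> real) \<Rightarrow> ennreal"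
  proof -
    define a where "a k = cycle_nn k s (\<lambda>y. f k y * (case k of 0 \<Rightarrow> 0 | Suc m \<Rightarrow> merge_sum m (g m) y))" for k
    have a: "a (Suc k) = cycle_nn k s (\<lambda>y. g k y * split_sum k (f (Suc k)) y)" for k
      unfolding a_def using merge_split_balance[of "f (Suc k)" "g k" k s] pf pg s by simp
    have "(\<lambda>y. case k of 0 \<Rightarrow> 0 | Suc m \<Rightarrow> merge_sum m (g m) y) \<in> borel_measurable borel" for k by (cases k) simp_all
    then have "cycle_nn k s (\<lambda>y. f k y * split_merge_sum g k y) = a k + cycle_nn k s (\<lambda>y. f k y * split_sum k (g (Suc k)) y)" for k
      unfolding split_merge_sum_def distrib_left a_def by (intro cycle_nn_add) measurable
    then have "(\<Sum>k. cycle_nn k s (\<lambda>y. f k y * split_merge_sum g k y)) = (\<Sum>k. a k) + (\<Sum>k. cycle_nn k s (\<lambda>y. f k y * split_sum k (g (Suc k)) y))"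
      by (simp add: suminf_add)
    \<comment> \<open>The index shift that pairs merges in grade \<open>k + 1\<close> with splits in
      grade \<open>k\<close> loses only \<open>a 0\<close>, which is 0 because a single part cannot
      merge.\<close>
    also have "(\<Sum>k. a k) = (\<Sum>k. a (Suc k))"
    proof -
      have "a 0 = 0" by (simp add: a_def cycle_nn_def)
      then show ?thesis using suminf_offset[of a 1] by simp
    qed
    finally show ?thesis unfolding a .
  qed
  show ?thesis unfolding *[OF f g pf pg] *[OF g f pg pf] by (rule add.commute)
qed

section \<open>The lazy step and its dual operator on functions\<close>

lemma nn_integral_half_sum:
  assumes N: "sets N = sets M" and F: "F \<in> borel_measurable M"
  shows "(\<integral>\<^sup>+x. F x \<partial>half_sum M N) = ((\<integral>\<^sup>+x. F x \<partial>M) + (\<integral>\<^sup>+x. F x \<partial>N)) / 2"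
proof -
  have m: "f \<in> borel_measurable (half_sum M N) \<longleftrightarrow> f \<in> borel_measurable M" "f \<in> borel_measurable N \<longleftrightarrow> f \<in> borel_measurable M"
    for f :: "'a \<Rightarrow> ennreal" using N by (simp_all cong: measurable_cong_sets)
  have sp: "space N = space M" using N by (rule sets_eq_imp_space_eq)
  show ?thesis using F
  proof (induction rule: borel_measurable_induct)
    case (cong f g)
    have e: "f x = g x" if "x \<in> space M" for x using cong(3) that .
    have "(\<integral>\<^sup>+x. f x \<partial>half_sum M N) = (\<integral>\<^sup>+x. g x \<partial>half_sum M N)" by (rule nn_integral_cong) (simp add: e)
    moreover have "(\<integral>\<^sup>+x. f x \<partial>M) = (\<integral>\<^sup>+x. g x \<partial>M)" by (rule nn_integral_cong) (simp add: e)
    moreover have "(\<integral>\<^sup>+x. f x \<partial>N) = (\<integral>\<^sup>+x. g x \<partial>N)" by (rule nn_integral_cong) (simp add: e sp)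
    ultimately show ?case using cong(4) by (simp only:)
  next
    case (set A) then show ?case using N emeasure_half_sum[OF N, of A] by simp
  next
    case (mult u c)
    then show ?case by (simp add: nn_integral_cmult m ennreal_times_divide distrib_left)
  next
    case (add u v)
    then show ?case by (simp add: nn_integral_add m divide_ennreal_def distrib_left distrib_right ac_simps)
  next
    case (seq U)
    have U: "U i \<in> borel_measurable M" for i using seq by simp
    have inc: "incseq U" by fact
    have i: "incseq (\<lambda>n. integral\<^sup>N K (U n))" for K
      using inc by (auto simp: incseq_def le_fun_def intro!: nn_integral_mono)
    have "(\<integral>\<^sup>+x. (SUP i. U i x) \<partial>half_sum M N) = (SUP i. ((\<integral>\<^sup>+x. U i x \<partial>M) + (\<integral>\<^sup>+x. U i x \<partial>N)) / 2)"
      using seq U by (subst nn_integral_monotone_convergence_SUP) (auto simp: m)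
    also have "\<dots> = (SUP i. (\<integral>\<^sup>+x. U i x \<partial>M) + (\<integral>\<^sup>+x. U i x \<partial>N)) / 2"
      unfolding divide_ennreal_def by (rule SUP_mult_right_ennreal[symmetric])
    also have "(SUP i. (\<integral>\<^sup>+x. U i x \<partial>M) + (\<integral>\<^sup>+x. U i x \<partial>N)) = (SUP i. \<integral>\<^sup>+x. U i x \<partial>M) + (SUP i. \<integral>\<^sup>+x. U i x \<partial>N)"
      by (rule ennreal_SUP_add[OF i i])
    also have "\<dots> = (\<integral>\<^sup>+x. (SUP i. U i x) \<partial>M) + (\<integral>\<^sup>+x. (SUP i. U i x) \<partial>N)"
      using seq U by (subst (1 2) nn_integral_monotone_convergence_SUP) (auto simp: m)
    finally show ?case by (simp add: image_comp)
  qed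
qed

text \<open>The operator dual to \<open>lazy_split_merge\<close>. Setting it to 0 outside
  \<open>Sigma1\<close> makes the result Borel on the whole sequence space, so that it can be
  iterated without returning to the restricted space.\<close>

definition lazy_op :: "((nat \<Rightarrow> real) \<Rightarrow> ennreal) \<Rightarrow> (nat \<Rightarrow> real) \<Rightarrow> ennreal" where
  "lazy_op F x = (F x + (\<integral>\<^sup>+z. F z \<partial>split_merge_law x)) / 2 * indicator Sigma1 x"

lemma borel_measurable_Sigma1_borel: "F \<in> borel_measurable borel \<Longrightarrow> F \<in> borel_measurable Sigma1_borel"
  by (rule measurable_restrict_space1)

lemma measurable_nn_integral_law:
  assumes "F \<in> borel_measurable Sigma1_borel"
  shows "(\<lambda>x. \<integral>\<^sup>+z. F z \<partial>split_merge_law x) \<in> borel_measurable Sigma1_borel"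
  by (rule measurable_compose[OF measurable_prob_algebraD[OF measurable_split_merge_law]
        nn_integral_measurable_subprob_algebra[OF assms]])

lemma measurable_lazy_op [measurable]:
  assumes F: "F \<in> borel_measurable borel" shows "lazy_op F \<in> borel_measurable borel"
proof -
  note [measurable] = borel_measurable_Sigma1_borel[OF F] measurable_nn_integral_law[OF borel_measurable_Sigma1_borel[OF F]]
  have "(\<lambda>x. (F x + (\<integral>\<^sup>+z. F z \<partial>split_merge_law x)) / 2) \<in> borel_measurable Sigma1_borel" by measurable
  then show ?thesis
    unfolding lazy_op_def using borel_measurable_restrict_space_iff_ennreal[of Sigma1 borel] by simp
qed

lemma measurable_lazy_op_funpow [measurable]:
  "F \<in> borel_measurable borel \<Longrightarrow> (lazy_op ^^ m) F \<in> borel_measurable borel"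
  by (induction m) auto

lemma nn_integral_lazy_split_merge:
  assumes \<nu>: "\<nu> \<in> space (prob_algebra Sigma1_borel)" and F: "F \<in> borel_measurable borel"
  shows "(\<integral>\<^sup>+x. F x \<partial>lazy_split_merge \<nu>) = (\<integral>\<^sup>+x. lazy_op F x \<partial>\<nu>)"
proof -
  have s: "sets \<nu> = sets Sigma1_borel" using \<nu> by (simp add: space_prob_algebra)
  have sp: "space \<nu> = Sigma1" using sets_eq_imp_space_eq[OF s] by (simp add: space_restrict_space)
  have s2: "sets (split_merge \<nu>) = sets \<nu>"
    unfolding split_merge_def using sets_bind'[OF \<nu> measurable_split_merge_law] s by simp
  have F2: "F \<in> borel_measurable Sigma1_borel" by (rule borel_measurable_Sigma1_borel[OF F])
  have F1: "F \<in> borel_measurable \<nu>" using F2 s by (simp cong: measurable_cong_sets)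
  have m: "(\<lambda>x. \<integral>\<^sup>+z. F z \<partial>split_merge_law x) \<in> borel_measurable \<nu>"
    using measurable_nn_integral_law[OF F2] s by (simp cong: measurable_cong_sets)
  have "split_merge_law \<in> \<nu> \<rightarrow>\<^sub>M subprob_algebra Sigma1_borel"
    using measurable_prob_algebraD[OF measurable_split_merge_law] s by (simp cong: measurable_cong_sets)
  then have b: "(\<integral>\<^sup>+x. F x \<partial>split_merge \<nu>) = (\<integral>\<^sup>+x. (\<integral>\<^sup>+z. F z \<partial>split_merge_law x) \<partial>\<nu>)"
    unfolding split_merge_def by (rule nn_integral_bind[OF F2])
  have "(\<integral>\<^sup>+x. F x \<partial>lazy_split_merge \<nu>) = (\<integral>\<^sup>+x. (F x + (\<integral>\<^sup>+z. F z \<partial>split_merge_law x)) / 2 \<partial>\<nu>)"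
    unfolding lazy_split_merge_def nn_integral_half_sum[OF s2 F1] b
    using F1 m by (simp add: nn_integral_add divide_ennreal_def nn_integral_multc)
  also have "\<dots> = (\<integral>\<^sup>+x. lazy_op F x \<partial>\<nu>)"
    by (rule nn_integral_cong) (simp add: lazy_op_def sp)
  finally show ?thesis .
qed

abbreviation lazy_iter :: "(nat \<Rightarrow> real) \<Rightarrow> nat \<Rightarrow> (nat \<Rightarrow> real) measure" where
  "lazy_iter x m \<equiv> (lazy_split_merge ^^ m) (return Sigma1_borel x)"

lemma lazy_iter_prob_algebra:
  assumes "x \<in> Sigma1" shows "lazy_iter x m \<in> space (prob_algebra Sigma1_borel)"
proof (induction m)
  case 0
  have "prob_space (return Sigma1_borel x)" using assms by (intro prob_space_return) (simp add: space_restrict_space)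
  then show ?case by (simp add: space_prob_algebra)
qed (simp add: lazy_split_merge_prob_algebra)

lemma nn_integral_lazy_iter_Suc:
  assumes "x \<in> Sigma1" "F \<in> borel_measurable borel"
  shows "(\<integral>\<^sup>+z. F z \<partial>lazy_iter x (Suc m)) = (\<integral>\<^sup>+z. lazy_op F z \<partial>lazy_iter x m)"
  using nn_integral_lazy_split_merge[OF lazy_iter_prob_algebra[OF assms(1)] assms(2)] by simp

lemma nn_integral_lazy_iter:
  assumes "x \<in> Sigma1" "F \<in> borel_measurable borel"
  shows "(\<integral>\<^sup>+z. F z \<partial>lazy_iter x m) = (lazy_op ^^ m) F x"
  using assms(2)
proof (induction m arbitrary: F)
  case 0
  then show ?case using assms(1) by (simp add: nn_integral_return space_restrict_space borel_measurable_Sigma1_borel)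
next
  case (Suc m)
  have "(\<integral>\<^sup>+z. F z \<partial>lazy_iter x (Suc m)) = (\<integral>\<^sup>+z. lazy_op F z \<partial>lazy_iter x m)"
    by (rule nn_integral_lazy_iter_Suc[OF assms(1) Suc.prems])
  also have "\<dots> = (lazy_op ^^ m) (lazy_op F) x" by (rule Suc.IH) (use Suc.prems in measurable)
  finally show ?case by (simp add: funpow_swap1)
qed

definition unit_pt :: "nat \<Rightarrow> real" where "unit_pt = case_nat 1 zeros"

lemma unit_pt_Sigma1: "unit_pt \<in> Sigma1"
proof -
  have "unit_pt sums (\<Sum>i\<in>{0}. unit_pt i)" by (rule sums_finite) (auto simp: unit_pt_def split: nat.split)
  then show ?thesis by (auto simp: Sigma1_def unit_pt_def decseq_Suc_iff split: nat.split)
qed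

lemma perm_inv_decr_rearr: "perm_inv k (\<lambda>y. F (decr_rearr y))"
  unfolding perm_inv_def using decr_rearr_bij[OF permutes_bij] by metis

text \<open>Induction on \<open>m\<close>, with \<open>N = Suc m\<close> draws. For
  \<open>N = 1\<close> a single draw hits all parts only if there is just one. In the step,
  reversibility moves \<open>T\<close> from the test function onto the weights, where
  \<open>surj_wt_split_merge\<close> evaluates it; the constants combine to
  \<open>1 / N * (1 / 2) * (2 * N / (N + 1)) = 1 / (N + 1)\<close>.\<close>

theorem nn_integral_lazy_iter_unit_pt:
  assumes "F \<in> borel_measurable borel"
  shows "(\<integral>\<^sup>+x. F x \<partial>lazy_iter unit_pt m) =
    ennreal (1 / real (Suc m)) * (\<Sum>k. cycle_nn k 1 (\<lambda>y. ennreal (surj_wt (Suc m) k y) * F (decr_rearr y)))"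
  using assms
proof (induction m arbitrary: F)
  case 0
  note [measurable] = 0
  have z: "cycle_nn (Suc k) 1 (\<lambda>y. ennreal (surj_wt 1 (Suc k) y) * F (decr_rearr y)) = 0" for k
  proof -
    have "surj_wt 1 (Suc k) y = 0" for y
    proof -
      have "surj_wt 1 (Suc k) y = surj_wt 1 (Suc k) (case_nat (y 0) (y \<circ> Suc))" by simp
      moreover have "surj_wt 1 (Suc k) (case_nat (y 0) (y \<circ> Suc)) = y 0 * surj_wt 0 k (y \<circ> Suc)" by (simp only: surj_wt_Suc) simp
      ultimately show ?thesis by (simp only: surj_wt_0_eq mult_zero_right)
    qed
    then show ?thesis by (simp add: cycle_nn_def)
  qed
  have "(\<Sum>k. cycle_nn k 1 (\<lambda>y. ennreal (surj_wt 1 k y) * F (decr_rearr y))) =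
     (\<Sum>k\<in>{0}. cycle_nn k 1 (\<lambda>y. ennreal (surj_wt 1 k y) * F (decr_rearr y)))"
    by (rule suminf_finite) (auto simp: z[unfolded One_nat_def] gr0_conv_Suc)
  also have "\<dots> = F (decr_rearr unit_pt)"
    by (simp add: cycle_nn_def surj_wt_0 unit_pt_def)
  also have "\<dots> = F unit_pt" by (simp add: decr_rearr_Sigma1_id unit_pt_Sigma1)
  finally show ?case using unit_pt_Sigma1
    by (simp add: nn_integral_return space_restrict_space borel_measurable_Sigma1_borel)
next
  case (Suc m)
  note [measurable] = Suc.prems
  define N where "N = Suc m"
  define w where "w N k y = ennreal (surj_wt N k y)" for N k and y :: "nat \<Rightarrow> real"
  have [measurable]: "w N k \<in> borel_measurable borel" for N k unfolding w_def by measurable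
  define H where "H = (\<lambda>(k::nat) y. F (decr_rearr y))"
  have [measurable]: "H k \<in> borel_measurable borel" for k unfolding H_def by measurable
  have ms [measurable]: "split_merge_sum f k \<in> borel_measurable borel" if "\<And>k. f k \<in> borel_measurable borel" for f k
    unfolding split_merge_sum_def using that by (cases k) (auto intro!: borel_measurable_add measurable_merge_sum measurable_split_sum)
  let ?C = "\<lambda>h. \<Sum>k. cycle_nn k 1 (h k)"
  have "(\<integral>\<^sup>+x. F x \<partial>lazy_iter unit_pt (Suc m)) = (\<integral>\<^sup>+x. lazy_op F x \<partial>lazy_iter unit_pt m)"
    by (rule nn_integral_lazy_iter_Suc[OF unit_pt_Sigma1 Suc.prems])
  also have "\<dots> = ennreal (1 / real N) * (\<Sum>k. cycle_nn k 1 (\<lambda>y. w N k y * lazy_op F (decr_rearr y)))"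
    unfolding N_def w_def by (rule Suc.IH) measurable
  also have "(\<Sum>k. cycle_nn k 1 (\<lambda>y. w N k y * lazy_op F (decr_rearr y))) =
     (\<Sum>k. cycle_nn k 1 (\<lambda>y. (1 / 2) * (w N k y * H k y + w N k y * split_merge_sum H k y)))"
  proof (intro suminf_cong cycle_nn_cong)
    fix k and y :: "nat \<Rightarrow> real"
    assume y: "\<And>i. i \<le> k \<Longrightarrow> 0 < y i" "\<And>i. k < i \<Longrightarrow> y i = 0" "(\<Sum>i\<le>k. y i) = 1"
    have "y sums (\<Sum>i\<le>k. y i)" by (rule sums_finite) (auto simp: y)
    moreover have "0 \<le> y i" for i using y(1)[of i] y(2)[of i] by (cases "i \<le> k") auto
    ultimately have "decr_rearr y \<in> Sigma1" using y(3) by (intro decr_rearr_Sigma1) auto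
    moreover have "(\<integral>\<^sup>+x. F x \<partial>split_merge_law (decr_rearr y)) = split_merge_sum H k y"
      unfolding H_def by (rule nn_integral_split_merge_law_finite) (use y borel_measurable_Sigma1_borel[OF Suc.prems] in auto)
    ultimately show "w N k y * lazy_op F (decr_rearr y) = (1 / 2) * (w N k y * H k y + w N k y * split_merge_sum H k y)"
      by (simp add: lazy_op_def H_def divide_ennreal_def distrib_left distrib_right ac_simps)
  qed simp
  also have "\<dots> = (1 / 2) * ((\<Sum>k. cycle_nn k 1 (\<lambda>y. w N k y * H k y)) + (\<Sum>k. cycle_nn k 1 (\<lambda>y. w N k y * split_merge_sum H k y)))"
    by (simp add: cycle_nn_cmult cycle_nn_add suminf_add)
  also have "(\<Sum>k. cycle_nn k 1 (\<lambda>y. w N k y * split_merge_sum H k y)) = (\<Sum>k. cycle_nn k 1 (\<lambda>y. H k y * split_merge_sum (w N) k y))"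
    by (rule split_merge_reversible)
       (auto simp: w_def H_def perm_inv_decr_rearr perm_inv_def intro: arg_cong[where f=ennreal] perm_inv_surj_wt[unfolded perm_inv_def, rule_format])
  also have "(\<Sum>k. cycle_nn k 1 (\<lambda>y. w N k y * H k y)) + (\<Sum>k. cycle_nn k 1 (\<lambda>y. H k y * split_merge_sum (w N) k y)) =
    (\<Sum>k. cycle_nn k 1 (\<lambda>y. H k y * (split_merge_sum (w N) k y + w N k y)))"
    by (simp add: suminf_add cycle_nn_add[symmetric] distrib_left ac_simps)
  also have "\<dots> = (\<Sum>k. cycle_nn k 1 (\<lambda>y. ennreal (2 * real N / real (Suc N)) * (w (Suc N) k y * H k y)))"
  proof (intro suminf_cong cycle_nn_cong)
    fix k and y :: "nat \<Rightarrow> real"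
    assume y: "\<And>i. i \<le> k \<Longrightarrow> 0 < y i" "\<And>i. k < i \<Longrightarrow> y i = 0" "(\<Sum>i\<le>k. y i) = 1"
    have nn: "0 \<le> y i" if "i \<le> k" for i using y(1)[OF that] by simp
    have nw: "0 \<le> surj_wt (Suc N) k y" by (rule surj_wt_nonneg) (rule nn)
    have "split_merge_sum (w N) k y + w N k y = ennreal (2 * real N / real (Suc N)) * w (Suc N) k y"
      using surj_wt_split_merge[of k y N, OF nn y(3)] unfolding w_def ennreal_mult''[OF nw] by (simp only:)
    then show "H k y * (split_merge_sum (w N) k y + w N k y) = ennreal (2 * real N / real (Suc N)) * (w (Suc N) k y * H k y)"
      by (simp only: ac_simps)
  qed simp
  also have "\<dots> = ennreal (2 * real N / real (Suc N)) * (\<Sum>k. cycle_nn k 1 (\<lambda>y. w (Suc N) k y * H k y))"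
    by (simp add: cycle_nn_cmult)
  also have "ennreal (1 / real N) * ((1 / 2) * (ennreal (2 * real N / real (Suc N)) * X)) = ennreal (1 / real (Suc N)) * X" for X
  proof -
    have h: "(1 / 2 :: ennreal) = ennreal (1 / 2)" by (metis divide_ennreal ennreal_1 ennreal_numeral zero_le_one zero_less_numeral)
    have m3: "ennreal (a * (b * c)) = ennreal a * (ennreal b * ennreal c)" if "0 \<le> a" "0 \<le> b" "0 \<le> c" for a b c
      using that by (simp add: ennreal_mult)
    have "ennreal (1 / real N) * ((1 / 2) * (ennreal (2 * real N / real (Suc N)) * X)) =
      ennreal (1 / real N * (1 / 2 * (2 * real N / real (Suc N)))) * X"
      unfolding h by (subst m3, simp, simp, simp) (simp only: mult.assoc)
    also have "1 / real N * (1 / 2 * (2 * real N / real (Suc N))) = 1 / real (Suc N)"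
    proof -
      have "real N \<noteq> 0" by (simp add: N_def)
      then show ?thesis by simp
    qed
    finally show ?thesis .
  qed
  finally show ?case unfolding N_def w_def H_def .
qed

section \<open>Recurrence\<close>

lemma split_merge_law_space: "x \<in> Sigma1 \<Longrightarrow> emeasure (split_merge_law x) Sigma1 = 1"
  using prob_space.emeasure_space_1[OF prob_space_split_merge_law] by simp

lemma measurable_split_merge_law_borel:
  "F \<in> borel_measurable borel \<Longrightarrow> (F :: _ \<Rightarrow> ennreal) \<in> borel_measurable (split_merge_law x)"
  by (subst measurable_cong_sets[OF sets_split_merge_law refl]) (rule borel_measurable_Sigma1_borel)

lemma lazy_op_mono:
  assumes "\<And>z. z \<in> Sigma1 \<Longrightarrow> F z \<le> G z" shows "lazy_op F x \<le> lazy_op G x"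
proof (cases "x \<in> Sigma1")
  case True
  have "(\<integral>\<^sup>+z. F z \<partial>split_merge_law x) \<le> (\<integral>\<^sup>+z. G z \<partial>split_merge_law x)"
    by (rule nn_integral_mono) (simp add: assms)
  then show ?thesis using True assms by (auto simp: lazy_op_def intro!: divide_right_mono_ennreal add_mono)
qed (simp add: lazy_op_def)

lemma ennreal_half_add: "(c + c) / 2 = (c :: ennreal)"
proof -
  have "(c + c) / 2 = c * 2 / 2" by (simp add: mult_2_right)
  also have "\<dots> = c" by (rule ennreal_mult_divide_eq) auto
  finally show ?thesis .
qed

lemma lazy_op_const: "x \<in> Sigma1 \<Longrightarrow> lazy_op (\<lambda>_. c) x = c"
  by (simp add: lazy_op_def split_merge_law_space ennreal_half_add)

lemma lazy_op_mult:
  assumes "F \<in> borel_measurable borel" shows "lazy_op (\<lambda>x. F x * c) x = lazy_op F x * c"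
proof -
  have "(\<integral>\<^sup>+z. F z * c \<partial>split_merge_law x) = (\<integral>\<^sup>+z. F z \<partial>split_merge_law x) * c"
    by (rule nn_integral_multc[OF measurable_split_merge_law_borel[OF assms]])
  moreover have "(a * c + b * c) * h * d = (a + b) * h * d * c" for a b h d :: ennreal by (simp add: algebra_simps)
  ultimately show ?thesis by (simp only: lazy_op_def divide_ennreal_def)
qed

lemma lazy_op_SUP:
  assumes F [measurable]: "\<And>k. F k \<in> borel_measurable borel" and inc: "\<And>k x. x \<in> Sigma1 \<Longrightarrow> F k x \<le> F (Suc k) x"
  shows "lazy_op (\<lambda>x. SUP k. F k x) x = (SUP k. lazy_op (F k) x)"
proof (cases "x \<in> Sigma1")
  case True
  let ?L = "split_merge_law x"
  have 1: "(\<integral>\<^sup>+z. (SUP k. F k z) \<partial>?L) = (SUP k. \<integral>\<^sup>+z. F k z \<partial>?L)"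
  proof (rule nn_integral_monotone_convergence_SUP_AE)
    show "AE z in ?L. F k z \<le> F (Suc k) z" for k by (rule AE_I2) (simp add: inc)
    show "F k \<in> borel_measurable ?L" for k by (rule measurable_split_merge_law_borel[OF F])
  qed
  have 2: "(SUP k. F k x) + (SUP k. \<integral>\<^sup>+z. F k z \<partial>?L) = (SUP k. F k x + (\<integral>\<^sup>+z. F k z \<partial>?L))"
  proof (rule ennreal_SUP_add[symmetric])
    show "incseq (\<lambda>k. F k x)" by (rule incseq_SucI) (rule inc[OF True])
    show "incseq (\<lambda>k. \<integral>\<^sup>+z. F k z \<partial>?L)"
      by (rule incseq_SucI, rule nn_integral_mono, rule inc) simp
  qed
  have "lazy_op (\<lambda>x. SUP k. F k x) x = (SUP k. F k x + (\<integral>\<^sup>+z. F k z \<partial>?L)) / 2"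
    by (simp only: lazy_op_def 1 2 indicator_simps(1)[OF True] mult_1_right)
  also have "\<dots> = (SUP k. (F k x + (\<integral>\<^sup>+z. F k z \<partial>?L)) / 2)"
    unfolding divide_ennreal_def by (rule SUP_mult_right_ennreal)
  also have "\<dots> = (SUP k. lazy_op (F k) x)"
    by (simp only: lazy_op_def indicator_simps(1)[OF True] mult_1_right)
  finally show ?thesis .
next
  case False
  then have "lazy_op G x = 0" for G by (simp add: lazy_op_def)
  then show ?thesis by (simp only: SUP_const UNIV_not_empty not_False_eq_True)
qed

text \<open>The probability that the lazy chain started at \<open>x\<close> visits \<open>(1, 0, 0, \<dots>)\<close> by time \<open>k\<close>.\<close>

fun hit :: "nat \<Rightarrow> (nat \<Rightarrow> real) \<Rightarrow> ennreal" where
  "hit 0 x = indicator {unit_pt} x"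
| "hit (Suc k) x = (if x = unit_pt then 1 else lazy_op (hit k) x)"

lemma singleton_seq_in_borel [measurable]: "{x} \<in> sets (borel :: (nat \<Rightarrow> real) measure)"
proof -
  have "{x} = {z \<in> space borel. \<forall>i. z i = x i}" by auto
  also have "\<dots> \<in> sets borel" by measurable
  finally show ?thesis .
qed

lemma measurable_hit [measurable]: "hit k \<in> borel_measurable borel"
proof (induction k)
  case (Suc k)
  note [measurable] = Suc
  have "hit (Suc k) = (\<lambda>x. if x \<in> {unit_pt} then 1 else lazy_op (hit k) x)" by auto
  then show ?case by simp
qed simp

lemma hit_le_1: "x \<in> Sigma1 \<Longrightarrow> hit k x \<le> 1"
proof (induction k arbitrary: x)
  case (Suc k)
  have "lazy_op (hit k) x \<le> lazy_op (\<lambda>_. 1) x" by (rule lazy_op_mono) (rule Suc.IH)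
  then show ?case using Suc.prems by (simp add: lazy_op_const)
qed (simp add: indicator_def)

lemma hit_mono: "x \<in> Sigma1 \<Longrightarrow> hit k x \<le> hit (Suc k) x"
proof (induction k arbitrary: x)
  case (Suc k)
  have "lazy_op (hit k) x \<le> lazy_op (hit (Suc k)) x" by (rule lazy_op_mono) (rule Suc.IH)
  then show ?case by simp
qed (simp add: indicator_def)

definition hit_prob :: "(nat \<Rightarrow> real) \<Rightarrow> ennreal" where "hit_prob x = (SUP k. hit k x)"

lemma measurable_hit_prob [measurable]: "hit_prob \<in> borel_measurable borel"
  unfolding hit_prob_def by measurable

lemma hit_prob_le_1: "x \<in> Sigma1 \<Longrightarrow> hit_prob x \<le> 1"
  unfolding hit_prob_def by (rule SUP_least) (rule hit_le_1)

lemma hit_prob_unit_pt: "hit_prob unit_pt = 1"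
proof (rule antisym)
  have "hit 0 unit_pt \<le> hit_prob unit_pt" unfolding hit_prob_def by (rule SUP_upper) simp
  then show "1 \<le> hit_prob unit_pt" by simp
qed (rule hit_prob_le_1[OF unit_pt_Sigma1])

text \<open>Off \<open>unit_pt\<close> the function \<open>lazy_op (hit k)\<close> is
  \<open>hit (Suc k)\<close>, so a further step does not change the limit. At \<open>unit_pt\<close>
  the right side is 1, the largest possible value.\<close>

lemma lazy_op_hit_prob_le:
  assumes x: "x \<in> Sigma1" shows "lazy_op hit_prob x \<le> hit_prob x"
proof (cases "x = unit_pt")
  case True
  have "lazy_op hit_prob x \<le> lazy_op (\<lambda>_. 1) x" by (rule lazy_op_mono) (rule hit_prob_le_1)
  then show ?thesis using True x by (simp add: hit_prob_unit_pt lazy_op_const)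
next
  case False
  have "lazy_op hit_prob x = (SUP k. lazy_op (hit k) x)"
    unfolding hit_prob_def by (rule lazy_op_SUP[where F=hit, OF measurable_hit hit_mono])
  also have "\<dots> \<le> hit_prob x"
  proof (rule SUP_least)
    fix k
    have "hit (Suc k) x \<le> hit_prob x" unfolding hit_prob_def by (rule SUP_upper[OF UNIV_I])
    then show "lazy_op (hit k) x \<le> hit_prob x" using False by simp
  qed
  finally show ?thesis .
qed

lemma lazy_op_funpow_hit_prob_le: "x \<in> Sigma1 \<Longrightarrow> (lazy_op ^^ j) hit_prob x \<le> hit_prob x"
proof (induction j arbitrary: x)
  case (Suc j)
  have "lazy_op ((lazy_op ^^ j) hit_prob) x \<le> lazy_op hit_prob x" by (rule lazy_op_mono) (rule Suc.IH)
  then show ?case using lazy_op_hit_prob_le[OF Suc.prems] by simp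
qed simp

text \<open>Only the one-part term of the series is kept. Its weight is \<open>1 ^ Suc k\<close>, so
  what remains is the normalization \<open>1 / (k + 1)\<close>.\<close>

lemma emeasure_lazy_iter_unit_pt_ge:
  "ennreal (1 / real (Suc k)) \<le> (\<integral>\<^sup>+x. indicator {unit_pt} x \<partial>lazy_iter unit_pt k)"
proof -
  let ?c = "\<lambda>l. cycle_nn l 1 (\<lambda>y. ennreal (surj_wt (Suc k) l y) * indicator {unit_pt} (decr_rearr y))"
  have "1 = ?c 0"
    using decr_rearr_Sigma1_id[OF unit_pt_Sigma1] by (simp add: cycle_nn_def surj_wt_0 unit_pt_def)
  also have "\<dots> = sum ?c {0}" by simp
  also have "\<dots> \<le> (\<Sum>l. ?c l)" by (rule sum_le_suminf) auto
  finally have "ennreal (1 / real (Suc k)) * 1 \<le> ennreal (1 / real (Suc k)) * (\<Sum>l. ?c l)" by (intro mult_left_mono) auto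
  then show ?thesis by (subst nn_integral_lazy_iter_unit_pt) auto
qed

lemma space_lazy_iter: "x \<in> Sigma1 \<Longrightarrow> space (lazy_iter x m) = Sigma1"
  and sets_lazy_iter: "x \<in> Sigma1 \<Longrightarrow> sets (lazy_iter x m) = sets Sigma1_borel"
  and prob_space_lazy_iter: "x \<in> Sigma1 \<Longrightarrow> prob_space (lazy_iter x m)"
proof -
  assume x: "x \<in> Sigma1"
  show s: "sets (lazy_iter x m) = sets Sigma1_borel" and "prob_space (lazy_iter x m)"
    using lazy_iter_prob_algebra[OF x, of m] by (auto simp: space_prob_algebra)
  show "space (lazy_iter x m) = Sigma1" using sets_eq_imp_space_eq[OF s] by (simp add: space_restrict_space)
qed

lemma measurable_lazy_iter:
  "x \<in> Sigma1 \<Longrightarrow> F \<in> borel_measurable borel \<Longrightarrow> F \<in> borel_measurable (lazy_iter x m)"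
  by (subst measurable_cong_sets[OF sets_lazy_iter refl]) (assumption, rule borel_measurable_Sigma1_borel)

text \<open>\<open>hit_prob\<close> is superharmonic for the chain; the expected total loss \<open>v = hit_prob - P\<^sup>j hit_prob\<close>
  along the path from \<open>(1, 0, 0, \<dots>)\<close> telescopes to at most \<open>j\<close>, whereas the expected number of visits to
  \<open>(1, 0, 0, \<dots>)\<close> is at least the harmonic series. Hence \<open>v\<close> vanishes there.\<close>

theorem nn_integral_hit_prob_lazy_iter: "(\<integral>\<^sup>+x. hit_prob x \<partial>lazy_iter unit_pt j) = 1"
proof -
  define A where "A k = (\<integral>\<^sup>+x. hit_prob x \<partial>lazy_iter unit_pt k)" for k
  have A: "A k = (lazy_op ^^ k) hit_prob unit_pt" for k
    unfolding A_def by (rule nn_integral_lazy_iter[OF unit_pt_Sigma1]) simp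
  have A1: "A k \<le> 1" for k
    unfolding A using lazy_op_funpow_hit_prob_le[OF unit_pt_Sigma1] by (simp add: hit_prob_unit_pt)
  define a where "a k = enn2real (A k)" for k
  have Aa: "A k = ennreal (a k)" for k
    unfolding a_def using A1[of k] by (intro ennreal_enn2real[symmetric]) (auto simp: le_less_trans)
  have a: "0 \<le> a k" "a k \<le> 1" for k
  proof -
    show "0 \<le> a k" by (simp add: a_def)
    then show "a k \<le> 1" using A1[of k] unfolding Aa by simp
  qed
  \<comment> \<open>\<open>a k - a (k + j)\<close> is the mean of \<open>v\<close> at time
    \<open>k\<close>. It is at least the contribution of \<open>unit_pt\<close>, where
    \<open>v\<close> equals \<open>1 - a j\<close> and the mass is at least
    \<open>1 / (k + 1)\<close>.\<close>
  have step: "a (k + j) + (1 - a j) / real (Suc k) \<le> a k" for k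
  proof -
    let ?v = "\<lambda>x. hit_prob x - (lazy_op ^^ j) hit_prob x"
    have [measurable]: "(lazy_op ^^ j) hit_prob \<in> borel_measurable borel" by measurable
    have vm [measurable]: "?v \<in> borel_measurable borel" by measurable
    have "A k = (\<integral>\<^sup>+x. (lazy_op ^^ j) hit_prob x + ?v x \<partial>lazy_iter unit_pt k)"
      unfolding A_def by (rule nn_integral_cong)
        (simp add: space_lazy_iter[OF unit_pt_Sigma1] lazy_op_funpow_hit_prob_le add_diff_inverse_ennreal)
    also have "\<dots> = (\<integral>\<^sup>+x. (lazy_op ^^ j) hit_prob x \<partial>lazy_iter unit_pt k) + (\<integral>\<^sup>+x. ?v x \<partial>lazy_iter unit_pt k)"
      by (intro nn_integral_add measurable_lazy_iter unit_pt_Sigma1) measurable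
    also have "(\<integral>\<^sup>+x. (lazy_op ^^ j) hit_prob x \<partial>lazy_iter unit_pt k) = A (k + j)"
      by (subst nn_integral_lazy_iter[OF unit_pt_Sigma1]) (simp_all add: A funpow_add)
    finally have 1: "A k = A (k + j) + (\<integral>\<^sup>+x. ?v x \<partial>lazy_iter unit_pt k)" .
    have "ennreal (1 - a j) * ennreal (1 / real (Suc k)) \<le> ennreal (1 - a j) * (\<integral>\<^sup>+x. indicator {unit_pt} x \<partial>lazy_iter unit_pt k)"
      by (intro mult_left_mono emeasure_lazy_iter_unit_pt_ge) auto
    also have "\<dots> = (\<integral>\<^sup>+x. ennreal (1 - a j) * indicator {unit_pt} x \<partial>lazy_iter unit_pt k)"
      by (rule nn_integral_cmult[symmetric]) (intro measurable_lazy_iter unit_pt_Sigma1, measurable)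
    also have "\<dots> \<le> (\<integral>\<^sup>+x. ?v x \<partial>lazy_iter unit_pt k)"
    proof (rule nn_integral_mono)
      fix x
      have "?v unit_pt = ennreal (1 - a j)"
        using a[of j] by (simp add: hit_prob_unit_pt A[symmetric] Aa ennreal_minus[symmetric] ennreal_1[symmetric] del: ennreal_1)
      then show "ennreal (1 - a j) * indicator {unit_pt} x \<le> ?v x" by (auto simp: indicator_def)
    qed
    finally have "A (k + j) + ennreal (1 - a j) * ennreal (1 / real (Suc k)) \<le> A k"
      unfolding 1 by (intro add_left_mono)
    then have "ennreal (a (k + j) + (1 - a j) * (1 / real (Suc k))) \<le> ennreal (a k)"
      unfolding Aa using a[of j] a[of "k + j"] by (simp add: ennreal_mult[symmetric] ennreal_plus[symmetric] del: ennreal_plus)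
    then show ?thesis using a[of k] by (simp add: ennreal_le_iff)
  qed
  \<comment> \<open>The shifted sums cancel except for the first \<open>j\<close> values of
    \<open>a\<close>, each at most 1, and terms of the favourable sign.\<close>
  have sum: "(1 - a j) * (\<Sum>k<n. 1 / real (Suc k)) \<le> real j" for n
  proof -
    have "(1 - a j) * (\<Sum>k<n. 1 / real (Suc k)) \<le> (\<Sum>k<n. a k) - (\<Sum>k<n. a (k + j))"
      unfolding sum_distrib_left sum_subtractf[symmetric]
      by (rule sum_mono) (use step in \<open>auto simp: algebra_simps\<close>)
    also have "(\<Sum>k<n. a (k + j)) = (\<Sum>k<n + j. a k) - (\<Sum>k<j. a k)"
      by (induction n) auto
    also have "(\<Sum>k<n. a k) - ((\<Sum>k<n + j. a k) - (\<Sum>k<j. a k)) \<le> (\<Sum>k<j. a k)"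
      using sum_mono2[of "{..<n + j}" "{..<n}" a] a by auto
    also have "\<dots> \<le> (\<Sum>k<j. 1)" by (rule sum_mono) (rule a)
    finally show ?thesis by simp
  qed
  have "a j = 1"
  proof (rule ccontr)
    assume "a j \<noteq> 1"
    then have p: "0 < 1 - a j" using a[of j] by simp
    have "summable (\<lambda>k. 1 / real (Suc k))"
    proof (rule bounded_imp_summable)
      show "(\<Sum>k\<le>n. 1 / real (Suc k)) \<le> real j / (1 - a j)" for n
        using sum[of "Suc n"] p by (simp add: lessThan_Suc_atMost pos_le_divide_eq mult.commute)
    qed simp
    then have "summable (\<lambda>k. 1 / real k)" by (subst (asm) summable_Suc_iff)
    then show False using not_summable_harmonic[where ?'a = real] by (simp add: inverse_eq_divide)
  qed
  then show ?thesis using Aa[of j] by (simp add: A_def)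
qed

text \<open>With as many draws as parts, every part must be hit exactly once. Accordingly only
  \<open>K = 1\<close> is kept in each step of the recursion, and its binomial coefficient is
  bounded below by 1.\<close>

lemma surj_wt_ge_prod:
  assumes "\<And>i. i \<le> k \<Longrightarrow> 0 \<le> y i" shows "(\<Prod>i\<le>k. y i) \<le> surj_wt (Suc k) k y"
  using assms
proof (induction k arbitrary: y)
  case 0 then show ?case by (simp add: surj_wt_0)
next
  case (Suc k)
  let ?r = "y \<circ> Suc"
  have nn: "0 \<le> ?r i" if "i \<le> k" for i using Suc.prems that by simp
  have w: "0 \<le> surj_wt (Suc k) k ?r" by (rule surj_wt_nonneg) (rule nn)
  have "(\<Prod>i\<le>Suc k. y i) = y 0 * (\<Prod>i\<le>k. ?r i)" by (simp add: prod.atMost_Suc_shift del: prod.atMost_Suc)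
  also have "\<dots> \<le> y 0 * surj_wt (Suc k) k ?r" using Suc.prems by (intro mult_left_mono Suc.IH nn) auto
  also have "\<dots> \<le> real (Suc (Suc k) choose 1) * y 0 ^ 1 * surj_wt (Suc (Suc k) - 1) k ?r"
    using Suc.prems w by (simp add: distrib_right)
  also have "\<dots> \<le> (\<Sum>K\<in>{1..Suc (Suc k)}. real (Suc (Suc k) choose K) * y 0 ^ K * surj_wt (Suc (Suc k) - K) k ?r)"
    by (rule member_le_sum) (auto intro!: mult_nonneg_nonneg zero_le_power surj_wt_nonneg Suc.prems)
  also have "\<dots> = surj_wt (Suc (Suc k)) (Suc k) (case_nat (y 0) ?r)" by (rule surj_wt_Suc[symmetric])
  finally show ?case by simp
qed

text \<open>By \<open>nn_integral_hit_prob_lazy_iter\<close>, \<open>1 - hit_prob\<close> has mean 0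
  under the law at time \<open>k\<close>, hence also integral 0 over the points with
  \<open>k + 1\<close> parts. There the density \<open>surj_wt (Suc k) k y * inv_prod k y\<close> is
  at least 1 by \<open>surj_wt_ge_prod\<close>, so the unweighted integral vanishes too.\<close>

theorem simplex_nn_hit_prob: "simplex_nn k 1 (\<lambda>y. 1 - hit_prob (decr_rearr y)) = 0"
proof -
  let ?F = "\<lambda>x. 1 - hit_prob x"
  let ?c = "\<lambda>l. cycle_nn l 1 (\<lambda>y. ennreal (surj_wt (Suc k) l y) * ?F (decr_rearr y))"
  have [measurable]: "?F \<in> borel_measurable borel" by measurable
  interpret prob_space "lazy_iter unit_pt k" by (rule prob_space_lazy_iter[OF unit_pt_Sigma1])
  have "(\<integral>\<^sup>+x. ?F x \<partial>lazy_iter unit_pt k) = (\<integral>\<^sup>+x. 1 \<partial>lazy_iter unit_pt k) - (\<integral>\<^sup>+x. hit_prob x \<partial>lazy_iter unit_pt k)"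
    by (rule nn_integral_diff)
       (auto intro!: measurable_lazy_iter unit_pt_Sigma1 hit_prob_le_1 simp: space_lazy_iter[OF unit_pt_Sigma1] nn_integral_hit_prob_lazy_iter)
  also have "\<dots> = 0" by (simp add: nn_integral_hit_prob_lazy_iter emeasure_space_1)
  finally have "ennreal (1 / real (Suc k)) * (\<Sum>l. ?c l) = 0"
    using nn_integral_lazy_iter_unit_pt[of ?F k] by simp
  then have "(\<Sum>l. ?c l) = 0" by simp
  moreover have "sum ?c {k} \<le> (\<Sum>l. ?c l)" by (rule sum_le_suminf) auto
  ultimately have "?c k = 0" by simp
  moreover have "simplex_nn k 1 (\<lambda>y. ?F (decr_rearr y)) \<le> simplex_nn k 1 (\<lambda>y. ennreal (surj_wt (Suc k) k y) * ?F (decr_rearr y) * inv_prod k y)"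
  proof (rule simplex_nn_mono)
    fix y :: "nat \<Rightarrow> real" assume y: "\<And>i. i \<le> k \<Longrightarrow> 0 < y i"
    have nn: "0 \<le> y i" if "i \<le> k" for i using y[OF that] by simp
    have "1 = (\<Prod>i\<le>k. ennreal (y i) * ennreal (1 / y i))" using y by (simp add: ennreal_mult_inverse)
    also have "\<dots> = ennreal (\<Prod>i\<le>k. y i) * inv_prod k y"
      unfolding prod.distrib by (subst prod_ennreal) (simp_all add: nn)
    also have "\<dots> \<le> ennreal (surj_wt (Suc k) k y) * inv_prod k y"
      by (intro mult_right_mono ennreal_leI surj_wt_ge_prod nn) auto
    finally have "1 * ?F (decr_rearr y) \<le> ennreal (surj_wt (Suc k) k y) * inv_prod k y * ?F (decr_rearr y)"
      by (intro mult_right_mono) auto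
    then show "?F (decr_rearr y) \<le> ennreal (surj_wt (Suc k) k y) * ?F (decr_rearr y) * inv_prod k y"
      by (simp add: ac_simps)
  qed simp
  ultimately show ?thesis unfolding cycle_nn_def by auto
qed

section \<open>The nested integral against product Lebesgue measure on a face\<close>

lemma measurable_simplex_integrand:
  fixes g :: "(nat \<Rightarrow> real) \<Rightarrow> ennreal" and s :: real
  assumes "g \<in> borel_measurable borel"
  shows "(\<lambda>y. g (\<lambda>i. if i < k then y (a + i) else if i = k then s - (\<Sum>j<k. y (a + j)) else 0) *
     indicator {y. (\<forall>i<k. 0 \<le> y (a + i)) \<and> (\<Sum>j<k. y (a + j)) \<le> s} y) \<in> borel_measurable (\<Pi>\<^sub>M i\<in>{a..<a + k}. lborel)"
proof -
    let ?p = "\<lambda>y i. if i < k then y (a + i) else if i = k then s - (\<Sum>j<k. y (a + j)) else (0::real)"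
    let ?A = "{y. (\<forall>i<k. 0 \<le> y (a + i)) \<and> (\<Sum>j<k. y (a + j)) \<le> (s::real)}"
    have c: "(\<lambda>y. y (a + i)) \<in> borel_measurable (PiM ({a..<a + k}) (\<lambda>_. lborel :: real measure))" if "i < k" for i
    proof -
      have "a + i \<in> {a..<a + k}" using that by simp
      from measurable_component_singleton[OF this, of "\<lambda>_. lborel :: real measure"] show ?thesis by simp
    qed
    have "?p \<in> (PiM ({a..<a + k}) (\<lambda>_. lborel)) \<rightarrow>\<^sub>M borel"
    proof (rule meas_seq)
      have d: "(\<lambda>y. s - (\<Sum>j<k. y (a + j))) \<in> borel_measurable (PiM ({a..<a + k}) (\<lambda>_. lborel))"
        by (intro borel_measurable_diff borel_measurable_const borel_measurable_sum c) (simp only: lessThan_iff)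
      show "(\<lambda>y. ?p y i) \<in> borel_measurable (PiM ({a..<a + k}) (\<lambda>_. lborel))" for i
      proof (cases "i < k")
        case True then show ?thesis using c[OF True] by (simp only: if_True)
      next
        case False
        then show ?thesis using d by (cases "i = k") (simp_all only: if_True if_False borel_measurable_const simp_thms)
      qed
    qed
    from measurable_compose[OF this assms]
    have 1: "(\<lambda>y. g (?p y)) \<in> borel_measurable (PiM ({a..<a + k}) (\<lambda>_. lborel))" .
    have "{y \<in> space (PiM {a..<a + k} (\<lambda>_. lborel)). (\<forall>i\<in>{..<k}. 0 \<le> y (a + i)) \<and> (\<Sum>j<k. y (a + j)) \<le> s} \<in> sets (PiM {a..<a + k} (\<lambda>_. lborel))"
    proof (intro sets.sets_Collect_conj sets.sets_Collect_finite_All)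
      show "{y \<in> space (PiM {a..<a + k} (\<lambda>_. lborel)). (0::real) \<le> y (a + i)} \<in> sets (PiM {a..<a + k} (\<lambda>_. lborel))" if "i \<in> {..<k}" for i
        using borel_measurable_le[OF borel_measurable_const[of "0 :: real"] c[of i]] that by simp
      show "{y \<in> space (PiM {a..<a + k} (\<lambda>_. lborel)). (\<Sum>j<k. y (a + j)) \<le> s} \<in> sets (PiM {a..<a + k} (\<lambda>_. lborel))"
        by (intro borel_measurable_le borel_measurable_const borel_measurable_sum c) simp
    qed simp
    then have "(indicator {y \<in> space (PiM {a..<a + k} (\<lambda>_. lborel)). (\<forall>i\<in>{..<k}. 0 \<le> y (a + i)) \<and> (\<Sum>j<k. y (a + j)) \<le> s} :: _ \<Rightarrow> ennreal) \<in> borel_measurable (PiM {a..<a + k} (\<lambda>_. lborel))"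
      by simp
    then have "(indicator ?A :: _ \<Rightarrow> ennreal) \<in> borel_measurable (PiM {a..<a + k} (\<lambda>_. lborel))"
      by (rule measurable_cong[THEN iffD1, rotated]) (auto simp: indicator_def)
    then show ?thesis using 1 by (intro borel_measurable_times_ennreal)
  qed

text \<open>The coordinates are numbered from a general \<open>a\<close>, since peeling off the
  first one leaves the index set \<open>{Suc a..<Suc a + k}\<close>. In each variable the closed
  interval differs from the open one in \<open>simplex_nn\<close> by a null set.\<close>

lemma nn_integral_simplex_le:
  fixes g :: "(nat \<Rightarrow> real) \<Rightarrow> ennreal"
  assumes [measurable]: "g \<in> borel_measurable borel"
  shows "(\<integral>\<^sup>+y. g (\<lambda>i. if i < k then y (a + i) else if i = k then s - (\<Sum>j<k. y (a + j)) else 0) *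
     indicator {y. (\<forall>i<k. 0 \<le> y (a + i)) \<and> (\<Sum>j<k. y (a + j)) \<le> s} y \<partial>(\<Pi>\<^sub>M i\<in>{a..<a + k}. lborel)) \<le> simplex_nn k s g"
  using assms
proof (induction k arbitrary: a s g)
  case 0
  interpret product_sigma_finite "\<lambda>_::nat. lborel :: real measure" by standard
  have "(\<lambda>i. if i = 0 then s else 0) = case_nat s zeros" by (auto split: nat.split)
  then show ?case
    by (cases "0 \<le> s") (simp_all add: PiM_empty nn_integral_count_space_finite indicator_def cong: if_cong)
next
  case (Suc k)
  interpret product_sigma_finite "\<lambda>_::nat. lborel :: real measure" by standard
  note [measurable] = Suc.prems
  let ?I = "{Suc a..<Suc a + k}"
  let ?p = "\<lambda>k a s y i. if i < k then y (a + i) else if i = k then s - (\<Sum>j<k. y (a + j)) else (0::real)"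
  let ?A = "\<lambda>k a s. {y. (\<forall>i<k. 0 \<le> y (a + i)) \<and> (\<Sum>j<k. y (a + j)) \<le> (s::real)}"
  have I: "{a..<a + Suc k} = insert a ?I" by auto
  have p: "?p (Suc k) a s (x(a := t)) = case_nat t (?p k (Suc a) (s - t) x)" for x t
  proof
    fix i show "?p (Suc k) a s (x(a := t)) i = case_nat t (?p k (Suc a) (s - t) x) i"
      by (cases i) (auto simp: sum.lessThan_Suc_shift simp del: sum.lessThan_Suc)
  qed
  have A: "x(a := t) \<in> ?A (Suc k) a s \<longleftrightarrow> 0 \<le> t \<and> x \<in> ?A k (Suc a) (s - t)" for x t
    by (simp add: sum.lessThan_Suc_shift All_less_Suc2 algebra_simps del: sum.lessThan_Suc)
  have m: "(\<lambda>y. g (?p (Suc k) a s y) * indicator (?A (Suc k) a s) y) \<in> borel_measurable (PiM (insert a ?I) (\<lambda>_. lborel))"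
    unfolding I[symmetric] by (rule measurable_simplex_integrand[OF Suc.prems])
  have "(\<integral>\<^sup>+y. g (?p (Suc k) a s y) * indicator (?A (Suc k) a s) y \<partial>(\<Pi>\<^sub>M i\<in>{a..<a + Suc k}. lborel)) =
    (\<integral>\<^sup>+t. (\<integral>\<^sup>+x. g (?p (Suc k) a s (x(a := t))) * indicator (?A (Suc k) a s) (x(a := t)) \<partial>(\<Pi>\<^sub>M i\<in>?I. lborel)) \<partial>lborel)"
    unfolding I by (rule product_nn_integral_insert_rev[OF _ _ m]) auto
  also have "\<dots> = (\<integral>\<^sup>+t. (\<integral>\<^sup>+x. g (case_nat t (?p k (Suc a) (s - t) x)) * indicator (?A k (Suc a) (s - t)) x \<partial>(\<Pi>\<^sub>M i\<in>?I. lborel)) * indicator {0..} t \<partial>lborel)"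
  proof (rule nn_integral_cong)
    fix t :: real
    have ind: "indicator (?A (Suc k) a s) (x(a := t)) = (indicator (?A k (Suc a) (s - t)) x * indicator {0..} t :: ennreal)" for x
      unfolding indicator_def A by (cases "0 \<le> t") auto
    show "(\<integral>\<^sup>+x. g (?p (Suc k) a s (x(a := t))) * indicator (?A (Suc k) a s) (x(a := t)) \<partial>(\<Pi>\<^sub>M i\<in>?I. lborel)) =
      (\<integral>\<^sup>+x. g (case_nat t (?p k (Suc a) (s - t) x)) * indicator (?A k (Suc a) (s - t)) x \<partial>(\<Pi>\<^sub>M i\<in>?I. lborel)) * indicator {0..} t"
      unfolding p ind by (cases "0 \<le> t") simp_all
  qed
  also have "\<dots> \<le> (\<integral>\<^sup>+t. simplex_nn k (s - t) (\<lambda>y. g (case_nat t y)) * indicator {0..s} t \<partial>lborel)"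
  proof (rule nn_integral_mono)
    fix t :: real
    show "(\<integral>\<^sup>+x. g (case_nat t (?p k (Suc a) (s - t) x)) * indicator (?A k (Suc a) (s - t)) x \<partial>(\<Pi>\<^sub>M i\<in>?I. lborel)) * indicator {0..} t
      \<le> simplex_nn k (s - t) (\<lambda>y. g (case_nat t y)) * indicator {0..s} t"
    proof (cases "0 \<le> t \<and> t \<le> s")
      case True
      then show ?thesis using Suc.IH[of "\<lambda>y. g (case_nat t y)" "Suc a" "s - t"] by simp
    next
      case False
      have "x \<notin> ?A k (Suc a) (s - t)" if "0 \<le> t" for x
        using sum_nonneg[of "{..<k}" "\<lambda>j. x (Suc a + j)"] False that by auto
      then have z: "indicator (?A k (Suc a) (s - t)) x = (0 :: ennreal)" if "0 \<le> t" for x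
        using that by (intro indicator_simps(2))
      show ?thesis
      proof (cases "0 \<le> t")
        case True then show ?thesis unfolding z[OF True] by simp
      qed simp
    qed
  qed
  also have "\<dots> = simplex_nn (Suc k) s g" unfolding simplex_nn.simps
    by (rule nn_integral_open_closed[symmetric])
  finally show ?case .
qed


text \<open>\<open>simplex_nn_hit_prob\<close> concerns all orders of the parts. Points of
  \<open>Sigma1\<close> are already sorted, so \<open>decr_rearr\<close> is the identity there and
  the null set can be restricted to the sorted region.\<close>

theorem AE_face_lebesgue_hit_prob:
  assumes "n \<ge> 1" shows "AE x in face_lebesgue n. x \<in> Sigma1 \<and> hit_prob x = 1"
proof -
  obtain k where k: "n = Suc k" using assms by (cases n) auto
  define g where "g y = 1 - hit_prob (decr_rearr y)" for y
  have gm [measurable]: "g \<in> borel_measurable borel" unfolding g_def by measurable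
  let ?p = "\<lambda>y i. if i < k then y (0 + i) else if i = k then 1 - (\<Sum>j<k. y (0 + j)) else (0::real)"
  let ?A = "{y. (\<forall>i<k. 0 \<le> y (0 + i)) \<and> (\<Sum>j<k. y (0 + j)) \<le> (1::real)}"
  let ?M = "\<Pi>\<^sub>M i\<in>{0..<0 + k}. (lborel :: real measure)"
  have "(\<integral>\<^sup>+y. g (?p y) * indicator ?A y \<partial>?M) \<le> simplex_nn k 1 g"
    by (rule nn_integral_simplex_le[OF gm])
  also have "\<dots> = 0" unfolding g_def by (rule simplex_nn_hit_prob)
  finally have "(\<integral>\<^sup>+y. g (?p y) * indicator ?A y \<partial>?M) = 0" by simp
  then have AE: "AE y in ?M. g (?p y) * indicator ?A y = 0"
    by (subst (asm) nn_integral_0_iff_AE[OF measurable_simplex_integrand[OF gm]])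
  have M: "?M = (\<Pi>\<^sub>M i\<in>{..<n - 1}. lborel)" by (simp add: k atLeast0LessThan)
  have p: "?p y = simplex_point n y" for y by (auto simp: k simplex_point_def)
  have "AE y in (\<Pi>\<^sub>M i\<in>{..<n - 1}. lborel). simplex_point n y \<in> Sigma1 \<longrightarrow> hit_prob (simplex_point n y) = 1"
    using AE unfolding M
  proof eventually_elim
    case (elim y)
    show ?case
    proof
      assume S: "simplex_point n y \<in> Sigma1"
      have nn: "0 \<le> simplex_point n y i" for i using S by (simp add: Sigma1_def)
      have "y \<in> ?A"
      proof -
        have "0 \<le> y i" if "i < k" for i using nn[of i] that by (simp add: simplex_point_def k)
        moreover have "(\<Sum>j<k. y j) \<le> 1" using nn[of k] by (simp add: simplex_point_def k)
        ultimately show ?thesis by simp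
      qed
      then have "1 - hit_prob (simplex_point n y) = 0"
        using elim unfolding p g_def decr_rearr_Sigma1_id[OF S] by simp
      then have "1 \<le> hit_prob (simplex_point n y)" by (simp add: diff_eq_0_iff_ennreal)
      then show "hit_prob (simplex_point n y) = 1" using hit_prob_le_1[OF S] by (rule antisym[rotated])
    qed
  qed
  then have "AE x in distr (\<Pi>\<^sub>M i\<in>{..<n - 1}. lborel) borel (simplex_point n). x \<in> Sigma1 \<longrightarrow> x \<in> Sigma1 \<and> hit_prob x = 1"
    by (subst AE_distr_iff[OF measurable_simplex_point]) auto
  then show ?thesis unfolding face_lebesgue_def
    by (subst AE_restrict_space_iff) (auto simp: sets_Sigma1)
qed

text \<open>The Markov property at the first visit to \<open>unit_pt\<close>: if it occurs within
  \<open>k\<close> steps, at least \<open>m\<close> of the \<open>m + k\<close> steps are still to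
  come, and from there the mean of \<open>F\<close> is at least \<open>I\<close>. Paths without a
  visit contribute at least 0. The induction on \<open>k\<close> conditions on the first
  step.\<close>

lemma hit_mult_le_lazy_op_funpow:
  assumes F [measurable]: "F \<in> borel_measurable borel" and I: "\<And>j. m \<le> j \<Longrightarrow> I \<le> (lazy_op ^^ j) F unit_pt"
    and x: "x \<in> Sigma1"
  shows "hit k x * I \<le> (lazy_op ^^ (m + k)) F x"
  using x
proof (induction k arbitrary: x)
  case 0
  then show ?case using I[of m] by (auto simp: indicator_def)
next
  case (Suc k)
  show ?case
  proof (cases "x = unit_pt")
    case True
    then show ?thesis using I[of "m + Suc k"] by simp
  next
    case False
    have "hit (Suc k) x * I = lazy_op (\<lambda>z. hit k z * I) x"
      using False by (simp add: lazy_op_mult)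
    also have "\<dots> \<le> lazy_op ((lazy_op ^^ (m + k)) F) x"
      by (rule lazy_op_mono) (rule Suc.IH)
    finally show ?thesis by simp
  qed
qed

theorem eventually_le_lazy_op_funpow:
  assumes F: "F \<in> borel_measurable borel" and I: "\<And>j. m \<le> j \<Longrightarrow> I \<le> (lazy_op ^^ j) F unit_pt"
    and x: "x \<in> Sigma1" "hit_prob x = 1" and c: "c < I"
  shows "\<forall>\<^sub>F n in sequentially. c < (lazy_op ^^ n) F x"
proof -
  have "(SUP k. hit k x * I) = I" using x(2) by (simp only: SUP_mult_right_ennreal[symmetric] hit_prob_def mult_1_left)
  then have "c < (SUP k. hit k x * I)" using c by (simp only:)
  then obtain k where k: "c < hit k x * I" by (auto simp: less_SUP_iff simp del: hit.simps)
  have "c < (lazy_op ^^ n) F x" if "m + k \<le> n" for n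
  proof -
    \<comment> \<open>The bound \<open>I\<close> also holds from \<open>n - k\<close> steps onwards,
      so the lemma is used with \<open>n - k\<close> in place of \<open>m\<close> and all spare
      steps come after the visit.\<close>
    have "hit k x * I \<le> (lazy_op ^^ ((n - k) + k)) F x"
      by (rule hit_mult_le_lazy_op_funpow[OF F I x(1)]) (use that in auto)
    then show ?thesis using k that by (simp del: hit.simps)
  qed
  then show ?thesis by (auto simp: eventually_sequentially)
qed

section \<open>Comparison with stick breaking\<close>

text \<open>Euler's beta integral with integer exponents, scaled to \<open>{0..s}\<close>; the
  induction on \<open>b\<close> is integration by parts.\<close>

lemma has_integral_beta:
  fixes s :: real assumes s: "0 \<le> s"
  shows "((\<lambda>t. t ^ a * (s - t) ^ b) has_integral (fact a * fact b / fact (a + b + 1) * s ^ (a + b + 1))) {0..s}"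
proof (induction b arbitrary: a)
  case 0
  have "((\<lambda>t. t ^ a) has_integral (s ^ Suc a / real (Suc a) - 0 ^ Suc a / real (Suc a))) {0..s}"
  proof (rule fundamental_theorem_of_calculus[OF s])
    fix x assume "x \<in> {0..s}"
    have "((\<lambda>x. x ^ Suc a / real (Suc a)) has_real_derivative x ^ a) (at x within {0..s})"
      by (rule derivative_eq_intros refl | simp)+
    then show "((\<lambda>x. x ^ Suc a / real (Suc a)) has_vector_derivative x ^ a) (at x within {0..s})"
      by (simp add: has_real_derivative_iff_has_vector_derivative)
  qed
  moreover have "s ^ Suc a / real (Suc a) - 0 ^ Suc a / real (Suc a) = fact a * fact 0 / fact (a + 0 + 1) * s ^ (a + 0 + 1)"
    by (simp del: of_nat_Suc)
  ultimately show ?case by simp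
next
  case (Suc b)
  have "((\<lambda>t. real (Suc a) * (t ^ a * (s - t) ^ Suc b) - real (Suc b) * (t ^ Suc a * (s - t) ^ b)) has_integral
     (s ^ Suc a * (s - s) ^ Suc b - 0 ^ Suc a * (s - 0) ^ Suc b)) {0..s}"
  proof (rule fundamental_theorem_of_calculus[OF s])
    fix x assume "x \<in> {0..s}"
    have "((\<lambda>t. t ^ Suc a * (s - t) ^ Suc b) has_real_derivative
        real (Suc a) * (x ^ a * (s - x) ^ Suc b) - real (Suc b) * (x ^ Suc a * (s - x) ^ b)) (at x within {0..s})"
      by (rule derivative_eq_intros refl | simp)+
    then show "((\<lambda>t. t ^ Suc a * (s - t) ^ Suc b) has_vector_derivative
        real (Suc a) * (x ^ a * (s - x) ^ Suc b) - real (Suc b) * (x ^ Suc a * (s - x) ^ b)) (at x within {0..s})"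
      by (simp only: has_real_derivative_iff_has_vector_derivative)
  qed
  from has_integral_add[OF this has_integral_mult_right[OF Suc.IH[of "Suc a"], of "real (Suc b)"]]
  have "((\<lambda>t. real (Suc a) * (t ^ a * (s - t) ^ Suc b)) has_integral
     (real (Suc b) * (fact (Suc a) * fact b / fact (Suc a + b + 1) * s ^ (Suc a + b + 1)))) {0..s}" by simp
  from has_integral_mult_right[OF this, of "1 / real (Suc a)"]
  have "((\<lambda>t. t ^ a * (s - t) ^ Suc b) has_integral
     (1 / real (Suc a) * (real (Suc b) * (fact (Suc a) * fact b / fact (Suc a + b + 1) * s ^ (Suc a + b + 1))))) {0..s}" by simp
  also have "1 / real (Suc a) * (real (Suc b) * (fact (Suc a) * fact b / fact (Suc a + b + 1) * s ^ (Suc a + b + 1))) =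
      fact a * fact (Suc b) / fact (a + Suc b + 1) * s ^ (a + Suc b + 1)"
    unfolding fact_Suc[of a] fact_Suc[of b] by (simp del: of_nat_Suc fact_Suc power_Suc)
  finally show ?case .
qed

text \<open>Unlike \<open>perm_inv\<close>, this does not refer to a number of parts:
  \<open>surj_nn\<close> sums over all of them, and its recursion fixes one more coordinate of
  \<open>g\<close> each time.\<close>

definition bij_inv :: "((nat \<Rightarrow> real) \<Rightarrow> 'a) \<Rightarrow> bool" where
  "bij_inv g \<longleftrightarrow> (\<forall>\<pi> y. bij \<pi> \<longrightarrow> g (y \<circ> \<pi>) = g y)"

lemma bij_inv_case_nat: "bij_inv g \<Longrightarrow> bij_inv (\<lambda>y. g (case_nat t y))"
  unfolding bij_inv_def by (metis bij_lift case_nat_o_lift)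

lemma bij_inv_perm_inv: "bij_inv g \<Longrightarrow> perm_inv k g"
  unfolding bij_inv_def perm_inv_def by (blast intro: permutes_bij)

text \<open>For \<open>s = 1\<close>, \<open>N \<ge> 1\<close> and \<open>g\<close> a function of
  the sorted sequence, this is \<open>N\<close> times the mean of \<open>g\<close> under the chain
  from \<open>unit_pt\<close> after \<open>N - 1\<close> steps. A general \<open>s\<close> stands
  for the mass that is left when some parts have been taken out.\<close>

definition surj_nn :: "nat \<Rightarrow> real \<Rightarrow> ((nat \<Rightarrow> real) \<Rightarrow> ennreal) \<Rightarrow> ennreal" where
  "surj_nn N s g = (\<Sum>k. cycle_nn k s (\<lambda>y. ennreal (surj_wt N k y) * g y))"

lemma surj_nn_0 [simp]: "surj_nn 0 s g = 0"
  by (simp add: surj_nn_def surj_wt_0_eq cycle_nn_def)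

lemma measurable_cycle_nn_case_nat:
  fixes g :: "(nat \<Rightarrow> real) \<Rightarrow> ennreal" and s :: real
  assumes [measurable]: "g \<in> borel_measurable borel" "h \<in> borel_measurable borel"
  shows "(\<lambda>t. cycle_nn k (s - t) (\<lambda>y. h y * g (case_nat t y))) \<in> borel_measurable borel"
proof -
  have "(\<lambda>t. simplex_nn k (s - t) (\<lambda>y. h y * g (case_nat t y) * inv_prod k y)) \<in> borel_measurable borel"
    by (rule measurable_simplex_nn_1[where a="\<lambda>t. t"]) measurable
  then show ?thesis unfolding cycle_nn_def by measurable
qed

lemma measurable_surj_nn_case_nat:
  fixes g :: "(nat \<Rightarrow> real) \<Rightarrow> ennreal" and s :: real
  assumes [measurable]: "g \<in> borel_measurable borel"
  shows "(\<lambda>t. surj_nn N (s - t) (\<lambda>y. g (case_nat t y))) \<in> borel_measurable borel"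
  unfolding surj_nn_def by (intro borel_measurable_suminf_order measurable_cycle_nn_case_nat assms) measurable

lemma cycle_nn_sum:
  assumes "finite I" "\<And>i. i \<in> I \<Longrightarrow> g i \<in> borel_measurable borel"
  shows "cycle_nn k s (\<lambda>y. \<Sum>i\<in>I. g i y) = (\<Sum>i\<in>I. cycle_nn k s (g i))"
  using assms by (induction I) (simp_all add: cycle_nn_add, simp add: cycle_nn_def)

text \<open>Take out a size-biased part by \<open>cycle_nn_Suc\<close>. Either it is the only part,
  with weight \<open>s ^ N\<close> and density \<open>1 / s\<close>; or it has size \<open>t\<close>
  with density \<open>dt / s\<close>, receives \<open>K\<close> of the \<open>N\<close> draws, and
  the other \<open>N - K\<close> draws must cover the rest. For \<open>K = N\<close> no draw is left
  for the rest, and indeed \<open>surj_nn 0\<close> is 0.\<close>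

theorem surj_nn_rec:
  assumes g [measurable]: "g \<in> borel_measurable borel" and inv: "bij_inv g" and s: "0 < s" and N: "1 \<le> N"
  shows "surj_nn N s g = ennreal (s ^ (N - 1)) * g (case_nat s zeros) +
    ennreal (1 / s) * (\<integral>\<^sup>+t. (\<Sum>K\<in>{1..N}. ennreal (real (N choose K) * t ^ K) * surj_nn (N - K) (s - t) (\<lambda>y. g (case_nat t y)))
       * indicator {0<..<s} t \<partial>lborel)"
proof -
  let ?c = "\<lambda>k. cycle_nn k s (\<lambda>y. ennreal (surj_wt N k y) * g y)"
  let ?d = "\<lambda>k K t. cycle_nn k (s - t) (\<lambda>y. ennreal (surj_wt (N - K) k y) * g (case_nat t y))"
  have dm: "?d k K \<in> borel_measurable borel" for k K by (rule measurable_cycle_nn_case_nat) measurable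
  have S: "?c (Suc k) = ennreal (1 / s) * (\<integral>\<^sup>+t. (\<Sum>K\<in>{1..N}. ennreal (real (N choose K) * t ^ K) * ?d k K t) * indicator {0<..<s} t \<partial>lborel)" for k
  proof -
    have p: "perm_inv (Suc k) (\<lambda>y. ennreal (surj_wt N (Suc k) y) * g y)"
      using perm_inv_surj_wt[of "Suc k" N] bij_inv_perm_inv[OF inv, of "Suc k"] by (simp add: perm_inv_def)
    have "cycle_nn k (s - t) (\<lambda>y. ennreal (surj_wt N (Suc k) (case_nat t y)) * g (case_nat t y)) =
       (\<Sum>K\<in>{1..N}. ennreal (real (N choose K) * t ^ K) * ?d k K t)" if t: "0 < t" "t < s" for t
    proof -
      have "cycle_nn k (s - t) (\<lambda>y. ennreal (surj_wt N (Suc k) (case_nat t y)) * g (case_nat t y)) =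
         cycle_nn k (s - t) (\<lambda>y. \<Sum>K\<in>{1..N}. ennreal (real (N choose K) * t ^ K) * (ennreal (surj_wt (N - K) k y) * g (case_nat t y)))"
      proof (rule cycle_nn_cong)
        fix y :: "nat \<Rightarrow> real" assume y: "\<And>i. i \<le> k \<Longrightarrow> 0 < y i"
        have nn: "0 \<le> surj_wt M k y" for M by (rule surj_wt_nonneg) (simp add: y less_imp_le)
        have "ennreal (surj_wt N (Suc k) (case_nat t y)) = (\<Sum>K\<in>{1..N}. ennreal (real (N choose K) * t ^ K) * ennreal (surj_wt (N - K) k y))"
          unfolding surj_wt_Suc using t nn by (subst sum_ennreal[symmetric]) (auto simp: ennreal_mult)
        then show "ennreal (surj_wt N (Suc k) (case_nat t y)) * g (case_nat t y) =
          (\<Sum>K\<in>{1..N}. ennreal (real (N choose K) * t ^ K) * (ennreal (surj_wt (N - K) k y) * g (case_nat t y)))"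
          by (simp only: sum_distrib_right mult.assoc)
      qed (use t in simp)
      also have "\<dots> = (\<Sum>K\<in>{1..N}. cycle_nn k (s - t) (\<lambda>y. ennreal (real (N choose K) * t ^ K) * (ennreal (surj_wt (N - K) k y) * g (case_nat t y))))"
        by (rule cycle_nn_sum) auto
      also have "\<dots> = (\<Sum>K\<in>{1..N}. ennreal (real (N choose K) * t ^ K) * ?d k K t)"
        by (intro sum.cong refl cycle_nn_cmult) measurable
      finally show ?thesis .
    qed
    then have "(\<integral>\<^sup>+t. cycle_nn k (s - t) (\<lambda>y. ennreal (surj_wt N (Suc k) (case_nat t y)) * g (case_nat t y)) * indicator {0<..<s} t \<partial>lborel)
      = (\<integral>\<^sup>+t. (\<Sum>K\<in>{1..N}. ennreal (real (N choose K) * t ^ K) * ?d k K t) * indicator {0<..<s} t \<partial>lborel)"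
      by (intro nn_integral_cong) (auto simp: indicator_def)
    moreover have m: "(\<lambda>y. ennreal (surj_wt N (Suc k) y) * g y) \<in> borel_measurable borel" by measurable
    ultimately show ?thesis unfolding cycle_nn_Suc[OF m p s] by (simp only:)
  qed
  have "surj_nn N s g = (\<Sum>k. ?c (Suc k)) + ?c 0"
    unfolding surj_nn_def using suminf_offset[of ?c 1] by simp
  also have "?c 0 = ennreal (s ^ (N - 1)) * g (case_nat s zeros)"
  proof -
    obtain M where M: "N = Suc M" using N by (cases N) auto
    have "ennreal (s ^ Suc M) * g (case_nat s zeros) * ennreal (1 / s) = ennreal (s ^ M) * (ennreal s * ennreal (1 / s)) * g (case_nat s zeros)"
      using s by (simp add: ennreal_mult ac_simps)
    then show ?thesis using s by (simp add: M cycle_nn_def surj_wt_0 ennreal_mult_inverse del: power_Suc)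
  qed
  also have "(\<Sum>k. ?c (Suc k)) = ennreal (1 / s) * (\<integral>\<^sup>+t. (\<Sum>k. (\<Sum>K\<in>{1..N}. ennreal (real (N choose K) * t ^ K) * ?d k K t) * indicator {0<..<s} t) \<partial>lborel)"
  proof -
    have "(\<lambda>t. (\<Sum>K\<in>{1..N}. ennreal (real (N choose K) * t ^ K) * ?d k K t) * indicator {0<..<s} t) \<in> borel_measurable lborel" for k
      using dm by simp
    then show ?thesis unfolding S by (simp only: ennreal_suminf_cmult nn_integral_suminf)
  qed
  also have "(\<lambda>t. \<Sum>k. (\<Sum>K\<in>{1..N}. ennreal (real (N choose K) * t ^ K) * ?d k K t) * indicator {0<..<s} t) =
     (\<lambda>t. (\<Sum>K\<in>{1..N}. ennreal (real (N choose K) * t ^ K) * surj_nn (N - K) (s - t) (\<lambda>y. g (case_nat t y))) * indicator {0<..<s} t)"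
    unfolding ennreal_suminf_multc surj_nn_def ennreal_suminf_cmult[symmetric]
    by (simp add: suminf_sum)
  finally show ?thesis by (simp only: add.commute)
qed

text \<open>\<open>(N choose K) * (N - K) = N * ((N - 1) choose K)\<close> turns the sum into the
  binomial expansion of \<open>(t + (s - t)) ^ (N - 1)\<close> without the term
  \<open>K = 0\<close>. The factors \<open>(N - K) * (s - t) ^ (N - K - 1)\<close> are the total
  masses of \<open>surj_nn (N - K) (s - t)\<close>.\<close>

lemma sum_choose_weights:
  fixes t s :: real assumes N: "1 \<le> N"
  shows "(\<Sum>K\<in>{1..N}. real (N choose K) * t ^ K * (real (N - K) * (s - t) ^ (N - K - 1))) = real N * (s ^ (N - 1) - (s - t) ^ (N - 1))"
proof -
  obtain M where M: "N = Suc M" using N by (cases N) auto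
  have a: "real (Suc M choose K) * real (Suc M - K) = real (Suc M) * real (M choose K)" for K
  proof (cases "K \<le> M")
    case True
    have "Suc M * (M choose K) = (Suc M - K) * (Suc M choose K)"
      using binomial_absorb_comp[of "Suc M" K] by simp
    then show ?thesis by (metis of_nat_mult mult.commute)
  next
    case False then show ?thesis by (simp add: binomial_eq_0)
  qed
  have "(\<Sum>K\<in>{1..N}. real (N choose K) * t ^ K * (real (N - K) * (s - t) ^ (N - K - 1))) =
     (\<Sum>K\<in>{1..N}. real (Suc M) * (real (M choose K) * t ^ K * (s - t) ^ (M - K)))"
  proof (rule sum.cong[OF refl])
    fix K assume "K \<in> {1..N}"
    have "real (N choose K) * t ^ K * (real (N - K) * (s - t) ^ (N - K - 1)) = (real (Suc M choose K) * real (Suc M - K)) * t ^ K * (s - t) ^ (M - K)"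
      unfolding M by simp
    then show "real (N choose K) * t ^ K * (real (N - K) * (s - t) ^ (N - K - 1)) = real (Suc M) * (real (M choose K) * t ^ K * (s - t) ^ (M - K))"
      unfolding a by simp
  qed
  also have "\<dots> = real (Suc M) * (\<Sum>K\<in>{1..Suc M}. real (M choose K) * t ^ K * (s - t) ^ (M - K))"
    unfolding M by (simp only: sum_distrib_left)
  also have "(\<Sum>K\<in>{1..Suc M}. real (M choose K) * t ^ K * (s - t) ^ (M - K)) = (\<Sum>K\<in>{1..M}. real (M choose K) * t ^ K * (s - t) ^ (M - K))"
    by simp
  also have "\<dots> = (\<Sum>K\<le>M. real (M choose K) * t ^ K * (s - t) ^ (M - K)) - (s - t) ^ M"
    by (simp add: atMost_atLeast0 sum.atLeast_Suc_atMost)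
  also have "(\<Sum>K\<le>M. real (M choose K) * t ^ K * (s - t) ^ (M - K)) = s ^ M"
    using binomial_ring[of t "s - t" M] by simp
  finally show ?thesis by (simp add: M)
qed

text \<open>Strong induction through \<open>surj_nn_rec\<close>: by
  \<open>sum_choose_weights\<close> the integral over \<open>t\<close> is
  \<open>(N - 1) * s ^ N\<close>, and after division by \<open>s\<close> the single part adds the
  missing \<open>s ^ (N - 1)\<close>.\<close>

lemma surj_nn_const_1:
  assumes "0 < s" shows "surj_nn N s (\<lambda>_. 1) = ennreal (real N * s ^ (N - 1))"
  using assms
proof (induction N arbitrary: s rule: less_induct)
  case (less N)
  show ?case
  proof (cases "N = 0")
    case False
    then have N: "1 \<le> N" by simp
    note s = less.prems
    have "surj_nn N s (\<lambda>_. 1) = ennreal (s ^ (N - 1)) +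
      ennreal (1 / s) * (\<integral>\<^sup>+t. (\<Sum>K\<in>{1..N}. ennreal (real (N choose K) * t ^ K) * surj_nn (N - K) (s - t) (\<lambda>_. 1)) * indicator {0<..<s} t \<partial>lborel)"
      using surj_nn_rec[of "\<lambda>_. 1" s N] s N by (simp add: bij_inv_def)
    also have "(\<integral>\<^sup>+t. (\<Sum>K\<in>{1..N}. ennreal (real (N choose K) * t ^ K) * surj_nn (N - K) (s - t) (\<lambda>_. 1)) * indicator {0<..<s} t \<partial>lborel)
      = (\<integral>\<^sup>+t. ennreal (real N * (s ^ (N - 1) - (s - t) ^ (N - 1))) * indicator {0<..<s} t \<partial>lborel)"
    proof (rule nn_integral_cong)
      fix t :: real
      have "(\<Sum>K\<in>{1..N}. ennreal (real (N choose K) * t ^ K) * surj_nn (N - K) (s - t) (\<lambda>_. 1)) =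
        ennreal (real N * (s ^ (N - 1) - (s - t) ^ (N - 1)))" if t: "0 < t" "t < s"
      proof -
        have "(\<Sum>K\<in>{1..N}. ennreal (real (N choose K) * t ^ K) * surj_nn (N - K) (s - t) (\<lambda>_. 1)) =
          (\<Sum>K\<in>{1..N}. ennreal (real (N choose K) * t ^ K * (real (N - K) * (s - t) ^ (N - K - 1))))"
          using t by (intro sum.cong refl) (subst less.IH, auto simp: ennreal_mult)
        also have "\<dots> = ennreal (\<Sum>K\<in>{1..N}. real (N choose K) * t ^ K * (real (N - K) * (s - t) ^ (N - K - 1)))"
          using t by (intro sum_ennreal) auto
        finally show ?thesis unfolding sum_choose_weights[OF N] .
      qed
      then show "(\<Sum>K\<in>{1..N}. ennreal (real (N choose K) * t ^ K) * surj_nn (N - K) (s - t) (\<lambda>_. 1)) * indicator {0<..<s} t =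
        ennreal (real N * (s ^ (N - 1) - (s - t) ^ (N - 1))) * indicator {0<..<s} t" by (auto simp: indicator_def)
    qed
    also have "\<dots> = ennreal (real N * s ^ N - s ^ N)"
    proof -
      obtain M where M: "N = Suc M" using N by (cases N) auto
      have h: "((\<lambda>t. real N * (s ^ M * 1 - t ^ 0 * (s - t) ^ M)) has_integral (real N * (s ^ M * s - fact 0 * fact M / fact (0 + M + 1) * s ^ (0 + M + 1)))) {0..s}"
        using s has_integral_const_real[of "1::real" 0 s]
        by (intro has_integral_mult_right has_integral_diff has_integral_beta) simp_all
      have "real N * (s ^ M * s - fact 0 * fact M / fact (0 + M + 1) * s ^ (0 + M + 1)) = real N * s ^ N - s ^ N"
      proof -
        have "fact 0 * fact M / fact (0 + M + 1) * s ^ (0 + M + 1) = s ^ N / real N" by (simp add: M del: of_nat_Suc)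
        then show ?thesis using N by (simp add: M right_diff_distrib del: of_nat_Suc)
      qed
      with h have h: "((\<lambda>t. real N * (s ^ (N - 1) - (s - t) ^ (N - 1))) has_integral (real N * s ^ N - s ^ N)) {0..s}" by (simp add: M)
      have "(\<integral>\<^sup>+t. ennreal (real N * (s ^ (N - 1) - (s - t) ^ (N - 1))) * indicator {0<..<s} t \<partial>lborel) =
        (\<integral>\<^sup>+t. ennreal (real N * (s ^ (N - 1) - (s - t) ^ (N - 1))) * indicator {0..s} t \<partial>lborel)"
        by (rule nn_integral_open_closed)
      also have "\<dots> = ennreal (real N * s ^ N - s ^ N)"
        by (rule nn_integral_has_integral_lebesgue'[OF _ h]) (auto intro!: mult_nonneg_nonneg power_mono)
      finally show ?thesis .
    qed
    also have "ennreal (s ^ (N - 1)) + ennreal (1 / s) * ennreal (real N * s ^ N - s ^ N) = ennreal (real N * s ^ (N - 1))"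
    proof -
      obtain M where M: "N = Suc M" using N by (cases N) auto
      have "0 \<le> real N * s ^ N - s ^ N" using N s by (simp add: M)
      then have "ennreal (s ^ (N - 1)) + ennreal (1 / s) * ennreal (real N * s ^ N - s ^ N) = ennreal (s ^ (N - 1) + 1 / s * (real N * s ^ N - s ^ N))"
        using s by (simp add: ennreal_mult ennreal_plus del: times_divide_eq_left)
      also have "s ^ (N - 1) + 1 / s * (real N * s ^ N - s ^ N) = real N * s ^ (N - 1)" using s by (simp add: M field_simps)
      finally show ?thesis .
    qed
    finally show ?thesis .
  qed simp
qed


section \<open>Stick breaking with uniform sticks from a total length \<open>s\<close>\<close>

abbreviation unif_seq :: "(nat \<Rightarrow> real) measure" where
  "unif_seq \<equiv> \<Pi>\<^sub>M i\<in>UNIV. uniform_measure lborel {0..1}"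

lemma prob_space_unif: "prob_space (uniform_measure lborel {0..1::real})"
  by (rule prob_space_uniform_measure) auto

lemma sequence_space_unif: "sequence_space (uniform_measure lborel {0..1::real})"
  by (intro sequence_space.intro product_prob_spaceI prob_space_unif)

lemma measurable_stick_breaking [measurable]:
  "(\<lambda>u. stick_breaking u k) \<in> borel_measurable unif_seq"
  unfolding stick_breaking_def by measurable

lemma stick_breaking_case_nat: "stick_breaking (case_nat a u) = case_nat a (\<lambda>i. (1 - a) * stick_breaking u i)"
proof
  fix i show "stick_breaking (case_nat a u) i = case_nat a (\<lambda>i. (1 - a) * stick_breaking u i) i"
  proof (cases i)
    case (Suc j)
    have "(\<Prod>l<Suc j. 1 - case_nat a u l) = (1 - a) * (\<Prod>l<j. 1 - u l)"
      by (simp add: prod.lessThan_Suc_shift del: prod.lessThan_Suc)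
    then show ?thesis by (simp add: Suc stick_breaking_def del: prod.lessThan_Suc)
  qed (simp add: stick_breaking_def)
qed

definition stick_nn :: "real \<Rightarrow> ((nat \<Rightarrow> real) \<Rightarrow> ennreal) \<Rightarrow> ennreal" where
  "stick_nn s g = (\<integral>\<^sup>+u. g (\<lambda>i. s * stick_breaking u i) \<partial>unif_seq)"

lemma measurable_stick_nn_case_nat:
  fixes g :: "(nat \<Rightarrow> real) \<Rightarrow> ennreal" and s :: real
  assumes [measurable]: "g \<in> borel_measurable borel"
  shows "(\<lambda>t. stick_nn (s - t) (\<lambda>y. g (case_nat t y))) \<in> borel_measurable borel"
proof -
  interpret U: sequence_space "uniform_measure lborel {0..1::real}" by (rule sequence_space_unif)
  have "(\<lambda>p. stick_breaking (snd p) i) \<in> borel_measurable (borel \<Otimes>\<^sub>M unif_seq)" for i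
    by (rule measurable_compose[OF measurable_snd measurable_stick_breaking])
  then have "(\<lambda>p i. (s - fst p) * stick_breaking (snd p) i) \<in> (borel \<Otimes>\<^sub>M unif_seq) \<rightarrow>\<^sub>M borel"
    by (intro meas_seq borel_measurable_times borel_measurable_diff) auto
  then have "(\<lambda>p. g (case_nat (fst p) (\<lambda>i. (s - fst p) * stick_breaking (snd p) i))) \<in> borel_measurable (borel \<Otimes>\<^sub>M unif_seq)"
    by (intro measurable_compose[OF measurable_case_nat_seq assms]) auto
  then show ?thesis unfolding stick_nn_def
    by (intro U.borel_measurable_nn_integral) (simp add: case_prod_beta)
qed

text \<open>The first stick \<open>t = s * a\<close> is uniform on \<open>{0..s}\<close>, and the
  others break the remaining length \<open>s - t\<close> in the same way. This is the counterpart of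
  \<open>surj_nn_rec\<close> without draws.\<close>

lemma stick_nn_rec:
  assumes g [measurable]: "g \<in> borel_measurable borel" and s: "0 < s"
  shows "stick_nn s g = ennreal (1 / s) * (\<integral>\<^sup>+t. stick_nn (s - t) (\<lambda>y. g (case_nat t y)) * indicator {0<..<s} t \<partial>lborel)"
proof -
  interpret U: sequence_space "uniform_measure lborel {0..1::real}" by (rule sequence_space_unif)
  let ?U = "uniform_measure lborel {0..1::real}"
  define h where "h t = stick_nn (s - t) (\<lambda>y. g (case_nat t y))" for t
  have h [measurable]: "h \<in> borel_measurable borel" unfolding h_def by (rule measurable_stick_nn_case_nat[OF g])
  have m: "(\<lambda>u. g (\<lambda>i. s * stick_breaking u i)) \<in> borel_measurable unif_seq"
    by (rule measurable_compose[OF meas_seq g]) measurable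
  have c: "(\<lambda>(a, u). case_nat a u) \<in> ?U \<Otimes>\<^sub>M unif_seq \<rightarrow>\<^sub>M unif_seq" by measurable
  have "stick_nn s g = (\<integral>\<^sup>+u. g (\<lambda>i. s * stick_breaking u i) \<partial>distr (?U \<Otimes>\<^sub>M unif_seq) unif_seq (\<lambda>(a, u). case_nat a u))"
    unfolding stick_nn_def U.PiM_iter ..
  also have "\<dots> = (\<integral>\<^sup>+p. g (\<lambda>i. s * stick_breaking (case p of (a, u) \<Rightarrow> case_nat a u) i) \<partial>(?U \<Otimes>\<^sub>M unif_seq))"
    by (rule nn_integral_distr[OF c]) (use m in simp)
  also have "\<dots> = (\<integral>\<^sup>+a. \<integral>\<^sup>+u. g (\<lambda>i. s * stick_breaking (case_nat a u) i) \<partial>unif_seq \<partial>?U)"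
    using U.nn_integral_fst[OF measurable_compose[OF c m], symmetric] by simp
  also have "\<dots> = (\<integral>\<^sup>+a. h (s * a) \<partial>?U)"
  proof -
    have "(\<lambda>i. s * stick_breaking (case_nat a u) i) = case_nat (s * a) (\<lambda>i. (s - s * a) * stick_breaking u i)" for a u
      unfolding stick_breaking_case_nat by (auto simp: fun_eq_iff algebra_simps split: nat.split)
    then show ?thesis by (simp only: h_def stick_nn_def)
  qed
  also have "\<dots> = (\<integral>\<^sup>+a. h (s * a) * indicator {0..1} a \<partial>lborel)"
    by (subst nn_integral_uniform_measure) (auto simp: divide_ennreal_def)
  also have "\<dots> = ennreal (1 / s) * (ennreal s * (\<integral>\<^sup>+a. h (s * a) * indicator {0..1} a \<partial>lborel))"
    by (simp only: ennreal_inverse_mult_cancel[OF s])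
  also have "ennreal s * (\<integral>\<^sup>+a. h (s * a) * indicator {0..1} a \<partial>lborel) = (\<integral>\<^sup>+t. h t * indicator {0..s} t \<partial>lborel)"
  proof -
    have "(\<integral>\<^sup>+t. h t * indicator {0..s} t \<partial>lborel) = ennreal \<bar>s\<bar> * (\<integral>\<^sup>+a. h (0 + s * a) * indicator {0..s} (0 + s * a) \<partial>lborel)"
      using s by (intro nn_integral_real_affine) auto
    also have "(\<lambda>a. h (0 + s * a) * indicator {0..s} (0 + s * a)) = (\<lambda>a. h (s * a) * indicator {0..1} a)"
      using s by (auto simp: fun_eq_iff indicator_def zero_le_mult_iff)
    finally show ?thesis using s by simp
  qed
  also have "\<dots> = (\<integral>\<^sup>+t. h t * indicator {0<..<s} t \<partial>lborel)" by (rule nn_integral_open_closed[symmetric])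
  finally show ?thesis unfolding h_def .
qed

lemma AE_unif_seq: "AE u in unif_seq. \<forall>i. 0 \<le> u i \<and> u i \<le> 1"
proof -
  have "AE x in uniform_measure lborel {0..1::real}. 0 \<le> x \<and> x \<le> 1"
    by (rule AE_uniform_measureI) auto
  then have "AE u in unif_seq. 0 \<le> u i \<and> u i \<le> 1" for i
    by (intro AE_PiM_component[where P="\<lambda>x. 0 \<le> x \<and> x \<le> 1"] prob_space_unif) auto
  then show ?thesis by (simp add: AE_all_countable)
qed

lemma sum_stick_breaking: "(\<Sum>i<n. stick_breaking u i) = 1 - (\<Prod>i<n. 1 - u i)"
  by (induction n) (simp_all add: stick_breaking_def algebra_simps)

lemma stick_breaking_bounds:
  assumes u: "\<forall>i. 0 \<le> u i \<and> u i \<le> 1"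
  shows "0 \<le> stick_breaking u i" "stick_breaking u i \<le> 1" "summable (stick_breaking u)" "stick_breaking u \<longlonglongrightarrow> 0"
proof -
  have p: "0 \<le> (\<Prod>i<n. 1 - u i)" for n using u by (intro prod_nonneg) auto
  show nn: "0 \<le> stick_breaking u i" for i using u p by (simp add: stick_breaking_def)
  have s1: "(\<Sum>i<n. stick_breaking u i) \<le> 1" for n using p by (simp add: sum_stick_breaking)
  show "stick_breaking u i \<le> 1"
    using s1[of "Suc i"] sum_nonneg[of "{..<i}" "stick_breaking u"] nn by simp
  show sm: "summable (stick_breaking u)"
  proof (rule bounded_imp_summable)
    show "(\<Sum>i\<le>n. stick_breaking u i) \<le> 1" for n using s1[of "Suc n"] by (simp add: lessThan_Suc_atMost)
  qed (rule nn)
  show "stick_breaking u \<longlonglongrightarrow> 0" by (rule summable_LIMSEQ_zero[OF sm])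
qed

text \<open>A Lipschitz condition in the uniform norm, in a form without subtraction. Sorting is
  nonexpansive for this norm, and on nonnegative null sequences the sorted terms are determined by
  counting the terms above a level.\<close>

definition sup_lipschitz :: "real \<Rightarrow> ((nat \<Rightarrow> real) \<Rightarrow> ennreal) \<Rightarrow> bool" where
  "sup_lipschitz c g \<longleftrightarrow> (\<forall>y y' d. (\<forall>i. 0 \<le> y i) \<longrightarrow> y \<longlonglongrightarrow> 0 \<longrightarrow> (\<forall>i. 0 \<le> y' i) \<longrightarrow> y' \<longlonglongrightarrow> 0 \<longrightarrow>
     (\<forall>i. \<bar>y i - y' i\<bar> \<le> d) \<longrightarrow> g y \<le> g y' + ennreal (c * d))"

lemma sup_lipschitzD:
  assumes "sup_lipschitz c g" "\<And>i. 0 \<le> y i" "y \<longlonglongrightarrow> 0" "\<And>i. 0 \<le> y' i" "y' \<longlonglongrightarrow> 0" "\<And>i. \<bar>y i - y' i\<bar> \<le> d"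
  shows "g y \<le> g y' + ennreal (c * d)"
  using assms unfolding sup_lipschitz_def by simp

lemma sup_lipschitz_case_nat:
  assumes "sup_lipschitz c g" "0 \<le> t" shows "sup_lipschitz c (\<lambda>y. g (case_nat t y))"
  unfolding sup_lipschitz_def
proof (intro allI impI)
  fix y y' :: "nat \<Rightarrow> real" and d assume y: "\<forall>i. 0 \<le> y i" "y \<longlonglongrightarrow> 0" "\<forall>i. 0 \<le> y' i" "y' \<longlonglongrightarrow> 0" "\<forall>i. \<bar>y i - y' i\<bar> \<le> d"
  have "0 \<le> d" using y(5) abs_ge_zero order_trans by blast
  then have "\<forall>i. 0 \<le> case_nat t y i" "\<forall>i. 0 \<le> case_nat t y' i" "\<forall>i. \<bar>case_nat t y i - case_nat t y' i\<bar> \<le> d"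
    using y assms(2) by (auto split: nat.split)
  then show "g (case_nat t y) \<le> g (case_nat t y') + ennreal (c * d)"
    by (intro sup_lipschitzD[OF assms(1)] case_nat_tendsto y(2,4)) simp_all
qed

text \<open>The crude comparison that ends the peeling: when only mass \<open>s\<close> is left, the
  terms of both sequences lie in \<open>{0..s}\<close>, so they differ by at most \<open>s\<close>
  in every place.\<close>

lemma stick_nn_le_finite:
  assumes g: "sup_lipschitz c g" and s: "0 < s" and y: "\<And>i. i \<le> k \<Longrightarrow> 0 < y i" "\<And>i. k < i \<Longrightarrow> y i = 0" "(\<Sum>i\<le>k. y i) = s"
  shows "stick_nn s g \<le> g y + ennreal (c * s)"
proof -
  interpret U: sequence_space "uniform_measure lborel {0..1::real}" by (rule sequence_space_unif)
  have nn: "0 \<le> y i" for i using y(1)[of i] y(2)[of i] by (cases "i \<le> k") auto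
  have ys: "y i \<le> s" for i
  proof (cases "i \<le> k")
    case True then show ?thesis unfolding y(3)[symmetric] using nn by (intro member_le_sum) auto
  qed (use y(2) s in auto)
  have "stick_nn s g \<le> (\<integral>\<^sup>+u. g y + ennreal (c * s) \<partial>unif_seq)" unfolding stick_nn_def
  proof (rule nn_integral_mono_AE)
    show "AE u in unif_seq. g (\<lambda>i. s * stick_breaking u i) \<le> g y + ennreal (c * s)"
      using AE_unif_seq
    proof eventually_elim
      case (elim u)
      note b = stick_breaking_bounds[OF elim]
      show ?case
      proof (rule sup_lipschitzD[OF g])
        show "\<bar>s * stick_breaking u i - y i\<bar> \<le> s" for i
        proof -
          have "0 \<le> s * stick_breaking u i" using s b(1) by simp
          moreover have "s * stick_breaking u i \<le> s" using s b(2)[of i] by simp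
          ultimately show ?thesis using nn[of i] ys[of i] by linarith
        qed
        show "(\<lambda>i. s * stick_breaking u i) \<longlonglongrightarrow> 0" using tendsto_mult_left[OF b(4), of s] by simp
        show "y \<longlonglongrightarrow> 0" using y(2) by (rule finite_support_tendsto)
        show "0 \<le> s * stick_breaking u i" for i using s b(1) by simp
      qed (rule nn)
    qed
  qed
  also have "\<dots> = g y + ennreal (c * s)" by (simp add: U.emeasure_space_1)
  finally show ?thesis .
qed

lemma surj_nn_add_cmult:
  assumes [measurable]: "g \<in> borel_measurable borel"
  shows "surj_nn N s (\<lambda>y. g y + e * 1) = surj_nn N s g + e * surj_nn N s (\<lambda>_. 1)"
proof -
  have "cycle_nn k s (\<lambda>y. ennreal (surj_wt N k y) * (g y + e * 1)) =
     cycle_nn k s (\<lambda>y. ennreal (surj_wt N k y) * g y) + e * cycle_nn k s (\<lambda>y. ennreal (surj_wt N k y) * 1)" for k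
  proof -
    have "cycle_nn k s (\<lambda>y. ennreal (surj_wt N k y) * (g y + e * 1)) =
      cycle_nn k s (\<lambda>y. ennreal (surj_wt N k y) * g y + e * (ennreal (surj_wt N k y) * 1))"
      by (simp only: distrib_left mult.left_commute)
    also have "\<dots> = cycle_nn k s (\<lambda>y. ennreal (surj_wt N k y) * g y) + cycle_nn k s (\<lambda>y. e * (ennreal (surj_wt N k y) * 1))"
      by (rule cycle_nn_add) measurable
    also have "cycle_nn k s (\<lambda>y. e * (ennreal (surj_wt N k y) * 1)) = e * cycle_nn k s (\<lambda>y. ennreal (surj_wt N k y) * 1)"
      by (rule cycle_nn_cmult) measurable
    finally show ?thesis .
  qed
  then show ?thesis unfolding surj_nn_def by (simp only: suminf_add[OF summableI summableI, symmetric] ennreal_suminf_cmult)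
qed

lemma surj_nn_mono:
  assumes "0 < s"
    and "\<And>k y. (\<And>i. i \<le> k \<Longrightarrow> 0 < y i) \<Longrightarrow> (\<And>i. k < i \<Longrightarrow> y i = 0) \<Longrightarrow> (\<Sum>i\<le>k. y i) = s \<Longrightarrow> g y \<le> h y"
  shows "surj_nn N s g \<le> surj_nn N s h"
  unfolding surj_nn_def by (intro suminf_le cycle_nn_mono[OF assms(1)] mult_left_mono assms(2)) auto

lemma sum_inverse_sqrt_le: "(\<Sum>M\<in>{1..n}. 1 / sqrt (real M)) \<le> 2 * sqrt (real n)"
proof (induction n)
  case (Suc n)
  have p: "0 < sqrt (real (Suc n))" by simp
  have "(sqrt (real (Suc n)) - sqrt (real n)) * (sqrt (real (Suc n)) + sqrt (real n)) = 1"
    by (simp add: algebra_simps)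
  moreover have "(sqrt (real (Suc n)) - sqrt (real n)) * (sqrt (real (Suc n)) + sqrt (real n)) \<le>
     (sqrt (real (Suc n)) - sqrt (real n)) * (2 * sqrt (real (Suc n)))"
    by (intro mult_left_mono) auto
  ultimately have "1 \<le> 2 * (sqrt (real (Suc n)) - sqrt (real n)) * sqrt (real (Suc n))"
    by (simp only: mult_ac)
  then have "1 / sqrt (real (Suc n)) \<le> 2 * (sqrt (real (Suc n)) - sqrt (real n))"
    using pos_divide_le_eq[OF p] by blast
  then show ?case using Suc by (simp del: of_nat_Suc)
qed simp


text \<open>Bounds the error from deficits after \<open>K\<close> peeled sticks. One more stick
  replaces it by \<open>1 / N\<close> plus the sum of the earlier errors over the number
  \<open>M\<close> of remaining draws, divided by \<open>N\<close>. The rate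
  \<open>1 / sqrt N\<close> reproduces itself under this, with a factor 2, because the sum of
  \<open>1 / sqrt M\<close> is at most \<open>2 * sqrt N\<close>; a rate \<open>1 / N\<close> would
  pick up logarithms. The constants obey \<open>1 + 2 * (2 ^ K - 1) = 2 ^ Suc K - 1\<close>.\<close>

definition err :: "nat \<Rightarrow> nat \<Rightarrow> real" where "err K N = (2 ^ K - 1) / sqrt (real N)"

lemma err_nonneg: "0 \<le> err K N"
  by (simp add: err_def)

lemma err_Suc:
  assumes "1 \<le> N" shows "1 + (\<Sum>M\<in>{1..N - 1}. err K M) \<le> real N * err (Suc K) N"
proof -
  have s1: "1 \<le> sqrt (real N)" using assms by simp
  have "(\<Sum>M\<in>{1..N - 1}. err K M) = (2 ^ K - 1) * (\<Sum>M\<in>{1..N - 1}. 1 / sqrt (real M))"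
    by (simp add: err_def sum_distrib_left)
  also have "\<dots> \<le> (2 ^ K - 1) * (2 * sqrt (real N))"
  proof (rule mult_left_mono)
    have "(\<Sum>M\<in>{1..N - 1}. 1 / sqrt (real M)) \<le> 2 * sqrt (real (N - 1))" by (rule sum_inverse_sqrt_le)
    also have "\<dots> \<le> 2 * sqrt (real N)" by simp
    finally show "(\<Sum>M\<in>{1..N - 1}. 1 / sqrt (real M)) \<le> 2 * sqrt (real N)" .
  qed simp
  finally have "1 + (\<Sum>M\<in>{1..N - 1}. err K M) \<le> sqrt (real N) + (2 ^ K - 1) * (2 * sqrt (real N))"
    by (rule add_mono[OF s1])
  also have "\<dots> = (2 ^ Suc K - 1) * sqrt (real N)" by (simp add: algebra_simps)
  also have "\<dots> = real N * err (Suc K) N"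
  proof -
    have "real N = sqrt (real N) * sqrt (real N)" by simp
    then have "real N / sqrt (real N) = sqrt (real N)" by (metis real_div_sqrt of_nat_0_le_iff)
    moreover have "real N * err (Suc K) N = (2 ^ Suc K - 1) * (real N / sqrt (real N))" by (simp add: err_def)
    ultimately show ?thesis by (simp only:)
  qed
  finally show ?thesis .
qed

text \<open>Peeling off the first stick: the surjection weights put mass at most \<open>N s\<^sup>N\<^sup>-\<^sup>1 dt / s\<close> on it, the uniform
  density, and the deficit is the event that the first stick takes everything.\<close>

theorem stick_nn_le_surj_nn:
  fixes g :: "(nat \<Rightarrow> real) \<Rightarrow> ennreal"
  assumes g: "g \<in> borel_measurable borel" "bij_inv g" "sup_lipschitz c g" "\<And>y. g y \<le> ennreal C"
    and C: "0 \<le> C" and c: "0 \<le> c" and s: "0 < s" and N: "1 \<le> N"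
  shows "ennreal (real N * s ^ (N - 1)) * stick_nn s g \<le>
    surj_nn N s g + ennreal (real N * s ^ (N - 1) * (C * err K N + c * s / 2 ^ K))"
  using g s N
proof (induction K arbitrary: N s g)
  \<comment> \<open>No stick is peeled: the bound of \<open>stick_nn_le_finite\<close> is integrated
    against the weights, whose total mass is \<open>N * s ^ (N - 1)\<close>.\<close>
  case 0
  note [measurable] = "0.prems"(1) and s = "0.prems"(5)
  have "ennreal (real N * s ^ (N - 1)) * stick_nn s g = stick_nn s g * surj_nn N s (\<lambda>_. 1)"
    by (simp add: surj_nn_const_1[OF s] mult.commute)
  also have "\<dots> = surj_nn N s (\<lambda>y. 0 + stick_nn s g * 1)"
    by (subst surj_nn_add_cmult) (simp_all add: surj_nn_def cycle_nn_def)
  also have "\<dots> \<le> surj_nn N s (\<lambda>y. g y + ennreal (c * s) * 1)"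
  proof (rule surj_nn_mono[OF s])
    fix k and y :: "nat \<Rightarrow> real"
    assume "\<And>i. i \<le> k \<Longrightarrow> 0 < y i" "\<And>i. k < i \<Longrightarrow> y i = 0" "(\<Sum>i\<le>k. y i) = s"
    from stick_nn_le_finite[OF "0.prems"(3) s this]
    show "0 + stick_nn s g * 1 \<le> g y + ennreal (c * s) * 1" by simp
  qed
  also have "\<dots> = surj_nn N s g + ennreal (c * s) * ennreal (real N * s ^ (N - 1))"
    by (subst surj_nn_add_cmult) (simp_all add: surj_nn_const_1[OF s])
  also have "ennreal (c * s) * ennreal (real N * s ^ (N - 1)) = ennreal (real N * s ^ (N - 1) * (C * err 0 N + c * s / 2 ^ 0))"
    using c s by (simp add: ennreal_mult[symmetric] err_def mult.commute)
  finally show ?case .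
next
  case (Suc K)
  note gm [measurable] = Suc.prems(1) and s = Suc.prems(5) and N = Suc.prems(6)
  let ?I = "C * s ^ N + (\<Sum>J\<in>{1..N - 1}. C * err K (N - J) * s ^ N) + real N * s ^ (N - 1) * (c / 2 ^ K) * (s\<^sup>2 / 2)"
  let ?q = "\<lambda>J. C * err K (N - J) * (real (N - J) * real (N choose J))"
  let ?m = "\<lambda>t J. (t ^ J * (s - t) ^ (N - J - 1))"
  let ?Z = "\<lambda>t J. surj_nn (N - J) (s - t) (\<lambda>y. g (case_nat t y))"
  let ?n = "real N * s ^ (N - 1)"
  let ?W = "\<lambda>t. stick_nn (s - t) (\<lambda>y. g (case_nat t y))"
  let ?b = "\<lambda>J t. real (N choose J) * t ^ J"
  let ?S = "\<lambda>t. \<Sum>J\<in>{1..N}. ennreal (?b J t) * (?Z t J)"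
  \<comment> \<open>Error for a first stick of length \<open>t\<close>: the deficit of the weights,
    where \<open>stick_nn\<close> is bounded by \<open>C\<close>; the deficits inherited for the
    \<open>N - J\<close> draws that are left; and the Lipschitz error for the remaining length
    \<open>s - t\<close>.\<close>
  define E where "E t = C * (real N * (s - t) ^ (N - 1)) + (\<Sum>J\<in>{1..N - 1}. (?q J) * (?m t J))
     + ?n * (c / 2 ^ K) * (s - t)" for t
  have W: "?W t \<le> ennreal C" for t
  proof -
    interpret U: sequence_space "uniform_measure lborel {0..1::real}" by (rule sequence_space_unif)
    have "?W t \<le> (\<integral>\<^sup>+u. ennreal C \<partial>unif_seq)" unfolding stick_nn_def by (intro nn_integral_mono Suc.prems(4))
    then show ?thesis by (simp add: U.emeasure_space_1)
  qed
  have E0: "0 \<le> E t" if "0 \<le> t" "t \<le> s" for t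
    unfolding E_def using that C c s err_nonneg by (intro add_nonneg_nonneg sum_nonneg mult_nonneg_nonneg) auto
  have pw: "ennreal (?n) * ?W t \<le> ?S t + ennreal (E t)" if t: "0 < t" "t < s" for t
  proof -
    let ?v = "\<lambda>J. real (N - J) * (s - t) ^ (N - J - 1)"
    let ?r = "\<lambda>J. C * err K (N - J) + c * (s - t) / 2 ^ K"
    have nn: "0 \<le> ?b J t" "0 \<le> ?v J" "0 \<le> ?r J" for J using t C c err_nonneg by auto
    \<comment> \<open>The uniform density splits into what \<open>surj_nn_rec\<close> offers for
      \<open>J \<ge> 1\<close> draws in the first stick and the deficit
      \<open>N * (s - t) ^ (N - 1)\<close>, which is the missing term \<open>J = 0\<close>.\<close>
    have e: "?n = real N * (s - t) ^ (N - 1) + (\<Sum>J\<in>{1..N}. ?b J t * ?v J)"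
      unfolding sum_choose_weights[OF N] by (simp add: algebra_simps)
    have "ennreal (?n) * ?W t = ennreal (real N * (s - t) ^ (N - 1)) * ?W t + (\<Sum>J\<in>{1..N}. ennreal (?b J t) * (ennreal (?v J) * ?W t))"
    proof -
      have "ennreal (?n) = ennreal (real N * (s - t) ^ (N - 1)) + ennreal (\<Sum>J\<in>{1..N}. ?b J t * ?v J)"
        unfolding e using t nn by (intro ennreal_plus sum_nonneg mult_nonneg_nonneg) auto
      also have "ennreal (\<Sum>J\<in>{1..N}. ?b J t * ?v J) = (\<Sum>J\<in>{1..N}. ennreal (?b J t) * ennreal (?v J))"
        by (subst sum_ennreal[symmetric], intro mult_nonneg_nonneg nn, intro sum.cong refl ennreal_mult nn)
      finally show ?thesis by (simp only: distrib_right sum_distrib_right mult.assoc)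
    qed
    also have "\<dots> \<le> ennreal (C * (real N * (s - t) ^ (N - 1))) + (\<Sum>J\<in>{1..N}. ennreal (?b J t) * ((?Z t J) + ennreal (?v J * ?r J)))"
    proof (intro add_mono sum_mono mult_left_mono)
      have "ennreal (real N * (s - t) ^ (N - 1)) * ?W t \<le> ennreal (real N * (s - t) ^ (N - 1)) * ennreal C"
        by (intro mult_left_mono W) simp
      then show "ennreal (real N * (s - t) ^ (N - 1)) * ?W t \<le> ennreal (C * (real N * (s - t) ^ (N - 1)))"
        using C t by (simp add: ennreal_mult[symmetric] mult.commute)
      fix J assume J: "J \<in> {1..N}"
      show "ennreal (?v J) * ?W t \<le> (?Z t J) + ennreal (?v J * ?r J)"
      proof (cases "J = N")
        case False
        show ?thesis
        proof (rule Suc.IH)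
          show "(\<lambda>y. g (case_nat t y)) \<in> borel_measurable borel" by measurable
          show "bij_inv (\<lambda>y. g (case_nat t y))" by (rule bij_inv_case_nat[OF Suc.prems(2)])
          show "sup_lipschitz c (\<lambda>y. g (case_nat t y))" using t by (intro sup_lipschitz_case_nat Suc.prems(3)) simp
        qed (use Suc.prems(4) t J False in auto)
      qed simp
    qed simp
    also have "\<dots> = ennreal (C * (real N * (s - t) ^ (N - 1))) + (?S t + ennreal (\<Sum>J\<in>{1..N}. ?b J t * (?v J * ?r J)))"
    proof -
      have "(\<Sum>J\<in>{1..N}. ennreal (?b J t) * ennreal (?v J * ?r J)) = ennreal (\<Sum>J\<in>{1..N}. ?b J t * (?v J * ?r J))"
        by (subst sum_ennreal[symmetric], intro mult_nonneg_nonneg nn, intro sum.cong refl ennreal_mult[symmetric] mult_nonneg_nonneg nn)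
      then show ?thesis by (simp only: distrib_left sum.distrib)
    qed
    also have "\<dots> = ?S t + ennreal (C * (real N * (s - t) ^ (N - 1)) + (\<Sum>J\<in>{1..N}. ?b J t * (?v J * ?r J)))"
    proof -
      have "ennreal (C * (real N * (s - t) ^ (N - 1)) + (\<Sum>J\<in>{1..N}. ?b J t * (?v J * ?r J))) =
        ennreal (C * (real N * (s - t) ^ (N - 1))) + ennreal (\<Sum>J\<in>{1..N}. ?b J t * (?v J * ?r J))"
        using nn C t by (intro ennreal_plus sum_nonneg mult_nonneg_nonneg) auto
      then show ?thesis by (simp only: ac_simps)
    qed
    also have "\<dots> \<le> ?S t + ennreal (E t)"
    proof (intro add_left_mono ennreal_leI)
      have "(\<Sum>J\<in>{1..N}. ?b J t * (?v J * ?r J)) = (\<Sum>J\<in>{1..N}. ?b J t * (?v J * (C * err K (N - J)))) + (\<Sum>J\<in>{1..N}. ?b J t * ?v J) * (c * (s - t) / 2 ^ K)"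
        by (simp only: sum.distrib[symmetric] sum_distrib_right distrib_left mult.assoc)
      also have "(\<Sum>J\<in>{1..N}. ?b J t * (?v J * (C * err K (N - J)))) = (\<Sum>J\<in>{1..N - 1}. ?b J t * (?v J * (C * err K (N - J))))"
      proof (rule sum.mono_neutral_right)
        show "\<forall>J\<in>{1..N} - {1..N - 1}. ?b J t * (?v J * (C * err K (N - J))) = 0"
        proof
          fix J assume "J \<in> {1..N} - {1..N - 1}"
          then have "N - J = 0" by auto
          then show "?b J t * (?v J * (C * err K (N - J))) = 0" by simp
        qed
      qed auto
      also have "\<dots> = (\<Sum>J\<in>{1..N - 1}. (?q J) * (?m t J))"
        by (intro sum.cong refl) (simp only: ac_simps)
      also have "(\<Sum>J\<in>{1..N}. ?b J t * ?v J) * (c * (s - t) / 2 ^ K) \<le> (?n) * (c * (s - t) / 2 ^ K)"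
        unfolding e using t c s by (intro mult_right_mono) auto
      finally show "C * (real N * (s - t) ^ (N - 1)) + (\<Sum>J\<in>{1..N}. ?b J t * (?v J * ?r J)) \<le> E t"
        unfolding E_def by (simp add: algebra_simps)
    qed
    finally show ?thesis .
  qed
  have IE: "(\<integral>\<^sup>+t. ennreal (E t) * indicator {0<..<s} t \<partial>lborel) =
     ennreal (?I)"
  proof -
    have s0: "0 \<le> s" using s by simp
    have 1: "((\<lambda>t. C * (real N * (s - t) ^ (N - 1))) has_integral (C * s ^ N)) {0..s}"
    proof -
      obtain M where M: "N = Suc M" using N by (cases N) auto
      have "((\<lambda>t. C * (real N * (t ^ 0 * (s - t) ^ M))) has_integral (C * (real N * (fact 0 * fact M / fact (0 + M + 1) * s ^ (0 + M + 1))))) {0..s}"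
        by (intro has_integral_mult_right has_integral_beta[OF s0])
      also have "real N * (fact 0 * fact M / fact (0 + M + 1) * s ^ (0 + M + 1)) = s ^ N" by (simp add: M del: of_nat_Suc power_Suc)
      finally show ?thesis by (simp add: M)
    qed
    \<comment> \<open>The beta integral cancels the binomial coefficient, so every \<open>J\<close>
      contributes the same power \<open>s ^ N\<close>. The inherited errors thus enter with equal
      weights, as in \<open>err_Suc\<close>.\<close>
    have 2: "((\<lambda>t. (?q J) * (?m t J)) has_integral (C * err K (N - J) * s ^ N)) {0..s}"
      if J: "J \<in> {1..N - 1}" for J
    proof -
      have "((\<lambda>t. (?q J) * (?m t J)) has_integral
         ((?q J) * (fact J * fact (N - J - 1) / fact (J + (N - J - 1) + 1) * s ^ (J + (N - J - 1) + 1)))) {0..s}"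
        by (intro has_integral_mult_right has_integral_beta[OF s0])
      also have "(?q J) * (fact J * fact (N - J - 1) / fact (J + (N - J - 1) + 1) * s ^ (J + (N - J - 1) + 1)) = C * err K (N - J) * s ^ N"
      proof -
        have "1 \<le> J" "J \<le> N - 1" using J by auto
        then have lt: "J < N" by linarith
        have a: "J + (N - J - 1) + 1 = N" using J by auto
        have b: "real (N choose J) = fact N / (fact J * fact (N - J))" using J by (intro binomial_fact) auto
        have d: "fact (N - J) = real (N - J) * fact (N - J - 1)" using J by (intro fact_reduce) auto
        have "real (N - J) * real (N choose J) * (fact J * fact (N - J - 1) / fact N) = 1"
          unfolding b d using lt by (simp add: field_simps)
        then show ?thesis unfolding a using lt by (simp add: mult.assoc)
      qed
      finally show ?thesis .
    qed
    \<comment> \<open>The remaining length has mean \<open>s / 2\<close> under the uniform stick,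
      which turns \<open>2 ^ K\<close> into \<open>2 ^ Suc K\<close> in the Lipschitz error.\<close>
    have 3: "((\<lambda>t. ?n * (c / 2 ^ K) * (s - t)) has_integral (?n * (c / 2 ^ K) * (s\<^sup>2 / 2))) {0..s}"
    proof -
      have "((\<lambda>t. ?n * (c / 2 ^ K) * (t ^ 0 * (s - t) ^ 1)) has_integral (?n * (c / 2 ^ K) * (fact 0 * fact 1 / fact (0 + 1 + 1) * s ^ (0 + 1 + 1)))) {0..s}"
        by (intro has_integral_mult_right has_integral_beta[OF s0])
      then show ?thesis by (simp add: power2_eq_square)
    qed
    have "(E has_integral (?I)) {0..s}"
      unfolding E_def by (intro has_integral_add has_integral_sum 1 2 3) auto
    then show ?thesis unfolding nn_integral_open_closed
      by (rule nn_integral_has_integral_lebesgue'[rotated]) (use E0 in auto)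
  qed
  have Wm: "?W \<in> borel_measurable borel" by (rule measurable_stick_nn_case_nat[OF gm])
  have Sm: "?S \<in> borel_measurable borel"
    by (intro borel_measurable_sum borel_measurable_times_ennreal measurable_surj_nn_case_nat[OF gm]) measurable
  have Em: "E \<in> borel_measurable borel" unfolding E_def by measurable
  have "ennreal (?n) * stick_nn s g = ennreal (1 / s) * (\<integral>\<^sup>+t. (ennreal (?n) * ?W t) * indicator {0<..<s} t \<partial>lborel)"
    unfolding stick_nn_rec[OF gm s] mult.assoc using Wm by (subst nn_integral_cmult) (auto simp: ac_simps)
  also have "\<dots> \<le> ennreal (1 / s) * (\<integral>\<^sup>+t. ?S t * indicator {0<..<s} t + ennreal (E t) * indicator {0<..<s} t \<partial>lborel)"
    using pw by (intro mult_left_mono nn_integral_mono) (auto simp: indicator_def)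
  also have "\<dots> = ennreal (1 / s) * (\<integral>\<^sup>+t. ?S t * indicator {0<..<s} t \<partial>lborel) + ennreal (1 / s) * (\<integral>\<^sup>+t. ennreal (E t) * indicator {0<..<s} t \<partial>lborel)"
    using Sm Em by (subst nn_integral_add) (auto simp: distrib_left)
  also have "\<dots> \<le> surj_nn N s g + ennreal (?n * (C * err (Suc K) N + c * s / 2 ^ Suc K))"
  proof (rule add_mono)
    show "ennreal (1 / s) * (\<integral>\<^sup>+t. ?S t * indicator {0<..<s} t \<partial>lborel) \<le> surj_nn N s g"
      unfolding surj_nn_rec[OF gm Suc.prems(2) s N] by simp
    have "1 / s * (?I)
      = s ^ (N - 1) * C * (1 + (\<Sum>J\<in>{1..N - 1}. err K (N - J))) + ?n * (c * s / 2 ^ Suc K)"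
    proof -
      obtain M where M: "N = Suc M" using N by (cases N) auto
      have "(\<Sum>J\<in>{1..N - 1}. C * err K (N - J) * s ^ N) = s ^ N * C * (\<Sum>J\<in>{1..N - 1}. err K (N - J))"
        by (simp only: sum_distrib_left ac_simps)
      then show ?thesis using s by (simp add: M field_simps power2_eq_square del: sum.cl_ivl_Suc)
    qed
    also have "(\<Sum>J\<in>{1..N - 1}. err K (N - J)) = (\<Sum>J\<in>{1..N - 1}. err K J)"
      using N by (subst sum.atLeastAtMost_rev) (auto intro!: sum.cong)
    also have "s ^ (N - 1) * C * (1 + (\<Sum>J\<in>{1..N - 1}. err K J)) \<le> s ^ (N - 1) * C * (real N * err (Suc K) N)"
      using s C by (intro mult_left_mono err_Suc[OF N]) auto
    finally have le: "1 / s * (?I)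
       \<le> ?n * (C * err (Suc K) N + c * s / 2 ^ Suc K)" by (simp add: algebra_simps)
    show "ennreal (1 / s) * (\<integral>\<^sup>+t. ennreal (E t) * indicator {0<..<s} t \<partial>lborel) \<le> ennreal (?n * (C * err (Suc K) N + c * s / 2 ^ Suc K))"
    proof -
      have "0 \<le> 1 / s" using s by simp
      show ?thesis unfolding IE ennreal_mult'[OF \<open>0 \<le> 1 / s\<close>, symmetric] by (rule ennreal_leI[OF le])
    qed
  qed
  finally show ?case .
qed

section \<open>Weak convergence\<close>

text \<open>A term of \<open>y\<close> that reaches level \<open>t\<close> reaches
  \<open>t - d\<close> in \<open>z\<close>, so the count that decides the sorted terms by
  \<open>decr_rearr_less_iff\<close> does not decrease. For sorted terms up to \<open>d\<close>,
  nonnegativity is enough.\<close>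

lemma decr_rearr_le_add:
  assumes y: "\<And>i. 0 \<le> y i" "y \<longlonglongrightarrow> 0" and z: "\<And>i. 0 \<le> z i" "z \<longlonglongrightarrow> 0"
    and d: "\<And>i. \<bar>y i - z i\<bar> \<le> d"
  shows "decr_rearr y k \<le> decr_rearr z k + d"
proof (cases "decr_rearr y k \<le> d")
  case True then show ?thesis using decr_rearr_nonneg[OF z, of k] by linarith
next
  case False
  define t where "t = decr_rearr y k"
  have d0: "0 \<le> d" using d[of 0] by linarith
  have t: "d < t" using False by (simp add: t_def)
  have "k < card {i. t \<le> y i}" using decr_rearr_less_iff(2)[OF y, of t k] t d0 by (simp add: t_def)
  also have "\<dots> \<le> card {i. t - d \<le> z i}"
  proof (rule card_mono)
    show "finite {i. t - d \<le> z i}" using t by (intro decr_rearr_less_iff(1)[OF z]) simp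
    show "{i. t \<le> y i} \<subseteq> {i. t - d \<le> z i}"
    proof
      fix i assume "i \<in> {i. t \<le> y i}"
      then show "i \<in> {i. t - d \<le> z i}" using d[of i] by simp
    qed
  qed
  finally have "t - d \<le> decr_rearr z k" using decr_rearr_less_iff(2)[OF z, of "t - d" k] t by simp
  then show ?thesis by (simp add: t_def)
qed

text \<open>The product metric weights the coordinate differences by \<open>(1 / 2) ^ n\<close>, and
  these weights add up to 2.\<close>

lemma dist_seq_le:
  fixes x y :: "nat \<Rightarrow> real"
  assumes "\<And>i. \<bar>x i - y i\<bar> \<le> d" shows "dist x y \<le> 2 * d"
proof -
  let ?f = "\<lambda>n. (1 / 2) ^ n * min (dist (x (from_nat n)) (y (from_nat n))) 1"
  have le: "?f n \<le> d * (1 / 2) ^ n" for n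
    using assms[of "from_nat n"] by (subst mult.commute) (auto simp: dist_real_def intro!: mult_right_mono)
  have g: "(\<lambda>n. d * (1 / 2 :: real) ^ n) sums (d * (1 / (1 - 1 / 2)))"
    by (intro sums_mult geometric_sums) simp
  have s: "summable ?f"
    by (rule summable_comparison_test'[OF sums_summable[OF g], of 0]) (use le in auto)
  have "dist x y = suminf ?f" by (simp add: dist_fun_def)
  also have "\<dots> \<le> (\<Sum>n. d * (1 / 2) ^ n)" by (rule suminf_le[OF le s sums_summable[OF g]])
  also have "\<dots> = 2 * d" using sums_unique[OF g] by simp
  finally show ?thesis .
qed

lemma sup_lipschitz_decr_rearr:
  assumes F: "\<And>x y. F x \<le> F y + L * dist x y" and L: "0 \<le> L" and nn: "\<And>x. 0 \<le> F x"
  shows "sup_lipschitz (2 * L) (\<lambda>y. ennreal (F (decr_rearr y)))"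
  unfolding sup_lipschitz_def
proof (intro allI impI)
  fix y z :: "nat \<Rightarrow> real" and d
  assume *: "\<forall>i. 0 \<le> y i" "y \<longlonglongrightarrow> 0" "\<forall>i. 0 \<le> z i" "z \<longlonglongrightarrow> 0" "\<forall>i. \<bar>y i - z i\<bar> \<le> d"
  have d0: "0 \<le> d" using *(5)[rule_format, of 0] by linarith
  have "\<bar>decr_rearr y k - decr_rearr z k\<bar> \<le> d" for k
    using decr_rearr_le_add[of y z d k] decr_rearr_le_add[of z y d k] * by (simp add: abs_le_iff abs_minus_commute)
  then have "dist (decr_rearr y) (decr_rearr z) \<le> 2 * d" by (rule dist_seq_le)
  then have "L * dist (decr_rearr y) (decr_rearr z) \<le> 2 * L * d" using L by (metis mult.assoc mult.commute mult_left_mono)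
  then have "F (decr_rearr y) \<le> F (decr_rearr z) + 2 * L * d" using F[of "decr_rearr y" "decr_rearr z"] by linarith
  then have "ennreal (F (decr_rearr y)) \<le> ennreal (F (decr_rearr z) + 2 * L * d)" by (rule ennreal_leI)
  also have "\<dots> = ennreal (F (decr_rearr z)) + ennreal (2 * L * d)" using nn L d0 by (intro ennreal_plus) auto
  finally show "ennreal (F (decr_rearr y)) \<le> ennreal (F (decr_rearr z)) + ennreal (2 * L * d)" .
qed

lemma err_tendsto: "(\<lambda>N. err K N) \<longlonglongrightarrow> 0"
  unfolding err_def by real_asymp

text \<open>Dividing \<open>stick_nn_le_surj_nn\<close> by \<open>N = Suc m\<close> leaves the error
  \<open>C * err K N + 2 * L / 2 ^ K\<close>. The number \<open>K\<close> of peeled sticks is fixed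
  first to make the second term small; then \<open>m\<close> grows, since \<open>err\<close> has a
  constant of order \<open>2 ^ K\<close>.\<close>

lemma stick_nn_le_lazy_iter:
  assumes Fm [measurable]: "F \<in> borel_measurable borel"
    and F: "\<And>x y. F x \<le> F y + L * dist x y" and L: "0 \<le> L" and nn: "\<And>x. 0 \<le> F x" and C: "\<And>x. F x \<le> C"
    and e: "0 < e"
  shows "\<forall>\<^sub>F m in sequentially. stick_nn 1 (\<lambda>y. ennreal (F (decr_rearr y))) \<le> (\<integral>\<^sup>+x. ennreal (F x) \<partial>lazy_iter unit_pt m) + ennreal e"
proof -
  let ?g = "\<lambda>y. ennreal (F (decr_rearr y))"
  have C0: "0 \<le> C" using nn[of unit_pt] C[of unit_pt] by linarith
  have "(\<lambda>K. 2 * L * 1 / 2 ^ K) \<longlonglongrightarrow> 0" by real_asymp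
  then have "\<forall>\<^sub>F K in sequentially. 2 * L * 1 / 2 ^ K < e / 2" using e by (intro order_tendstoD) auto
  then obtain K where K: "2 * L * 1 / 2 ^ K < e / 2" by (auto simp: eventually_sequentially)
  have "(\<lambda>N. C * err K (Suc N)) \<longlonglongrightarrow> C * 0"
    by (intro tendsto_mult_left LIMSEQ_Suc err_tendsto)
  then have "\<forall>\<^sub>F N in sequentially. C * err K (Suc N) < e / 2" using e by (intro order_tendstoD) auto
  then show ?thesis
  proof eventually_elim
    case (elim m)
    have inv: "bij_inv ?g" unfolding bij_inv_def using decr_rearr_bij by metis
    have gm: "?g \<in> borel_measurable borel" by measurable
    have Cg: "?g y \<le> ennreal C" for y by (rule ennreal_leI[OF C])
    have "ennreal (real (Suc m)) * stick_nn 1 ?g \<le> surj_nn (Suc m) 1 ?g + ennreal (real (Suc m) * (C * err K (Suc m) + 2 * L * 1 / 2 ^ K))"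
      using stick_nn_le_surj_nn[OF gm inv sup_lipschitz_decr_rearr[OF F L nn] Cg C0 _ _ , of 1 "Suc m" K] L by simp
    also have "\<dots> \<le> surj_nn (Suc m) 1 ?g + ennreal (real (Suc m) * e)"
      using elim K by (intro add_left_mono ennreal_leI mult_left_mono) auto
    finally have "ennreal (1 / real (Suc m)) * (ennreal (real (Suc m)) * stick_nn 1 ?g) \<le>
       ennreal (1 / real (Suc m)) * (surj_nn (Suc m) 1 ?g + ennreal (real (Suc m) * e))" by (rule mult_left_mono) simp
    moreover have "ennreal (1 / real (Suc m)) * (ennreal (real (Suc m)) * X) = X" for X
      by (rule ennreal_inverse_mult_cancel) simp
    moreover have "ennreal (real (Suc m) * e) = ennreal (real (Suc m)) * ennreal e" using e by (intro ennreal_mult) auto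
    moreover have "ennreal (1 / real (Suc m)) * surj_nn (Suc m) 1 ?g = (\<integral>\<^sup>+x. ennreal (F x) \<partial>lazy_iter unit_pt m)"
      unfolding surj_nn_def by (rule nn_integral_lazy_iter_unit_pt[symmetric]) measurable
    ultimately show ?case by (simp only: distrib_left)
  qed
qed

section \<open>\<open>PD1\<close> as the law of the sorted sticks\<close>

lemma nn_integral_prod_unif:
  "(\<integral>\<^sup>+u. (\<Prod>i<n. ennreal (1 - u i)) \<partial>unif_seq) = ennreal ((1 / 2) ^ n)"
proof (induction n)
  case 0
  interpret U: sequence_space "uniform_measure lborel {0..1::real}" by (rule sequence_space_unif)
  show ?case by (simp add: U.emeasure_space_1)
next
  case (Suc n)
  interpret U: sequence_space "uniform_measure lborel {0..1::real}" by (rule sequence_space_unif)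
  let ?U = "uniform_measure lborel {0..1::real}"
  have c: "(\<lambda>(a, u). case_nat a u) \<in> ?U \<Otimes>\<^sub>M unif_seq \<rightarrow>\<^sub>M unif_seq" by measurable
  have m: "(\<lambda>u. \<Prod>i<n. ennreal (1 - u i)) \<in> borel_measurable unif_seq" for n by measurable
  have "(\<integral>\<^sup>+u. (\<Prod>i<Suc n. ennreal (1 - u i)) \<partial>unif_seq) = (\<integral>\<^sup>+u. (\<Prod>i<Suc n. ennreal (1 - u i)) \<partial>distr (?U \<Otimes>\<^sub>M unif_seq) unif_seq (\<lambda>(a, u). case_nat a u))"
    unfolding U.PiM_iter ..
  also have "\<dots> = (\<integral>\<^sup>+p. (\<Prod>i<Suc n. ennreal (1 - (case p of (a, u) \<Rightarrow> case_nat a u) i)) \<partial>(?U \<Otimes>\<^sub>M unif_seq))"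
    by (rule nn_integral_distr[OF c]) (use m[of "Suc n"] in simp)
  also have "\<dots> = (\<integral>\<^sup>+a. \<integral>\<^sup>+u. (\<Prod>i<Suc n. ennreal (1 - case_nat a u i)) \<partial>unif_seq \<partial>?U)"
    using U.nn_integral_fst[OF measurable_compose[OF c m[of "Suc n"]], symmetric] by (simp del: prod.lessThan_Suc)
  also have "\<dots> = (\<integral>\<^sup>+a. ennreal (1 - a) * ennreal ((1 / 2) ^ n) \<partial>?U)"
    unfolding prod.lessThan_Suc_shift by (simp add: nn_integral_cmult[OF m] Suc)
  also have "\<dots> = (\<integral>\<^sup>+a. ennreal (1 - a) \<partial>?U) * ennreal ((1 / 2) ^ n)"
    by (rule nn_integral_multc) simp
  also have "(\<integral>\<^sup>+a. ennreal (1 - a) \<partial>?U) = ennreal (1 / 2)"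
  proof -
    have "(\<integral>\<^sup>+a. ennreal (1 - a) \<partial>?U) = (\<integral>\<^sup>+a. ennreal (a ^ 0 * (1 - a) ^ 1) * indicator {0..1} a \<partial>lborel)"
      by (subst nn_integral_uniform_measure) (auto simp: divide_ennreal_def)
    also have "\<dots> = ennreal (fact 0 * fact 1 / fact (0 + 1 + 1) * 1 ^ (0 + 1 + 1))"
      by (rule nn_integral_has_integral_lebesgue'[OF _ has_integral_beta]) auto
    finally show ?thesis by simp
  qed
  also have "ennreal (1 / 2) * ennreal ((1 / 2) ^ n) = ennreal ((1 / 2) ^ Suc n)" by (subst ennreal_mult[symmetric]) simp_all
  finally show ?case .
qed

text \<open>The unbroken length after \<open>n\<close> sticks has mean \<open>(1 / 2) ^ n\<close>
  and decreases in \<open>n\<close>, so its limit is 0 almost surely and the partial sums of the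
  sticks tend to 1.\<close>

lemma AE_stick_breaking_sums: "AE u in unif_seq. decr_rearr (stick_breaking u) \<in> Sigma1"
proof -
  have "(\<integral>\<^sup>+u. (INF n. \<Prod>i<n. ennreal (1 - u i)) \<partial>unif_seq) \<le> ennreal ((1 / 2) ^ n)" for n
    unfolding nn_integral_prod_unif[symmetric] by (intro nn_integral_mono INF_lower) simp
  moreover have "(\<lambda>n. ennreal ((1 / 2) ^ n)) \<longlonglongrightarrow> ennreal 0" by (intro tendsto_ennrealI LIMSEQ_power_zero) simp
  ultimately have "(\<integral>\<^sup>+u. (INF n. \<Prod>i<n. ennreal (1 - u i)) \<partial>unif_seq) \<le> ennreal 0"
    by (intro LIMSEQ_le_const) auto
  then have "(\<integral>\<^sup>+u. (INF n. \<Prod>i<n. ennreal (1 - u i)) \<partial>unif_seq) = 0" by simp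
  moreover have "(\<lambda>u. INF n. \<Prod>i<n. ennreal (1 - u i)) \<in> borel_measurable unif_seq" by measurable
  ultimately have "AE u in unif_seq. (INF n. \<Prod>i<n. ennreal (1 - u i)) = 0" by (simp add: nn_integral_0_iff_AE)
  then show ?thesis using AE_unif_seq
  proof eventually_elim
    case (elim u)
    note b = stick_breaking_bounds[OF elim(2)]
    have p: "(\<Prod>i<n. ennreal (1 - u i)) = ennreal (\<Prod>i<n. 1 - u i)" for n
      using elim(2) by (intro prod_ennreal) auto
    have nn: "0 \<le> (\<Prod>i<n. 1 - u i)" for n using elim(2) by (intro prod_nonneg) auto
    have dec: "decseq (\<lambda>n. ennreal (\<Prod>i<n. 1 - u i))"
    proof (rule decseq_SucI, rule ennreal_leI)
      fix n show "(\<Prod>i<Suc n. 1 - u i) \<le> (\<Prod>i<n. 1 - u i)"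
        using mult_left_mono[of "1 - u n" 1 "\<Prod>i<n. 1 - u i"] nn[of n] elim(2) by simp
    qed
    have "(\<lambda>n. ennreal (\<Prod>i<n. 1 - u i)) \<longlonglongrightarrow> ennreal 0"
      using LIMSEQ_INF[OF dec] elim(1) by (simp add: p)
    then have "(\<lambda>n. \<Prod>i<n. 1 - u i) \<longlonglongrightarrow> 0" using nn by (subst (asm) tendsto_ennreal_iff) auto
    then have "(\<lambda>n. 1 - (\<Prod>i<n. 1 - u i)) \<longlonglongrightarrow> 1 - 0" by (intro tendsto_intros)
    then have "stick_breaking u sums 1" by (simp add: sums_def sum_stick_breaking)
    then show ?case using b(1) by (intro decr_rearr_Sigma1)
  qed
qed

lemma sets_PD1: "sets PD1 = sets Sigma1_borel"
  unfolding PD1_def by (rule sets_restrict_space_cong) simp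

lemma space_PD1: "space PD1 = Sigma1"
  using sets_eq_imp_space_eq[OF sets_PD1] by (simp add: space_restrict_space)

lemma nn_integral_PD1:
  assumes "F \<in> borel_measurable borel"
  shows "(\<integral>\<^sup>+x. F x \<partial>PD1) = stick_nn 1 (\<lambda>y. F (decr_rearr y))"
proof -
  have "(\<integral>\<^sup>+x. F x \<partial>PD1) = (\<integral>\<^sup>+x. F x * indicator Sigma1 x \<partial>distr unif_seq borel (\<lambda>u. decr_rearr (stick_breaking u)))"
    unfolding PD1_def by (rule nn_integral_restrict_space) (simp add: sets_Sigma1)
  also have "\<dots> = (\<integral>\<^sup>+u. F (decr_rearr (stick_breaking u)) * indicator Sigma1 (decr_rearr (stick_breaking u)) \<partial>unif_seq)"
    using assms sets_Sigma1 by (intro nn_integral_distr measurable_PD1) auto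
  also have "\<dots> = (\<integral>\<^sup>+u. F (decr_rearr (\<lambda>i. 1 * stick_breaking u i)) \<partial>unif_seq)"
    using AE_stick_breaking_sums by (intro nn_integral_cong_AE) (auto elim!: eventually_mono)
  finally show ?thesis unfolding stick_nn_def .
qed

lemma prob_space_PD1: "prob_space PD1"
proof
  interpret U: sequence_space "uniform_measure lborel {0..1::real}" by (rule sequence_space_unif)
  have "emeasure PD1 (space PD1) = (\<integral>\<^sup>+x. 1 \<partial>PD1)" by simp
  also have "\<dots> = stick_nn 1 (\<lambda>y. 1)" by (rule nn_integral_PD1) simp
  also have "\<dots> = 1" by (simp add: stick_nn_def U.emeasure_space_1)
  finally show "emeasure PD1 (space PD1) = 1" .
qed

text \<open>The inf-convolution of \<open>h\<close> with \<open>n * dist\<close>, capped at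
  \<open>C\<close>. For \<open>0 \<le> h \<le> C\<close> on \<open>Sigma1\<close> it is
  \<open>n\<close>-Lipschitz on the whole sequence space, hence Borel there, although
  \<open>h\<close> is controlled only on \<open>Sigma1\<close>.\<close>

definition lip_approx :: "real \<Rightarrow> ((nat \<Rightarrow> real) \<Rightarrow> real) \<Rightarrow> nat \<Rightarrow> (nat \<Rightarrow> real) \<Rightarrow> real" where
  "lip_approx C h n x = (INF y\<in>Sigma1. min C (h y + real n * dist x y))"

context
  fixes h :: "(nat \<Rightarrow> real) \<Rightarrow> real" and C :: real
  assumes h: "\<And>x. x \<in> Sigma1 \<Longrightarrow> 0 \<le> h x" "\<And>x. x \<in> Sigma1 \<Longrightarrow> h x \<le> C" and cont: "continuous_on Sigma1 h"
begin

lemma bound_nonneg: "0 \<le> C"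
  using h[OF unit_pt_Sigma1] by linarith

lemma Sigma1_nonempty: "Sigma1 \<noteq> {}"
  using unit_pt_Sigma1 by auto

lemma lip_approx_bdd: "bdd_below ((\<lambda>y. min C (h y + real n * dist x y)) ` Sigma1)"
  by (rule bdd_belowI2[of _ 0]) (simp add: bound_nonneg h add_nonneg_nonneg)

lemma lip_approx_le: "y \<in> Sigma1 \<Longrightarrow> lip_approx C h n x \<le> min C (h y + real n * dist x y)"
  unfolding lip_approx_def by (rule cINF_lower[OF lip_approx_bdd])

lemma lip_approx_ge: "(\<And>y. y \<in> Sigma1 \<Longrightarrow> c \<le> min C (h y + real n * dist x y)) \<Longrightarrow> c \<le> lip_approx C h n x"
  unfolding lip_approx_def by (rule cINF_greatest[OF Sigma1_nonempty])

lemma lip_approx_nonneg: "0 \<le> lip_approx C h n x"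
  by (rule lip_approx_ge) (simp add: bound_nonneg h add_nonneg_nonneg)

lemma lip_approx_le_C: "lip_approx C h n x \<le> C"
  using lip_approx_le[OF unit_pt_Sigma1, of n x] by simp

lemma lip_approx_le_h: "x \<in> Sigma1 \<Longrightarrow> lip_approx C h n x \<le> h x"
  using lip_approx_le[of x n x] by simp

lemma lip_approx_lipschitz: "lip_approx C h n x \<le> lip_approx C h n z + real n * dist x z"
proof -
  have "lip_approx C h n x - real n * dist x z \<le> lip_approx C h n z"
  proof (rule lip_approx_ge)
    fix y assume y: "y \<in> Sigma1"
    have "real n * dist x y \<le> real n * (dist x z + dist z y)" by (intro mult_left_mono dist_triangle) simp
    then have "real n * dist x y \<le> real n * dist x z + real n * dist z y" by (simp only: distrib_left)
    moreover have "0 \<le> real n * dist x z" by simp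
    moreover have "lip_approx C h n x \<le> C" "lip_approx C h n x \<le> h y + real n * dist x y"
      using lip_approx_le[OF y, of n x] by simp_all
    ultimately show "lip_approx C h n x - real n * dist x z \<le> min C (h y + real n * dist z y)"
      by (intro min.boundedI) linarith+
  qed
  then show ?thesis by simp
qed

lemma lip_approx_mono: "n \<le> m \<Longrightarrow> lip_approx C h n x \<le> lip_approx C h m x"
proof (rule lip_approx_ge)
  fix y assume nm: "n \<le> m" and y: "y \<in> Sigma1"
  have "real n * dist x y \<le> real m * dist x y" using nm by (intro mult_right_mono) auto
  then show "lip_approx C h n x \<le> min C (h y + real m * dist x y)"
    using lip_approx_le[OF y, of n x] by linarith
qed

lemma measurable_lip_approx: "lip_approx C h n \<in> borel_measurable borel"
proof (rule borel_measurable_continuous_onI)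
  have "(real n)-lipschitz_on UNIV (lip_approx C h n)"
  proof (rule lipschitz_onI)
    fix x z
    show "dist (lip_approx C h n x) (lip_approx C h n z) \<le> real n * dist x z"
      using lip_approx_lipschitz[of n x z] lip_approx_lipschitz[of n z x] by (simp add: dist_real_def abs_le_iff dist_commute)
  qed simp
  then show "continuous_on UNIV (lip_approx C h n)" by (rule lipschitz_on_continuous_on)
qed

text \<open>Near \<open>x\<close>, continuity keeps \<open>h y\<close> above \<open>h x - e\<close>;
  at distance at least \<open>d\<close> the penalty is at least \<open>n * d\<close>, which exceeds
  the bound \<open>C\<close> once \<open>n > C / d\<close>.\<close>

lemma lip_approx_SUP: 
  assumes x: "x \<in> Sigma1" shows "(SUP n. ennreal (lip_approx C h n x)) = ennreal (h x)"
proof (rule antisym)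
  show "(SUP n. ennreal (lip_approx C h n x)) \<le> ennreal (h x)"
    by (intro SUP_least ennreal_leI lip_approx_le_h x)
  show "ennreal (h x) \<le> (SUP n. ennreal (lip_approx C h n x))"
  proof (rule ennreal_le_epsilon)
    fix e :: real assume e: "0 < e"
    obtain d where d: "d > 0" "\<And>y. y \<in> Sigma1 \<Longrightarrow> dist y x < d \<Longrightarrow> dist (h y) (h x) < e"
      using cont x e unfolding continuous_on_iff by metis
    obtain n where n: "C / d < real n" using reals_Archimedean2 by blast
    have "h x - e \<le> lip_approx C h n x"
    proof (rule lip_approx_ge)
      fix y assume y: "y \<in> Sigma1"
      have "h x - e \<le> h y + real n * dist x y"
      proof (cases "dist y x < d")
        case True
        then have "h x - e \<le> h y" using d(2)[OF y] by (simp add: dist_real_def abs_less_iff)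
        moreover have "0 \<le> real n * dist x y" by simp
        ultimately show ?thesis by linarith
      next
        case False
        have "C \<le> real n * d" using n d(1) by (simp add: pos_divide_less_eq less_imp_le)
        also have "\<dots> \<le> real n * dist x y" using False by (intro mult_left_mono) (auto simp: dist_commute)
        finally show ?thesis using h(2)[OF x] h(1)[OF y] e by linarith
      qed
      then show "h x - e \<le> min C (h y + real n * dist x y)" using h(2)[OF x] e by simp
    qed
    then have "ennreal (h x) \<le> ennreal (lip_approx C h n x + e)" by (intro ennreal_leI) simp
    also have "\<dots> = ennreal (lip_approx C h n x) + ennreal e" using e lip_approx_nonneg by (intro ennreal_plus) auto
    also have "\<dots> \<le> (SUP n. ennreal (lip_approx C h n x)) + ennreal e" by (intro add_right_mono SUP_upper) simp
    finally show "ennreal (h x) \<le> (SUP n. ennreal (lip_approx C h n x)) + ennreal e" .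
  qed
qed

text \<open>Some Lipschitz minorant of \<open>h\<close> already has mean above \<open>c\<close>
  under \<open>PD1\<close>. The comparison with stick breaking bounds its mean from below at all
  late times of the chain from \<open>unit_pt\<close>, and the almost sure visit to
  \<open>unit_pt\<close> carries this bound over to the start \<open>x\<close>.\<close>

lemma eventually_less_nn_integral_lazy_iter:
  assumes x: "x \<in> Sigma1" "hit_prob x = 1" and c: "c < (\<integral>\<^sup>+z. ennreal (h z) \<partial>PD1)"
  shows "\<forall>\<^sub>F m in sequentially. c < (\<integral>\<^sup>+z. ennreal (h z) \<partial>lazy_iter x m)"
proof -
  let ?F = "\<lambda>n x. ennreal (lip_approx C h n x)"
  have Fm: "?F n \<in> borel_measurable borel" for n using measurable_lip_approx[of n] by measurable
  have FPD: "?F n \<in> borel_measurable PD1" for n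
    by (subst measurable_cong_sets[OF sets_PD1 refl]) (rule borel_measurable_Sigma1_borel[OF Fm])
  have "(\<integral>\<^sup>+z. ennreal (h z) \<partial>PD1) = (\<integral>\<^sup>+z. (SUP n. ?F n z) \<partial>PD1)"
    by (intro nn_integral_cong) (simp add: space_PD1 lip_approx_SUP)
  also have "\<dots> = (SUP n. \<integral>\<^sup>+z. ?F n z \<partial>PD1)"
    by (rule nn_integral_monotone_convergence_SUP[OF _ FPD]) (auto simp: incseq_def le_fun_def intro!: ennreal_leI lip_approx_mono)
  finally obtain n where n: "c < (\<integral>\<^sup>+z. ?F n z \<partial>PD1)" using c by (auto simp: less_SUP_iff)
  define Q where "Q = (\<integral>\<^sup>+z. ?F n z \<partial>PD1)"
  have Q: "Q = stick_nn 1 (\<lambda>y. ennreal (lip_approx C h n (decr_rearr y)))"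
    unfolding Q_def by (rule nn_integral_PD1[OF Fm])
  have Qfin: "Q < \<top>"
  proof -
    interpret P: prob_space PD1 by (rule prob_space_PD1)
    have "Q \<le> (\<integral>\<^sup>+z. ennreal C \<partial>PD1)" unfolding Q_def by (intro nn_integral_mono ennreal_leI lip_approx_le_C)
    also have "\<dots> = ennreal C" by (simp add: P.emeasure_space_1)
    finally show ?thesis by (rule order_le_less_trans) simp
  qed
  \<comment> \<open>The gap between \<open>I\<close> and \<open>Q\<close> is the error allowed for
    the chain from \<open>unit_pt\<close>; the gap between \<open>c\<close> and \<open>I\<close>
    absorbs the paths from \<open>x\<close> that have not yet visited it.\<close>
  obtain I where I: "c < I" "I < Q" using n dense unfolding Q_def by blast
  define e where "e = enn2real Q - enn2real I"
  have e: "0 < e" unfolding e_def using I(2) Qfin by (simp add: enn2real_less_iff less_trans)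
  have Ie: "I + ennreal e = Q"
  proof -
    have "I = ennreal (enn2real I)" "Q = ennreal (enn2real Q)" using I(2) Qfin by (auto simp: less_trans)
    then show ?thesis using e by (metis e_def add.commute diff_add_cancel enn2real_nonneg ennreal_plus less_imp_le)
  qed
  have "\<forall>\<^sub>F m in sequentially. Q \<le> (\<integral>\<^sup>+x. ?F n x \<partial>lazy_iter unit_pt m) + ennreal e"
    unfolding Q by (rule stick_nn_le_lazy_iter[OF measurable_lip_approx lip_approx_lipschitz _ lip_approx_nonneg lip_approx_le_C e]) simp
  then obtain m0 where m0: "\<And>j. m0 \<le> j \<Longrightarrow> Q \<le> (\<integral>\<^sup>+x. ?F n x \<partial>lazy_iter unit_pt j) + ennreal e"
    by (auto simp: eventually_sequentially)
  have Ij: "I \<le> (lazy_op ^^ j) (?F n) unit_pt" if "m0 \<le> j" for j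
  proof (rule ccontr)
    assume "\<not> I \<le> (lazy_op ^^ j) (?F n) unit_pt"
    then have "(lazy_op ^^ j) (?F n) unit_pt + ennreal e < I + ennreal e"
      by (simp add: not_le add.commute[of _ "ennreal e"] ennreal_add_left_cancel_less)
    then show False using m0[OF that] unfolding nn_integral_lazy_iter[OF unit_pt_Sigma1 Fm] Ie by simp
  qed
  have "\<forall>\<^sub>F m in sequentially. c < (lazy_op ^^ m) (?F n) x"
    by (rule eventually_le_lazy_op_funpow[OF Fm Ij x I(1)])
  then show ?thesis
  proof eventually_elim
    case (elim m)
    have "(\<integral>\<^sup>+z. ?F n z \<partial>lazy_iter x m) \<le> (\<integral>\<^sup>+z. ennreal (h z) \<partial>lazy_iter x m)"
      by (intro nn_integral_mono ennreal_leI lip_approx_le_h) (simp add: space_lazy_iter[OF x(1)])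
    from less_le_trans[OF elim this[unfolded nn_integral_lazy_iter[OF x(1) Fm]]] show ?case .
  qed
qed

lemma integral_eq_nn_integral_Sigma1:
  assumes s: "sets M = sets Sigma1_borel" and P: "prob_space M"
  shows "integrable M h" "(\<integral>\<^sup>+z. ennreal (h z) \<partial>M) = ennreal (\<integral>z. h z \<partial>M)" "0 \<le> (\<integral>z. h z \<partial>M)"
proof -
  interpret prob_space M by (rule P)
  have sp: "space M = Sigma1" using sets_eq_imp_space_eq[OF s] by (simp add: space_restrict_space)
  have m: "h \<in> borel_measurable M"
    by (subst measurable_cong_sets[OF s refl]) (rule borel_measurable_continuous_on_restrict[OF cont])
  have nn: "AE z in M. 0 \<le> h z" by (rule AE_I2) (simp add: sp h)
  show i: "integrable M h"
    by (rule integrable_const_bound[of _ C, OF _ m]) (auto intro!: AE_I2 simp: sp h)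
  show "(\<integral>\<^sup>+z. ennreal (h z) \<partial>M) = ennreal (\<integral>z. h z \<partial>M)" by (rule nn_integral_eq_integral[OF i nn])
  show "0 \<le> (\<integral>z. h z \<partial>M)" by (rule integral_nonneg_AE[OF nn])
qed

lemma eventually_less_integral_lazy_iter:
  assumes x: "x \<in> Sigma1" "hit_prob x = 1" and e: "0 < e"
  shows "\<forall>\<^sub>F m in sequentially. (\<integral>z. h z \<partial>PD1) - e < (\<integral>z. h z \<partial>lazy_iter x m)"
proof (cases "(\<integral>z. h z \<partial>PD1) - e < 0")
  case True
  then show ?thesis
    using integral_eq_nn_integral_Sigma1(3)[OF sets_lazy_iter[OF x(1)] prob_space_lazy_iter[OF x(1)]]
    by (intro always_eventually allI) (rule less_le_trans)
next
  case False
  have "ennreal ((\<integral>z. h z \<partial>PD1) - e) < (\<integral>\<^sup>+z. ennreal (h z) \<partial>PD1)"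
    unfolding integral_eq_nn_integral_Sigma1(2)[OF sets_PD1 prob_space_PD1]
    using False e by (intro ennreal_lessI) auto
  from eventually_less_nn_integral_lazy_iter[OF x this] show ?thesis
  proof eventually_elim
    case (elim m)
    then show ?case
      unfolding integral_eq_nn_integral_Sigma1(2)[OF sets_lazy_iter[OF x(1)] prob_space_lazy_iter[OF x(1)]]
      using False by (subst (asm) ennreal_less_iff) auto
  qed
qed

end

text \<open>Lower bounds for \<open>f + B\<close> and for \<open>B - f\<close>, both nonnegative on
  the simplex, enclose the integral of \<open>f\<close> from two sides, because all measures
  involved have mass 1.\<close>

lemma weakly_converges_PD1:
  assumes x: "x \<in> Sigma1" "hit_prob x = 1"
  shows "weakly_converges (lazy_iter x) PD1"
  unfolding weakly_converges_def
proof (intro allI impI)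
  fix f :: "(nat \<Rightarrow> real) \<Rightarrow> real" assume f: "continuous_on Sigma1 f" "bounded (f ` Sigma1)"
  obtain B where B: "\<And>z. z \<in> Sigma1 \<Longrightarrow> \<bar>f z\<bar> \<le> B" using f(2) by (auto simp: bounded_iff)
  have p: "0 \<le> f z + B" "f z + B \<le> 2 * B" "0 \<le> B - f z" "B - f z \<le> 2 * B" if "z \<in> Sigma1" for z
    using B[OF that] by auto
  have c: "continuous_on Sigma1 (\<lambda>z. f z + B)" "continuous_on Sigma1 (\<lambda>z. B - f z)"
    by (intro continuous_intros f)+
  have i: "integrable M f" "(\<integral>z. f z + B \<partial>M) = (\<integral>z. f z \<partial>M) + B" "(\<integral>z. B - f z \<partial>M) = B - (\<integral>z. f z \<partial>M)"
    if s: "sets M = sets Sigma1_borel" and P: "prob_space M" for M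
  proof -
    interpret prob_space M by (rule P)
    have "integrable M (\<lambda>z. f z + B)" by (rule integral_eq_nn_integral_Sigma1(1)[where h="\<lambda>z. f z + B" and C="2 * B", OF p(1,2) c(1) s P])
    then have "integrable M (\<lambda>z. (f z + B) - B)" by (intro Bochner_Integration.integrable_diff) auto
    then show i: "integrable M f" by simp
    show "(\<integral>z. f z + B \<partial>M) = (\<integral>z. f z \<partial>M) + B" "(\<integral>z. B - f z \<partial>M) = B - (\<integral>z. f z \<partial>M)"
      using i by (simp_all add: prob_space)
  qed
  show "(\<lambda>m. \<integral>z. f z \<partial>lazy_iter x m) \<longlonglongrightarrow> (\<integral>z. f z \<partial>PD1)"
  proof (rule tendstoI)
    fix e :: real assume e: "0 < e"
    note L = i(2,3)[OF sets_lazy_iter[OF x(1)] prob_space_lazy_iter[OF x(1)]] i(2,3)[OF sets_PD1 prob_space_PD1]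
    have "\<forall>\<^sub>F m in sequentially. (\<integral>z. f z + B \<partial>PD1) - e < (\<integral>z. f z + B \<partial>lazy_iter x m)"
      by (rule eventually_less_integral_lazy_iter[OF p(1,2) c(1) x e])
    moreover have "\<forall>\<^sub>F m in sequentially. (\<integral>z. B - f z \<partial>PD1) - e < (\<integral>z. B - f z \<partial>lazy_iter x m)"
      by (rule eventually_less_integral_lazy_iter[OF p(3,4) c(2) x e])
    ultimately show "\<forall>\<^sub>F m in sequentially. dist (\<integral>z. f z \<partial>lazy_iter x m) (\<integral>z. f z \<partial>PD1) < e"
      by eventually_elim (simp add: L dist_real_def abs_less_iff)
  qed
qed

theorem mainTheorem2:
  fixes n :: nat
  assumes "n \<ge> 1"
  shows "AE x in face_lebesgue n.
    weakly_converges (\<lambda>m. (lazy_split_merge ^^ m) (return Sigma1_borel x)) PD1"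
  using AE_face_lebesgue_hit_prob[OF assms] by eventually_elim (blast intro: weakly_converges_PD1)

end
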